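(* Suppose that for a total monomial order $<'$ on $\mathbb C[P]$ the determinants $D_{i_1,\dots,i_k}$, $(i_1,\dots,i_k)\in\Theta$, form a sagbi basis of $\mathcal R$ with respect to $<'$. Then for every integral dominant $\mathfrak{sp}_{2n}(\mathbb C)$-weight $\lambda$ the vectors $f^dv_\lambda$ with $d\in\mathbb Z_{\ge0}^P$ such that $z^d\in\mathrm{in}_{<'}\mathcal R[\lambda]$ form a basis of $V_\lambda$.
   Context: Fix $n\ge1$ and the totally ordered set $N=\{1\lessdot\dots\lessdot n\lessdot -n\lessdot\dots\lessdot -1\}$. Let $P$ be the set of integer pairs $(i,j)$ with $1\le i\le n$, $i\le|j|\le n$, let $A=\{(i,i)\}_{1\le i\le n}$, and $\mathbb C[P]=\mathbb C[z_{i,j}]_{(i,j)\in P}$, $z^d=\prod z_{i,j}^{d_{i,j}}$. A tuple in $N$ is admissible if its elements are distinct and for each $l\in[1,n]$ at most $l$ of them have absolute value $\le l$. $\Theta$ is the set of admissible tuples $(i_1\lessdot\dots\lessdot i_k)$, $k\in[1,n]$. For $(i_1,\dots,i_k)\in\Theta$ let $D_{i_1,\dots,i_k}\in\mathbb C[P]$ be the determinant of the matrix with rows $1,\dots,k$ and columns $i_1,\dots,i_k$ whose entry in row $a$ and column $b$ is $z_{a,b}$ if $|b|\ge a$ and $0$ otherwise. $\mathcal R\subset\mathbb C[P]$ is the subalgebra generated by all $D_{i_1,\dots,i_k}$. A total monomial order is a total order on monomials with $M_1<'M_2\iff M_1x<'M_2x$ for every variable $x$. $\mathrm{in}_{<'}p$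 is the term of $p$ with $<'$-maximal monomial; for a subspace $U$, $\mathrm{in}_{<'}U=\mathrm{span}\{\mathrm{in}_{<'}p:p\in U\}$. A generating set $\{p_t\}$ of a subalgebra $U$ is a sagbi basis if $\{\mathrm{in}_{<'}p_t\}$ generates the algebra $\mathrm{in}_{<'}U$. $\mathfrak g=\mathfrak{sp}_{2n}(\mathbb C)\subset\mathfrak{gl}(\mathbb C^N)$; for $(i,j)\in P\setminus A$ the negative root vectors are $f_{i,j}=E_{j,i}-E_{-i,-j}$ if $j\in[i+1,n]$ and $f_{i,j}=E_{j,i}+E_{-i,-j}$ if $j\in[-n,-i]$ ($E_{a,b}$ is the matrix unit in row $a$, column $b$). The fundamental weights are $\omega_k=\varepsilon_1+\dots+\varepsilon_k$, where $\varepsilon_1,\dots,\varepsilon_n$ is the standard basis of $\mathfrak h^*$; integral dominant weights are $\lambda=\sum a_k\omega_k$, $a_k\in\mathbb Z_{\ge0}$. $V_\lambda$ is the irreducible representation with highest weight $\lambda$ and highest-weight vector $v_\lambda$. For $d\in\mathbb Z_{\ge0}^P$, $f^d=\prod_{(i,j)\in P\setminus A}f_{i,j}^{d_{i,j}}$ ordered first by $i$ increasing and then by $j$ $\lessdot$-increasing from left to right. $\mathbb C[P]$ is graded by integral weights via $\mathrm{grad}\,z_{i,j}=\varepsilon_i$, so $\mathrm{grad}\,D_{i_1,\dots,i_k}=\omega_k$; $\mathcal R[\lambda]$ is the component of $\mathcal R$ of grading $\lambda$. *)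

theory Defs
  imports
    "HOL-Library.Poly_Mapping"
    "Jordan_Normal_Form.Determinant"
begin

section \<open>The index sets\<close>

definition Nset :: "nat \<Rightarrow> int set" where
  "Nset n = {1..int n} \<union> {- int n..- 1}"

definition prec :: "int \<Rightarrow> int \<Rightarrow> bool" (infix \<open>\<lessdot>\<close> 50) where
  "a \<lessdot> b \<longleftrightarrow> 0 < a \<and> b < 0 \<or> 0 < a \<and> a < b \<or> a < b \<and> b < 0"

text \<open>The elements of \<open>Nset n\<close> in \<open>\<lessdot>\<close>-increasing order; the entry at position \<open>r\<close> labels
  row and column \<open>r\<close> of the matrices acting on $\mathbb{C}^N$.\<close>

definition N_list :: "nat \<Rightarrow> int list" where
  "N_list n = [1..int n] @ [- int n..- 1]"

definition Pset :: "nat \<Rightarrow> (int \<times> int) set" where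
  "Pset n = {(i, j). 1 \<le> i \<and> i \<le> int n \<and> i \<le> \<bar>j\<bar> \<and> \<bar>j\<bar> \<le> int n}"

definition Aset :: "nat \<Rightarrow> (int \<times> int) set" where
  "Aset n = {(i, i) | i. 1 \<le> i \<and> i \<le> int n}"

definition admissible :: "nat \<Rightarrow> int list \<Rightarrow> bool" where
  "admissible n is \<longleftrightarrow> set is \<subseteq> Nset n \<and> distinct is \<and>
     (\<forall>l\<in>{1..n}. length (filter (\<lambda>i. \<bar>i\<bar> \<le> int l) is) \<le> l)"

definition Theta :: "nat \<Rightarrow> int list set" where
  "Theta n = {is. admissible n is \<and> sorted_wrt (\<lessdot>) is \<and> length is \<in> {1..n}}"


section \<open>The polynomial ring and the determinants\<close>

text \<open>Variables are indexed by all pairs of integers; the polynomial ring $\mathbb{C}[P]$ consists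
  of the polynomials all of whose monomials lie in \<open>monomials n\<close>. A monomial $z^d$ is identified
  with its exponent \<open>d\<close>, so that multiplication of monomials is addition.\<close>

type_synonym mono = "(int \<times> int) \<Rightarrow>\<^sub>0 nat"
type_synonym cpoly = "mono \<Rightarrow>\<^sub>0 complex"

definition monomials :: "nat \<Rightarrow> mono set" where
  "monomials n = {d. Poly_Mapping.keys d \<subseteq> Pset n}"

definition var_exp :: "int \<times> int \<Rightarrow> mono" where
  "var_exp ij = Poly_Mapping.single ij 1"

definition monomial :: "mono \<Rightarrow> cpoly" where
  "monomial d = Poly_Mapping.single d 1"

definition zvar :: "int \<Rightarrow> int \<Rightarrow> cpoly" where
  "zvar i j = monomial (var_exp (i, j))"

definition poly_scale :: "complex \<Rightarrow> cpoly \<Rightarrow> cpoly" where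
  "poly_scale c p = Poly_Mapping.single 0 c * p"

lemma vector_space_poly_scale: "vector_space poly_scale"
  by unfold_locales
    (simp_all add: poly_scale_def algebra_simps single_add mult_single flip: mult.assoc)

text \<open>The matrix below is indexed from 0, so its row \<open>r\<close> is row \<open>r + 1\<close> of the determinant.\<close>

definition Ddet :: "int list \<Rightarrow> cpoly" where
  "Ddet is = det (mat (length is) (length is)
     (\<lambda>(r, c). let a = int r + 1; b = is ! c in if \<bar>b\<bar> \<ge> a then zvar a b else 0))"

definition subalgebra :: "cpoly set \<Rightarrow> bool" where
  "subalgebra S \<longleftrightarrow> module.subspace poly_scale S \<and> 1 \<in> S \<and> (\<forall>p\<in>S. \<forall>q\<in>S. p * q \<in> S)"

definition algebra_generated :: "cpoly set \<Rightarrow> cpoly set" where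
  "algebra_generated B = subalgebra hull B"

definition Ralg :: "nat \<Rightarrow> cpoly set" where
  "Ralg n = algebra_generated (Ddet ` Theta n)"


section \<open>Monomial orders, initial subspaces and sagbi bases\<close>

text \<open>The order is not required to be a well-order, nor to have 1 as its least element.\<close>

definition total_monomial_order :: "nat \<Rightarrow> (mono \<Rightarrow> mono \<Rightarrow> bool) \<Rightarrow> bool" where
  "total_monomial_order n lt \<longleftrightarrow>
     irreflp_on (monomials n) lt \<and> transp_on (monomials n) lt \<and> totalp_on (monomials n) lt \<and>
     (\<forall>d\<in>monomials n. \<forall>e\<in>monomials n. \<forall>ij\<in>Pset n. lt d e \<longleftrightarrow> lt (d + var_exp ij) (e + var_exp ij))"

definition max_exp :: "(mono \<Rightarrow> mono \<Rightarrow> bool) \<Rightarrow> cpoly \<Rightarrow> mono" where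
  "max_exp lt p = (THE d. d \<in> Poly_Mapping.keys p \<and> (\<forall>e\<in>Poly_Mapping.keys p. e \<noteq> d \<longrightarrow> lt e d))"

text \<open>The initial term includes the coefficient. The initial term of 0 is set to be 0, which
  does not affect spans and generated algebras.\<close>

definition initial :: "(mono \<Rightarrow> mono \<Rightarrow> bool) \<Rightarrow> cpoly \<Rightarrow> cpoly" where
  "initial lt p =
     (if p = 0 then 0 else Poly_Mapping.single (max_exp lt p) (Poly_Mapping.lookup p (max_exp lt p)))"

definition initial_space :: "(mono \<Rightarrow> mono \<Rightarrow> bool) \<Rightarrow> cpoly set \<Rightarrow> cpoly set" where
  "initial_space lt U = module.span poly_scale (initial lt ` U)"

definition sagbi_basis :: "(mono \<Rightarrow> mono \<Rightarrow> bool) \<Rightarrow> cpoly set \<Rightarrow> cpoly set \<Rightarrow> bool" where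
  "sagbi_basis lt U B \<longleftrightarrow>
     algebra_generated B = U \<and> algebra_generated (initial lt ` B) = initial_space lt U"


section \<open>Weights and the grading\<close>

text \<open>An integral weight is given by its coordinates in the basis
  $\varepsilon_1, \ldots, \varepsilon_n$ of the dual of the Cartan subalgebra; coordinates outside
  \<open>{1..n}\<close> are 0.\<close>

type_synonym weight = "int \<Rightarrow> int"

definition eps :: "int \<Rightarrow> weight" where
  "eps i = (\<lambda>k. if k = i then 1 else 0)"

definition fundamental_weight :: "nat \<Rightarrow> weight" where
  "fundamental_weight k = (\<lambda>x. \<Sum>i\<in>{1..int k}. eps i x)"

definition dominant_weight :: "nat \<Rightarrow> weight \<Rightarrow> bool" where
  "dominant_weight n lam \<longleftrightarrow>
     (\<exists>a :: nat \<Rightarrow> nat. lam = (\<lambda>x. \<Sum>k\<in>{1..n}. int (a k) * fundamental_weight k x))"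

definition grad :: "nat \<Rightarrow> mono \<Rightarrow> weight" where
  "grad n d = (\<lambda>x. \<Sum>(i, j)\<in>Pset n. int (Poly_Mapping.lookup d (i, j)) * eps i x)"

definition R_component :: "nat \<Rightarrow> weight \<Rightarrow> cpoly set" where
  "R_component n lam = {p \<in> Ralg n. \<forall>d\<in>Poly_Mapping.keys p. grad n d = lam}"


section \<open>The symplectic Lie algebra and its representations\<close>

definition N_mat :: "nat \<Rightarrow> (int \<Rightarrow> int \<Rightarrow> complex) \<Rightarrow> complex mat" where
  "N_mat n F = mat (2 * n) (2 * n) (\<lambda>(r, c). F (N_list n ! r) (N_list n ! c))"

definition Eunit :: "nat \<Rightarrow> int \<Rightarrow> int \<Rightarrow> complex mat" where
  "Eunit n a b = N_mat n (\<lambda>x y. if x = a \<and> y = b then 1 else 0)"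

text \<open>The invariant symplectic form pairs the basis vectors $e_i$ and $e_{-i}$, with value 1 on
  $(e_i, e_{-i})$ for positive $i$. This is the form preserved by the root vectors
  \<open>froot n i j\<close> below.\<close>

definition Jform :: "nat \<Rightarrow> complex mat" where
  "Jform n = N_mat n (\<lambda>a b. if b = - a then of_int (sgn a) else 0)"

definition sp :: "nat \<Rightarrow> complex mat set" where
  "sp n = {X \<in> carrier_mat (2 * n) (2 * n).
     transpose_mat X * Jform n + Jform n * X = 0\<^sub>m (2 * n) (2 * n)}"

definition froot :: "nat \<Rightarrow> int \<Rightarrow> int \<Rightarrow> complex mat" where
  "froot n i j = (if j > 0 then Eunit n j i - Eunit n (- i) (- j) else Eunit n j i + Eunit n (- i) (- j))"

text \<open>A weight evaluated at a diagonal matrix: $\varepsilon_i$ is the diagonal entry labelled by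
  $i \in \{1, \ldots, n\}$, which stands at position \<open>i - 1\<close>.\<close>

definition weight_eval :: "nat \<Rightarrow> weight \<Rightarrow> complex mat \<Rightarrow> complex" where
  "weight_eval n lam H = (\<Sum>r<n. of_int (lam (int r + 1)) * H $$ (r, r))"

locale sp_representation = vector_space scale
  for scale :: "complex \<Rightarrow> 'v::ab_group_add \<Rightarrow> 'v" +
  fixes n :: nat and \<rho> :: "complex mat \<Rightarrow> 'v \<Rightarrow> 'v"
  assumes linear_action: "X \<in> sp n \<Longrightarrow> Vector_Spaces.linear scale scale (\<rho> X)"
    and action_add: "X \<in> sp n \<Longrightarrow> Y \<in> sp n \<Longrightarrow> \<rho> (X + Y) w = \<rho> X w + \<rho> Y w"
    and action_smult: "X \<in> sp n \<Longrightarrow> \<rho> (c \<cdot>\<^sub>m X) w = scale c (\<rho> X w)"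
    and action_bracket:
      "X \<in> sp n \<Longrightarrow> Y \<in> sp n \<Longrightarrow> \<rho> (X * Y - Y * X) w = \<rho> X (\<rho> Y w) - \<rho> Y (\<rho> X w)"

text \<open>The positive root vectors are the transposes of the negative ones, up to scalar factors.\<close>

locale irreducible_highest_weight_representation = sp_representation scale n \<rho>
  for scale :: "complex \<Rightarrow> 'v::ab_group_add \<Rightarrow> 'v" and n \<rho> +
  fixes lam :: weight and v :: 'v
  assumes irreducible:
      "subspace W \<Longrightarrow> (\<And>X w. X \<in> sp n \<Longrightarrow> w \<in> W \<Longrightarrow> \<rho> X w \<in> W) \<Longrightarrow> W = {0} \<or> W = UNIV"
    and highest_weight_vector_nonzero: "v \<noteq> 0"
    and positive_root_vectors: "(i, j) \<in> Pset n - Aset n \<Longrightarrow> \<rho> (transpose_mat (froot n i j)) v = 0"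
    and highest_weight:
      "H \<in> sp n \<Longrightarrow> diagonal_mat H \<Longrightarrow> \<rho> H v = scale (weight_eval n lam H) v"

text \<open>The pairs in \<open>Pset n - Aset n\<close>, ordered first by \<open>i\<close> increasing and then by \<open>j\<close>
  \<open>\<lessdot>\<close>-increasing.\<close>

definition root_list :: "nat \<Rightarrow> (int \<times> int) list" where
  "root_list n = concat (map (\<lambda>i. map (Pair i) ([i + 1..int n] @ [- int n..- i])) [1..int n])"

text \<open>The vector $f^d v$: the factors of $f^d$ stand in the order of \<open>root_list n\<close> from left to
  right, so the last one acts on \<open>v\<close> first. The exponents $d_{i,i}$ are ignored.\<close>

definition f_power :: "nat \<Rightarrow> (complex mat \<Rightarrow> 'v \<Rightarrow> 'v) \<Rightarrow> mono \<Rightarrow> 'v \<Rightarrow> 'v" where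
  "f_power n \<rho> d v = foldr (\<lambda>(i, j). \<rho> (froot n i j) ^^ Poly_Mapping.lookup d (i, j)) (root_list n) v"

definition basis_family ::
  "(complex \<Rightarrow> 'v::ab_group_add \<Rightarrow> 'v) \<Rightarrow> ('i \<Rightarrow> 'v) \<Rightarrow> 'i set \<Rightarrow> bool" where
  "basis_family scale u I \<longleftrightarrow> inj_on u I \<and>
     \<not> module.dependent scale (u ` I) \<and> module.span scale (u ` I) = UNIV"

end

(* Let V be irreducible with highest weight vector v and let t be the product of the column
   antisymmetrizers in a tensor power of C^N, for columns of lengths given by the weight. A
   contravariant Hermitian form on the tensor power shows that v and t satisfy the same relations
   over sp_2n, so V may be replaced by the submodule generated by t.

   Give z_{i,j} the degree |j| - i. Among the matrix coefficients of f^d t at a word w, those with d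
   of the lowest possible degree see only the summand E_{j,i} of each f_{i,j}, and they agree up to
   a nonzero factor depending only on d with the coefficients of z^d in the product D_w of
   determinants whose columns are read off w. Hence the degenerations of the coordinate functionals
   lie in R[lambda]. Ordering exponents by degree and then by <', the functional obtained from an
   element of R[lambda] with initial monomial z^d is triangular at f^d t, which gives linear
   independence.

   For the spanning property, Garnir relations and contractions with the symplectic form express
   every coordinate functional on the submodule through those of King's symplectic tableaux, and the
   D_w of King tableaux are linearly independent because their diagonal terms are. So the lowest
   degree part of a nonzero functional is a nonzero element of R[lambda], and its initial monomial
   z^d provides an f^d t on which the functional does not vanish. *)

theory Submission
  imports Defs "HOL-Library.Function_Algebras" "HOL-Library.Product_Plus" "HOL-Library.Multiset"
begin


section \<open>Matrices in the symplectic Lie algebra\<close>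

text \<open>The obstacle to matching f^d t with z^d is the second summand of a root vector, a
  multiple of E_{-i,-j}. On words E_{j,i} raises the sum of the absolute values of the letters by
  |j| - i, and the second summand lowers it by as much; for j = -i the two coincide. So at the words
  of largest sum that f^d t can reach only E_{j,i} counts, which explains the degree |j| - i. The
  order of the factors of f^d enters here: factors with larger i act first, so no factor creates a
  letter that a later one moves. Every letter moves at most once, and the coefficients count moved
  positions just as the expansion of the determinants does. For tableaux King's order replaces
  \<lessdot>: sorted by absolute value, a column is admissible when each of its rows satisfies a
  bound, and the same bound makes the diagonal term of D_w nonzero. V is known only through
  irreducibility and its highest weight vector, so the passage to the tensor model goes through the
  submodule generated by (v, t) in the product of both representations. It meets each factor only in
  0 and is thus the graph of an injective map.\<close>

definition N_index :: "nat \<Rightarrow> int \<Rightarrow> nat" where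
  "N_index n a = (if a > 0 then nat (a - 1) else nat (2 * int n + a))"

definition entry :: "nat \<Rightarrow> complex mat \<Rightarrow> int \<Rightarrow> int \<Rightarrow> complex" where
  "entry n X a b = X $$ (N_index n a, N_index n b)"

lemma finite_Nset [simp]: "finite (Nset n)"
  by (simp add: Nset_def)

lemma uminus_mem_Nset_iff [simp]: "- a \<in> Nset n \<longleftrightarrow> a \<in> Nset n"
  by (auto simp: Nset_def)

lemma ball_Nset_uminus: "(\<forall>a\<in>Nset n. Q a) \<longleftrightarrow> (\<forall>a\<in>Nset n. Q (- a))"
proof
  assume "\<forall>a\<in>Nset n. Q (- a)"
  then have "Q (- (- a))" if "a \<in> Nset n" for a
    using that by (simp del: minus_minus)
  then show "\<forall>a\<in>Nset n. Q a" by simp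
qed auto

lemma Nset_iff: "a \<in> Nset n \<longleftrightarrow> a \<noteq> 0 \<and> \<bar>a\<bar> \<le> int n"
  by (auto simp: Nset_def)

lemma N_index_less: "a \<in> Nset n \<Longrightarrow> N_index n a < 2 * n"
  by (auto simp: Nset_def N_index_def)

lemma N_list_nth:
  "r < 2 * n \<Longrightarrow> N_list n ! r = (if r < n then int r + 1 else int r - 2 * int n)"
  by (auto simp: N_list_def nth_append nth_upto)

lemma N_list_nth_mem: "r < 2 * n \<Longrightarrow> N_list n ! r \<in> Nset n"
  by (auto simp: N_list_nth Nset_def)

lemma N_list_nth_N_index: "a \<in> Nset n \<Longrightarrow> N_list n ! N_index n a = a"
  using N_index_less[of a n] by (auto simp: N_list_nth) (auto simp: N_index_def Nset_def)

lemma N_index_N_list_nth: "r < 2 * n \<Longrightarrow> N_index n (N_list n ! r) = r"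
  by (auto simp: N_list_nth N_index_def)

lemma bij_betw_N_index: "bij_betw (N_index n) (Nset n) {0..<2 * n}"
  by (rule bij_betw_byWitness[where f' = "\<lambda>r. N_list n ! r"])
    (auto simp: N_list_nth_N_index N_index_N_list_nth N_list_nth_mem N_index_less)

lemma entry_eqI:
  assumes "X \<in> carrier_mat (2 * n) (2 * n)" "Y \<in> carrier_mat (2 * n) (2 * n)"
    and "\<And>a b. a \<in> Nset n \<Longrightarrow> b \<in> Nset n \<Longrightarrow> entry n X a b = entry n Y a b"
  shows "X = Y"
proof (rule eq_matI)
  fix r c assume "r < dim_row Y" "c < dim_col Y"
  then have r: "r < 2 * n" "c < 2 * n" using assms by auto
  show "X $$ (r, c) = Y $$ (r, c)"
    using assms(3)[of "N_list n ! r" "N_list n ! c"] r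
    by (auto simp: N_list_nth_mem entry_def N_index_N_list_nth)
qed (use assms in auto)

lemma N_mat_carrier [simp]: "N_mat n F \<in> carrier_mat (2 * n) (2 * n)"
  by (simp add: N_mat_def)

lemma entry_N_mat [simp]: "a \<in> Nset n \<Longrightarrow> b \<in> Nset n \<Longrightarrow> entry n (N_mat n F) a b = F a b"
  by (simp add: N_mat_def entry_def N_index_less N_list_nth_N_index)

context
  fixes n :: nat and X Y :: "complex mat" and a b :: int
  assumes X: "X \<in> carrier_mat (2 * n) (2 * n)" and Y: "Y \<in> carrier_mat (2 * n) (2 * n)"
    and a: "a \<in> Nset n" and b: "b \<in> Nset n"
begin

lemma entry_add: "entry n (X + Y) a b = entry n X a b + entry n Y a b"
  using X Y a b by (simp add: entry_def N_index_less)

lemma entry_diff: "entry n (X - Y) a b = entry n X a b - entry n Y a b"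
  using X Y a b by (simp add: entry_def N_index_less)

lemma entry_mult: "entry n (X * Y) a b = (\<Sum>c\<in>Nset n. entry n X a c * entry n Y c b)"
proof -
  have "entry n (X * Y) a b
      = (\<Sum>r\<in>{0..<2 * n}. X $$ (N_index n a, r) * Y $$ (r, N_index n b))"
    using X Y a b by (simp add: entry_def N_index_less scalar_prod_def)
  also have "\<dots> = (\<Sum>c\<in>Nset n. entry n X a c * entry n Y c b)"
    unfolding entry_def by (rule sum.reindex_bij_betw[OF bij_betw_N_index, symmetric])
  finally show ?thesis .
qed

end

lemma entry_smult:
  "X \<in> carrier_mat (2 * n) (2 * n) \<Longrightarrow> a \<in> Nset n \<Longrightarrow> b \<in> Nset n \<Longrightarrow>
    entry n (c \<cdot>\<^sub>m X) a b = c * entry n X a b"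
  by (simp add: entry_def N_index_less)

lemma entry_transpose:
  "X \<in> carrier_mat (2 * n) (2 * n) \<Longrightarrow> a \<in> Nset n \<Longrightarrow> b \<in> Nset n \<Longrightarrow>
    entry n (transpose_mat X) a b = entry n X b a"
  by (simp add: entry_def N_index_less)

lemma entry_zero: "a \<in> Nset n \<Longrightarrow> b \<in> Nset n \<Longrightarrow> entry n (0\<^sub>m (2 * n) (2 * n)) a b = 0"
  by (simp add: entry_def N_index_less)

lemma sp_carrier: "X \<in> sp n \<Longrightarrow> X \<in> carrier_mat (2 * n) (2 * n)"
  by (simp add: sp_def)

lemma Jform_carrier: "Jform n \<in> carrier_mat (2 * n) (2 * n)"
  by (simp add: Jform_def)

lemma entry_sp_condition:
  assumes X: "X \<in> carrier_mat (2 * n) (2 * n)" and a: "a \<in> Nset n" and b: "b \<in> Nset n"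
  shows "entry n (transpose_mat X * Jform n + Jform n * X) a b
    = of_int (sgn a) * entry n X (- a) b - of_int (sgn b) * entry n X (- b) a"
proof -
  have "entry n (transpose_mat X * Jform n) a b
      = (\<Sum>c\<in>Nset n. entry n (transpose_mat X) a c * entry n (Jform n) c b)"
    using X a b Jform_carrier by (simp add: entry_mult[of _ n])
  also have "\<dots> = (\<Sum>c\<in>Nset n. if c = - b then - of_int (sgn b) * entry n X (- b) a else 0)"
    using X a b by (intro sum.cong) (auto simp: entry_transpose Jform_def)
  also have "\<dots> = - of_int (sgn b) * entry n X (- b) a"
    using b by (subst sum.delta) auto
  finally have 1: "entry n (transpose_mat X * Jform n) a b
      = - of_int (sgn b) * entry n X (- b) a" .
  have "entry n (Jform n * X) a b = (\<Sum>c\<in>Nset n. entry n (Jform n) a c * entry n X c b)"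
    using X a b Jform_carrier by (simp add: entry_mult[of _ n])
  also have "\<dots>
      = (\<Sum>c\<in>Nset n. if c = - a then of_int (sgn a) * entry n X (- a) b else 0)"
    using X a b by (intro sum.cong) (auto simp: Jform_def)
  also have "\<dots> = of_int (sgn a) * entry n X (- a) b"
    using a by (subst sum.delta) auto
  finally have 2: "entry n (Jform n * X) a b = of_int (sgn a) * entry n X (- a) b" .
  have "transpose_mat X * Jform n \<in> carrier_mat (2 * n) (2 * n)"
    "Jform n * X \<in> carrier_mat (2 * n) (2 * n)"
    using X Jform_carrier[of n] by auto
  then show ?thesis
    using a b by (simp add: entry_add 1 2)
qed

text \<open>The entry of X^T J + J X at (a, b) involves only X at (-a, b) and at (-b, a). After
  replacing a by -a, the defining equation becomes a signed symmetry under (a, b) -> (-b, -a), the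
  reflection in the antidiagonal.\<close>

lemma sp_iff:
  "X \<in> sp n \<longleftrightarrow> X \<in> carrier_mat (2 * n) (2 * n) \<and>
    (\<forall>a\<in>Nset n. \<forall>b\<in>Nset n. entry n X (- b) (- a) = - of_int (sgn a * sgn b) * entry n X a b)"
  (is "_ \<longleftrightarrow> _ \<and> ?R")
proof (cases "X \<in> carrier_mat (2 * n) (2 * n)")
  case True
  let ?E = "transpose_mat X * Jform n + Jform n * X"
  have E: "?E \<in> carrier_mat (2 * n) (2 * n)"
    using True Jform_carrier[of n] by (auto intro!: add_carrier_mat mult_carrier_mat)
  have sq: "sgn a = 1 \<or> sgn a = - 1" if "a \<in> Nset n" for a :: int
    using that by (auto simp: Nset_iff sgn_if)
  have "X \<in> sp n \<longleftrightarrow> (\<forall>a\<in>Nset n. \<forall>b\<in>Nset n. entry n ?E a b = 0)"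
    using True E by (auto simp: sp_def entry_zero intro!: entry_eqI[of _ n])
  also have "\<dots> \<longleftrightarrow> (\<forall>a\<in>Nset n. \<forall>b\<in>Nset n.
      of_int (sgn a) * entry n X (- a) b - of_int (sgn b) * entry n X (- b) a = 0)"
    using True by (simp add: entry_sp_condition)
  also have "\<dots> \<longleftrightarrow> (\<forall>a\<in>Nset n. \<forall>b\<in>Nset n.
      of_int (sgn (- a)) * entry n X a b - of_int (sgn b) * entry n X (- b) (- a) = 0)"
    by (subst ball_Nset_uminus) simp
  also have "\<dots> \<longleftrightarrow> ?R"
  proof (intro ball_cong refl)
    fix a b assume "a \<in> Nset n" "b \<in> Nset n"
    then show "of_int (sgn (- a)) * entry n X a b - of_int (sgn b) * entry n X (- b) (- a) = 0
      \<longleftrightarrow> entry n X (- b) (- a) = - of_int (sgn a * sgn b) * entry n X a b"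
      using sq[of a] sq[of b] by (auto simp: sgn_minus algebra_simps add_eq_0_iff)
  qed
  finally show ?thesis using True by blast
qed (simp add: sp_def)

lemma sp_entry:
  assumes "X \<in> sp n" "a \<in> Nset n" "b \<in> Nset n"
  shows "entry n X (- b) (- a) = - of_int (sgn a * sgn b) * entry n X a b"
  using assms by (simp add: sp_iff)

lemma sp_diff: "X \<in> sp n \<Longrightarrow> Y \<in> sp n \<Longrightarrow> X - Y \<in> sp n"
  by (auto simp: sp_iff entry_diff algebra_simps minus_carrier_mat)

lemma sp_smult: "X \<in> sp n \<Longrightarrow> c \<cdot>\<^sub>m X \<in> sp n"
  by (auto simp: sp_iff entry_smult)

lemma sp_transpose: "X \<in> sp n \<Longrightarrow> transpose_mat X \<in> sp n"
proof -
  assume X: "X \<in> sp n"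
  have "entry n X (- a) (- b) = - (of_int (sgn a) * of_int (sgn b) * entry n X b a)"
    if "a \<in> Nset n" "b \<in> Nset n" for a b
    using sp_entry[OF X that(2,1)] by (simp add: mult.commute)
  then show ?thesis using sp_carrier[OF X] by (auto simp: sp_iff entry_transpose)
qed

lemma sp_bracket:
  assumes X: "X \<in> sp n" and Y: "Y \<in> sp n"
  shows "X * Y - Y * X \<in> sp n"
  unfolding sp_iff
proof (intro conjI ballI)
  have C: "X \<in> carrier_mat (2 * n) (2 * n)" "Y \<in> carrier_mat (2 * n) (2 * n)"
    using X Y by (auto dest: sp_carrier)
  show "X * Y - Y * X \<in> carrier_mat (2 * n) (2 * n)"
    using C by (auto intro!: minus_carrier_mat)
  fix a b assume ab: "a \<in> Nset n" "b \<in> Nset n"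
  \<comment> \<open>The reflection in the antidiagonal reverses products, and the two minus signs
    from \<open>sp_entry\<close> cancel. The sign in the bracket comes from the interchange of the
    two products.\<close>
  have prod: "entry n (S * T) (- b) (- a) = of_int (sgn a * sgn b) * entry n (T * S) a b"
    if S: "S \<in> sp n" and T: "T \<in> sp n" for S T
  proof -
    have "entry n (S * T) (- b) (- a) = (\<Sum>c\<in>Nset n. entry n S (- b) c * entry n T c (- a))"
      using that ab by (subst entry_mult) (auto dest: sp_carrier)
    also have "\<dots> = (\<Sum>c\<in>Nset n. entry n S (- b) (- c) * entry n T (- c) (- a))"
      by (rule sum.reindex_bij_witness[of _ uminus uminus]) auto
    also have "\<dots> = (\<Sum>c\<in>Nset n. of_int (sgn a * sgn b) * (entry n T a c * entry n S c b))"
    proof (intro sum.cong refl)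
      fix c assume c: "c \<in> Nset n"
      then have "sgn c = 1 \<or> sgn c = - 1"
        by (auto simp: Nset_iff sgn_if)
      then show "entry n S (- b) (- c) * entry n T (- c) (- a)
          = of_int (sgn a * sgn b) * (entry n T a c * entry n S c b)"
        using sp_entry[OF S c ab(2)] sp_entry[OF T ab(1) c] by auto
    qed
    also have "\<dots> = of_int (sgn a * sgn b) * entry n (T * S) a b"
      using that ab by (subst entry_mult) (auto dest: sp_carrier simp: sum_distrib_left)
    finally show ?thesis .
  qed
  show "entry n (X * Y - Y * X) (- b) (- a)
      = - of_int (sgn a * sgn b) * entry n (X * Y - Y * X) a b"
    using C ab prod[OF X Y] prod[OF Y X]
    by (simp add: entry_diff[of _ n] right_diff_distrib)
qed

lemma froot_carrier [simp]: "froot n i j \<in> carrier_mat (2 * n) (2 * n)"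
  by (auto simp: froot_def Eunit_def intro!: minus_carrier_mat)

lemma PsetD:
  assumes "(i, j) \<in> Pset n"
  shows "i \<in> Nset n" "j \<in> Nset n" "0 < i" "i \<le> \<bar>j\<bar>" "\<bar>j\<bar> \<le> int n"
  using assms by (auto simp: Pset_def Nset_iff)

lemma Pset_minus_AsetD:
  assumes "(i, j) \<in> Pset n - Aset n"
  shows "i \<in> Nset n" "j \<in> Nset n" "0 < i" "i \<le> \<bar>j\<bar>" "i \<noteq> j" "j = - i \<or> i < \<bar>j\<bar>"
  using assms by (auto simp: Pset_def Nset_iff Aset_def)

lemma entry_froot:
  assumes "i \<in> Nset n" "j \<in> Nset n" "a \<in> Nset n" "b \<in> Nset n"
  shows "entry n (froot n i j) a b
    = of_bool (a = j \<and> b = i) - of_int (sgn j) * of_bool (a = - i \<and> b = - j)"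
proof -
  have "j \<noteq> 0" using assms by (simp add: Nset_iff)
  then show ?thesis
    using assms unfolding froot_def Eunit_def
    by (auto simp: entry_add entry_diff sgn_if)
qed

lemma froot_sp:
  assumes "(i, j) \<in> Pset n"
  shows "froot n i j \<in> sp n"
  unfolding sp_iff
proof (intro conjI ballI)
  fix a b assume ab: "a \<in> Nset n" "b \<in> Nset n"
  have ij: "i \<in> Nset n" "j \<in> Nset n" "0 < i" using PsetD[OF assms] by auto
  then have j: "sgn j = 1 \<or> sgn j = - 1" by (auto simp: Nset_iff sgn_if)
  have eq: "- b = j \<longleftrightarrow> b = - j" "- a = i \<longleftrightarrow> a = - i" "- b = - i \<longleftrightarrow> b = i" "- a = - j \<longleftrightarrow> a = j"
    by auto
  consider "a = j" "b = i" | "a = - i" "b = - j" | "\<not> (a = j \<and> b = i)" "\<not> (a = - i \<and> b = - j)"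
    by blast
  then show "entry n (froot n i j) (- b) (- a)
      = - of_int (sgn a * sgn b) * entry n (froot n i j) a b"
  proof cases
    case 1
    then show ?thesis using ij j by (cases "j = - i") (auto simp: entry_froot)
  next
    case 2
    then show ?thesis using ij j by (cases "j = - i") (auto simp: entry_froot sgn_minus)
  next
    case 3
    have "\<not> (- b = j \<and> - a = i)" "\<not> (- b = - i \<and> - a = - j)"
      using 3 by auto
    then have "entry n (froot n i j) (- b) (- a) = 0"
      using ij ab by (simp only: entry_froot uminus_mem_Nset_iff) (simp only: of_bool_eq, simp)
    moreover have "entry n (froot n i j) a b = 0"
      using ij ab 3 by (simp only: entry_froot) (simp only: of_bool_eq, simp)
    ultimately show ?thesis by simp
  qed
qed simp


section \<open>Highest weight vectors\<close>

lemma root_entry_cases: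
  assumes "a \<in> Nset n" "b \<in> Nset n" "a \<noteq> b"
  obtains i j where "(i, j) \<in> Pset n - Aset n"
    "(a, b) = (j, i) \<or> (a, b) = (- i, - j) \<or> (a, b) = (i, j) \<or> (a, b) = (- j, - i)"
proof -
  consider "\<bar>b\<bar> \<le> \<bar>a\<bar>" "b > 0" | "\<bar>b\<bar> \<le> \<bar>a\<bar>" "b < 0" | "\<bar>a\<bar> \<le> \<bar>b\<bar>" "a > 0" | "\<bar>a\<bar> \<le> \<bar>b\<bar>" "a < 0"
    using assms by (fastforce simp: Nset_iff)
  then show ?thesis
  proof cases
    case 1
    then show ?thesis using that[of b a] assms by (auto simp: Nset_iff Pset_def Aset_def)
  next
    case 2
    then show ?thesis using that[of "- b" "- a"] assms by (auto simp: Nset_iff Pset_def Aset_def)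
  next
    case 3
    then show ?thesis using that[of a b] assms by (auto simp: Nset_iff Pset_def Aset_def)
  next
    case 4
    then show ?thesis using that[of "- a" "- b"] assms by (auto simp: Nset_iff Pset_def Aset_def)
  qed
qed

text \<open>Transposition and the reflection (x, y) -> (-y, -x) move any off-diagonal position to
  some (j, i) with i positive and i \<le> |j|, where \<open>froot\<close> has an entry. The bound on
  the support guarantees that subtracting a multiple of R creates no new off-diagonal
  entries.\<close>

lemma root_vector_through:
  assumes ab: "a \<in> Nset n" "b \<in> Nset n" "a \<noteq> b"
  obtains i j R where "(i, j) \<in> Pset n - Aset n" "R = froot n i j \<or> R = transpose_mat (froot n i j)"
    "entry n R a b \<noteq> 0"
    "\<forall>x\<in>Nset n. \<forall>y\<in>Nset n. entry n R x y \<noteq> 0 \<longrightarrow> (x, y) = (a, b) \<or> (x, y) = (- b, - a)"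
proof -
  obtain i j where ij: "(i, j) \<in> Pset n - Aset n"
    "(a, b) = (j, i) \<or> (a, b) = (- i, - j) \<or> (a, b) = (i, j) \<or> (a, b) = (- j, - i)"
    using root_entry_cases[OF ab] .
  note P = Pset_minus_AsetD[OF ij(1)]
  have j: "sgn j = 1 \<or> sgn j = - 1" using P(2) by (auto simp: Nset_iff sgn_if)
  have nz: "entry n (froot n i j) j i \<noteq> 0" "entry n (froot n i j) (- i) (- j) \<noteq> 0"
    using P j by (cases "j = - i"; auto simp: entry_froot)+
  have supp: "(x, y) = (j, i) \<or> (x, y) = (- i, - j)"
    if "x \<in> Nset n" "y \<in> Nset n" "entry n (froot n i j) x y \<noteq> 0" for x y
    using that(3) entry_froot[OF P(1,2) that(1,2)] by (auto split: if_splits)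
  show ?thesis
  proof (cases "(a, b) = (j, i) \<or> (a, b) = (- i, - j)")
    case True
    show ?thesis
      by (rule that[OF ij(1), of "froot n i j"]) (use True nz supp in fastforce)+
  next
    case False
    then have "(a, b) = (i, j) \<or> (a, b) = (- j, - i)" using ij(2) by blast
    then show ?thesis
      by (intro that[OF ij(1), of "transpose_mat (froot n i j)"])
        (use P nz supp in \<open>fastforce simp: entry_transpose\<close>)+
  qed
qed

text \<open>Generation of sp by diagonal matrices and root vectors, in the form of an induction
  rule. Subtracting a multiple of one root vector clears an entry together with its mirror image, so
  the number of nonzero off-diagonal entries drops.\<close>

lemma sp_induct [consumes 1, case_names diagonal negative positive add smult]:
  assumes "X \<in> sp n"
    and diagonal: "\<And>H. H \<in> sp n \<Longrightarrow> diagonal_mat H \<Longrightarrow> Q H"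
    and negative: "\<And>i j. (i, j) \<in> Pset n - Aset n \<Longrightarrow> Q (froot n i j)"
    and positive: "\<And>i j. (i, j) \<in> Pset n - Aset n \<Longrightarrow> Q (transpose_mat (froot n i j))"
    and add: "\<And>X Y. X \<in> sp n \<Longrightarrow> Y \<in> sp n \<Longrightarrow> Q X \<Longrightarrow> Q Y \<Longrightarrow> Q (X + Y)"
    and smult: "\<And>X c. X \<in> sp n \<Longrightarrow> Q X \<Longrightarrow> Q (c \<cdot>\<^sub>m X)"
  shows "Q X"
  using assms(1)
proof (induction "card {(a, b) \<in> Nset n \<times> Nset n. a \<noteq> b \<and> entry n X a b \<noteq> 0}"
    arbitrary: X rule: less_induct)
  case less
  let ?S = "\<lambda>X. {(a, b) \<in> Nset n \<times> Nset n. a \<noteq> b \<and> entry n X a b \<noteq> 0}"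
  have fin: "finite (?S X)" for X
    by (rule finite_subset[of _ "Nset n \<times> Nset n"]) auto
  note X = sp_carrier[OF less.prems]
  show ?case
  proof (cases "?S X = {}")
    case True
    have "diagonal_mat X"
      unfolding diagonal_mat_def
    proof (intro allI impI)
      fix r c assume "r < dim_row X" "c < dim_col X" "r \<noteq> c"
      then have rc: "r < 2 * n" "c < 2 * n" "N_list n ! r \<noteq> N_list n ! c"
        using X by (auto simp: dest: arg_cong[of _ _ "N_index n"] simp: N_index_N_list_nth)
      have "entry n X (N_list n ! r) (N_list n ! c) = 0"
        using True rc N_list_nth_mem[OF rc(1)] N_list_nth_mem[OF rc(2)] by auto
      then show "X $$ (r, c) = 0"
        using rc by (simp add: entry_def N_index_N_list_nth)
    qed
    then show ?thesis using diagonal less.prems by blast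
  next
    case False
    then obtain a b where ab: "a \<in> Nset n" "b \<in> Nset n" "a \<noteq> b" "entry n X a b \<noteq> 0"
      by auto
    obtain i j R where R: "(i, j) \<in> Pset n - Aset n"
      "R = froot n i j \<or> R = transpose_mat (froot n i j)" "entry n R a b \<noteq> 0"
      "\<forall>x\<in>Nset n. \<forall>y\<in>Nset n. entry n R x y \<noteq> 0 \<longrightarrow> (x, y) = (a, b) \<or> (x, y) = (- b, - a)"
      by (rule root_vector_through[OF ab(1-3)])
    have "froot n i j \<in> sp n" using R(1) froot_sp by blast
    then have Rsp: "R \<in> sp n" using R(2) sp_transpose by auto
    have QR: "Q R" using R(1,2) negative positive by auto
    define c where "c = entry n X a b / entry n R a b"
    define Y where "Y = X - c \<cdot>\<^sub>m R"
    have cR: "c \<cdot>\<^sub>m R \<in> sp n" using sp_smult[OF Rsp] .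
    have Y: "Y \<in> sp n" unfolding Y_def by (rule sp_diff[OF less.prems cR])
    have eY: "entry n Y x y = entry n X x y - c * entry n R x y"
      if "x \<in> Nset n" "y \<in> Nset n" for x y
      using that X sp_carrier[OF cR] sp_carrier[OF Rsp] by (simp add: Y_def entry_diff entry_smult)
    have Yab: "entry n Y a b = 0" using ab R(3) by (simp add: eY c_def)
    have Yba: "entry n Y (- b) (- a) = 0" using sp_entry[OF Y ab(1,2)] Yab by simp
    have "?S Y \<subseteq> ?S X"
    proof
      fix p assume "p \<in> ?S Y"
      then obtain x y where p: "p = (x, y)" "x \<in> Nset n" "y \<in> Nset n" "x \<noteq> y" "entry n Y x y \<noteq> 0"
        by auto
      then have "entry n R x y = 0" using R(4) Yab Yba by blast
      then show "p \<in> ?S X" using p by (simp add: eY)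
    qed
    moreover have "(a, b) \<in> ?S X" "(a, b) \<notin> ?S Y" using ab Yab by auto
    ultimately have "?S Y \<subset> ?S X" by blast
    then have "card (?S Y) < card (?S X)" by (rule psubset_card_mono[OF fin])
    then have "Q Y" using less.hyps Y by blast
    then have "Q (Y + c \<cdot>\<^sub>m R)" using add Y cR smult[OF Rsp QR] by blast
    moreover have "Y + c \<cdot>\<^sub>m R = X"
      using X sp_carrier[OF Rsp] unfolding Y_def by (intro eq_matI) auto
    ultimately show ?thesis by simp
  qed
qed

text \<open>Along \<lessdot> these are n, ..., 1, -1, ..., -n. They decrease strictly, so every
  negative root vector lowers the eigenvalue of \<open>H0\<close> by a positive integer, and this
  one element separates a highest weight vector from its proper descendants.\<close>

definition H0_weight :: "nat \<Rightarrow> int \<Rightarrow> int" where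
  "H0_weight n a = sgn a * (int n + 1 - \<bar>a\<bar>)"

definition H0 :: "nat \<Rightarrow> complex mat" where
  "H0 n = N_mat n (\<lambda>a b. if a = b then of_int (H0_weight n a) else 0)"

lemma H0_weight_uminus: "H0_weight n (- a) = - H0_weight n a"
  by (simp add: H0_weight_def)

lemma H0_sp: "H0 n \<in> sp n"
  unfolding sp_iff
proof (intro conjI ballI)
  fix a b assume "a \<in> Nset n" "b \<in> Nset n"
  then show "entry n (H0 n) (- b) (- a) = - of_int (sgn a * sgn b) * entry n (H0 n) a b"
    by (auto simp: H0_def H0_weight_uminus Nset_iff sgn_if)
qed (simp add: H0_def)

lemma H0_diagonal: "diagonal_mat (H0 n)"
  by (auto simp: diagonal_mat_def H0_def N_mat_def)
    (metis N_index_N_list_nth)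

lemma H0_bracket:
  assumes "(i, j) \<in> Pset n - Aset n"
  shows "H0 n * froot n i j - froot n i j * H0 n
    = of_int (H0_weight n j - H0_weight n i) \<cdot>\<^sub>m froot n i j"
proof (rule entry_eqI[of _ n])
  have C: "H0 n \<in> carrier_mat (2 * n) (2 * n)" by (simp add: H0_def)
  show "H0 n * froot n i j - froot n i j * H0 n \<in> carrier_mat (2 * n) (2 * n)"
    using C by (intro minus_carrier_mat mult_carrier_mat[of _ _ "2 * n"]) auto
  show "of_int (H0_weight n j - H0_weight n i) \<cdot>\<^sub>m froot n i j \<in> carrier_mat (2 * n) (2 * n)"
    by simp
  note P = Pset_minus_AsetD[OF assms]
  let ?F = "froot n i j"
  fix a b assume ab: "a \<in> Nset n" "b \<in> Nset n"
  have 1: "entry n (H0 n * ?F) a b = of_int (H0_weight n a) * entry n ?F a b"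
  proof -
    have "entry n (H0 n * ?F) a b = (\<Sum>c\<in>Nset n. entry n (H0 n) a c * entry n ?F c b)"
      using C ab by (simp add: entry_mult[of _ n])
    also have "\<dots> = (\<Sum>c\<in>Nset n. if c = a then of_int (H0_weight n a) * entry n ?F a b else 0)"
      using ab by (intro sum.cong) (auto simp: H0_def)
    finally show ?thesis using ab by simp
  qed
  have 2: "entry n (?F * H0 n) a b = of_int (H0_weight n b) * entry n ?F a b"
  proof -
    have "entry n (?F * H0 n) a b = (\<Sum>c\<in>Nset n. entry n ?F a c * entry n (H0 n) c b)"
      using C ab by (simp add: entry_mult[of _ n])
    also have "\<dots> = (\<Sum>c\<in>Nset n. if c = b then of_int (H0_weight n b) * entry n ?F a b else 0)"
      using ab by (intro sum.cong) (auto simp: H0_def)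
    finally show ?thesis using ab by simp
  qed
  have "entry n (H0 n * ?F - ?F * H0 n) a b
      = of_int (H0_weight n a - H0_weight n b) * entry n ?F a b"
    using C ab 1 2
    by (subst entry_diff[of _ n])
      (auto simp: algebra_simps intro: mult_carrier_mat[of _ "n * 2" "n * 2"] simp del:
          froot_carrier
        intro!: froot_carrier[of n, unfolded mult.commute[of 2]])
  also have "\<dots> = of_int (H0_weight n j - H0_weight n i) * entry n ?F a b"
  proof (cases "entry n ?F a b = 0")
    case False
    then have "a = j \<and> b = i \<or> a = - i \<and> b = - j"
      using entry_froot[OF P(1,2) ab] by (auto split: if_splits)
    then show ?thesis by (auto simp: H0_weight_uminus)
  qed simp
  finally show "entry n (H0 n * ?F - ?F * H0 n) a b
      = entry n (of_int (H0_weight n j - H0_weight n i) \<cdot>\<^sub>m ?F) a b"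
    using ab by (simp add: entry_smult)
qed

lemma H0_weight_decreasing:
  assumes "(i, j) \<in> Pset n - Aset n"
  shows "H0_weight n j < H0_weight n i"
  using assms by (auto simp: Pset_def Aset_def H0_weight_def sgn_if)


section \<open>Descendants of a highest weight vector\<close>

context sp_representation
begin

abbreviation fword :: "(int \<times> int) list \<Rightarrow> 'v \<Rightarrow> 'v" where
  "fword L w \<equiv> foldr (\<lambda>(i, j). \<rho> (froot n i j)) L w"

definition fwords :: "'v \<Rightarrow> 'v set" where
  "fwords w = {fword L w | L. set L \<subseteq> Pset n - Aset n}"

definition hw_vector :: "weight \<Rightarrow> 'v \<Rightarrow> bool" where
  "hw_vector mu w \<longleftrightarrow>
    (\<forall>i j. (i, j) \<in> Pset n - Aset n \<longrightarrow> \<rho> (transpose_mat (froot n i j)) w = 0) \<and>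
    (\<forall>H\<in>sp n. diagonal_mat H \<longrightarrow> \<rho> H w = scale (weight_eval n mu H) w)"

lemma action_module_hom: "X \<in> sp n \<Longrightarrow> module_hom scale scale (\<rho> X)"
  using linear_action by (simp add: linear_iff_module_hom)

lemma action_vec_add: "X \<in> sp n \<Longrightarrow> \<rho> X (u + w) = \<rho> X u + \<rho> X w"
  using module_hom.add[OF action_module_hom] .

lemma action_vec_scale: "X \<in> sp n \<Longrightarrow> \<rho> X (scale c w) = scale c (\<rho> X w)"
  using module_hom.scale[OF action_module_hom] .

lemma action_vec_zero: "X \<in> sp n \<Longrightarrow> \<rho> X 0 = 0"
  using module_hom.zero[OF action_module_hom] .

lemma span_action:
  assumes "X \<in> sp n" and S: "\<And>s. s \<in> S \<Longrightarrow> \<rho> X s \<in> span T" and w: "w \<in> span S"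
  shows "\<rho> X w \<in> span T"
  using w
proof (induction rule: span_induct_alt)
  case base
  then show ?case by (simp add: action_vec_zero assms(1) span_zero)
next
  case (step c x y)
  then show ?case
    by (simp add: action_vec_add action_vec_scale assms(1) S span_add span_scale)
qed

lemma froot_in_sp: "p \<in> Pset n - Aset n \<Longrightarrow> froot n (fst p) (snd p) \<in> sp n"
  using froot_sp[of "fst p" "snd p" n] by simp

lemma span_fwords_froot:
  assumes "p \<in> Pset n - Aset n" "x \<in> span (fwords w)"
  shows "\<rho> (froot n (fst p) (snd p)) x \<in> span (fwords w)"
proof (rule span_action[OF froot_in_sp[OF assms(1)] _ assms(2)])
  fix s assume "s \<in> fwords w"
  then obtain L where "s = fword L w" "set L \<subseteq> Pset n - Aset n"
    by (auto simp: fwords_def)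
  then have "\<rho> (froot n (fst p) (snd p)) s = fword (p # L) w" "set (p # L) \<subseteq> Pset n - Aset n"
    using assms(1) by (auto simp: case_prod_beta)
  then show "\<rho> (froot n (fst p) (snd p)) s \<in> span (fwords w)"
    unfolding fwords_def by (intro span_base) blast
qed

text \<open>Commuting X past the first factor leaves a bracket, again in sp, that acts on a shorter
  word. The induction is therefore over the word, for all X at once; the highest weight conditions
  enter only at the empty word.\<close>

lemma action_fword:
  assumes hw: "hw_vector mu w" and X: "X \<in> sp n" and L: "set L \<subseteq> Pset n - Aset n"
  shows "\<rho> X (fword L w) \<in> span (fwords w)"
  using X L
proof (induction L arbitrary: X)
  case Nil
  have w: "w \<in> span (fwords w)"
    unfolding fwords_def by (intro span_base) (auto intro!: exI[of _ "[]"])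
  have "\<rho> X w \<in> span (fwords w)"
    using Nil(1)
  proof (induction rule: sp_induct)
    case (diagonal H)
    then show ?case using hw w by (auto simp: hw_vector_def intro!: span_scale)
  next
    case (negative i j)
    then show ?case using span_fwords_froot[OF negative w] by simp
  next
    case (positive i j)
    then show ?case using hw by (auto simp: hw_vector_def span_zero)
  next
    case (add X Y)
    then show ?case by (simp add: action_add span_add)
  next
    case (smult X c)
    then show ?case by (simp add: action_smult span_scale)
  qed
  then show ?case by simp
next
  case (Cons p L)
  let ?F = "froot n (fst p) (snd p)"
  have p: "p \<in> Pset n - Aset n" "set L \<subseteq> Pset n - Aset n" using Cons.prems by auto
  have F: "?F \<in> sp n" using froot_in_sp[OF p(1)] .
  have "\<rho> X (\<rho> ?F (fword L w)) = \<rho> ?F (\<rho> X (fword L w)) + \<rho> (X * ?F - ?F * X) (fword L w)"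
    using action_bracket[OF Cons.prems(1) F] by simp
  also have "\<dots> \<in> span (fwords w)"
    by (intro span_add span_fwords_froot p Cons.IH Cons.prems sp_bracket F)
  finally show ?case by (cases p) simp
qed

lemma action_span_fwords:
  assumes "hw_vector mu w" "X \<in> sp n" "x \<in> span (fwords w)"
  shows "\<rho> X x \<in> span (fwords w)"
  by (rule span_action[OF assms(2) _ assms(3)])
    (use action_fword[OF assms(1,2)] in \<open>auto simp: fwords_def\<close>)

text \<open>The total drop of the \<open>H0\<close>-eigenvalue along the word.\<close>

definition depth :: "(int \<times> int) list \<Rightarrow> nat" where
  "depth L = (\<Sum>(i, j)\<leftarrow>L. nat (H0_weight n i - H0_weight n j))"

lemma depth_pos: "set L \<subseteq> Pset n - Aset n \<Longrightarrow> L \<noteq> [] \<Longrightarrow> depth L > 0"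
  using H0_weight_decreasing[of "fst (hd L)" "snd (hd L)" n]
  by (cases L) (auto simp: depth_def)

lemma H0_fword:
  assumes hw: "hw_vector mu w" and L: "set L \<subseteq> Pset n - Aset n"
  shows "\<rho> (H0 n) (fword L w) = scale (weight_eval n mu (H0 n) - of_nat (depth L)) (fword L w)"
  using L
proof (induction L)
  case Nil
  then show ?case using hw H0_sp H0_diagonal by (simp add: hw_vector_def depth_def)
next
  case (Cons p L)
  obtain i j where ij: "p = (i, j)" by fastforce
  have p: "(i, j) \<in> Pset n - Aset n" "set L \<subseteq> Pset n - Aset n" using Cons.prems ij by auto
  let ?F = "froot n i j" and ?w = "fword L w"
  have F: "?F \<in> sp n" using froot_in_sp[OF p(1)] by simp
  have nat: "(of_nat (nat (H0_weight n i - H0_weight n j)) :: complex)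
      = of_int (H0_weight n i - H0_weight n j)"
    using H0_weight_decreasing[OF p(1)] by simp
  have "\<rho> (H0 n) (\<rho> ?F ?w) = \<rho> ?F (\<rho> (H0 n) ?w) + \<rho> (H0 n * ?F - ?F * H0 n) ?w"
    using action_bracket[OF H0_sp F] by simp
  also have "\<dots> = scale (weight_eval n mu (H0 n) - of_nat (depth L)) (\<rho> ?F ?w)
      + scale (of_int (H0_weight n j - H0_weight n i)) (\<rho> ?F ?w)"
    using Cons.IH[OF p(2)] by (simp only: H0_bracket[OF p(1)] action_smult[OF F]
        action_vec_scale[OF F])
  also have "\<dots> = scale (weight_eval n mu (H0 n) - of_nat (depth (p # L))) (\<rho> ?F ?w)"
    by (simp add: ij depth_def nat flip: scale_left_distrib)
  finally show ?case by (simp add: ij)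
qed

text \<open>A product of operators \<open>H0 - \<mu>\<close> annihilates any combination of proper descendants of \<open>w\<close>
  but multiplies \<open>w\<close> by a nonzero number.\<close>

lemma hw_vector_not_in_lower_span:
  assumes hw: "hw_vector mu w" and w: "w \<noteq> 0"
  shows "w \<notin> span {fword L w | L. set L \<subseteq> Pset n - Aset n \<and> L \<noteq> []}"
proof
  define T where "T m x = \<rho> (H0 n) x - scale (weight_eval n mu (H0 n) - of_nat m) x" for m :: nat
      and x
  have T_add: "T m (x + y) = T m x + T m y" for m x y
    by (simp add: T_def action_vec_add[OF H0_sp] scale_right_distrib)
  have T_scale: "T m (scale c x) = scale c (T m x)" for m c x
    by (simp add: T_def action_vec_scale[OF H0_sp] scale_right_diff_distrib scale_scale
        mult.commute)
  have T_zero: "T m 0 = 0" for m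
    by (simp add: T_def action_vec_zero[OF H0_sp])
  have T_comm: "T m (T k x) = T k (T m x)" for m k x
    unfolding T_def
    by (simp add: module_hom.diff[OF action_module_hom[OF H0_sp]] action_vec_scale[OF H0_sp]
        scale_right_diff_distrib scale_scale mult.commute)
  have f_add: "foldr T ms (x + y) = foldr T ms x + foldr T ms y" for ms x y
    by (induction ms) (auto simp: T_add)
  have f_scale: "foldr T ms (scale c x) = scale c (foldr T ms x)" for ms c x
    by (induction ms) (auto simp: T_scale)
  have f_zero: "foldr T ms 0 = 0" for ms
    by (induction ms) (auto simp: T_zero)
  have f_T: "foldr T ms (T m x) = T m (foldr T ms x)" for ms m x
    by (induction ms) (auto simp: T_comm)
  have f_comm: "foldr T ms (foldr T ks x) = foldr T ks (foldr T ms x)" for ms ks x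
    by (induction ms) (auto simp: f_T)
  have T_w: "T m w = scale (of_nat m) w" for m
    using H0_fword[OF hw, of "[]"] by (simp add: T_def depth_def flip: scale_left_diff_distrib)
  have f_w: "foldr T ms w = scale (\<Prod>m\<leftarrow>ms. of_nat m) w" for ms
    by (induction ms) (auto simp: T_scale T_w scale_scale mult.commute)
  assume "w \<in> span {fword L w | L. set L \<subseteq> Pset n - Aset n \<and> L \<noteq> []}"
  then have "\<exists>ms. 0 \<notin> set ms \<and> foldr T ms w = 0"
  proof (induction rule: span_induct_alt)
    case base
    show ?case by (intro exI[of _ "[]"]) simp
  next
    case (step c x y)
    then obtain L ms where L: "x = fword L w" "set L \<subseteq> Pset n - Aset n" "L \<noteq> []"
      and ms: "0 \<notin> set ms" "foldr T ms y = 0" by blast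
    have "T (depth L) x = 0" using H0_fword[OF hw L(2)] L(1) by (simp add: T_def)
    then have "foldr T (ms @ [depth L]) (scale c x + y) = 0"
      using ms(2) by (simp add: f_add f_T f_scale T_add T_scale f_zero T_zero)
    moreover have "0 \<notin> set (ms @ [depth L])" using ms(1) depth_pos[OF L(2,3)] by simp
    ultimately show ?case by blast
  qed
  then obtain ms where "0 \<notin> set ms" "foldr T ms w = 0" by blast
  then show False
    using w by (auto simp: f_w prod_list_zero_iff)
qed

end


text \<open>The properties of the model that the comparison uses. Definiteness is asked only on the
  submodule generated by t: tensors will be functions on all words, while the form sees finitely
  many of them.\<close>

locale contravariant_sp_representation = sp_representation scale n \<rho>
  for scale :: "complex \<Rightarrow> 'v::ab_group_add \<Rightarrow> 'v" and n \<rho> +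
  fixes B :: "'v \<Rightarrow> 'v \<Rightarrow> complex" and mu :: weight and t :: 'v
  assumes B_add_right: "B x (y + z) = B x y + B x z"
    and B_scale_right: "B x (scale c y) = c * B x y"
    and B_contravariant:
      "(i, j) \<in> Pset n - Aset n \<Longrightarrow> B x (\<rho> (froot n i j) y) = B (\<rho> (transpose_mat (froot n i j)) x) y"
    and B_symmetric: "B y x = cnj (B x y)"
    and B_definite: "x \<in> span (fwords t) \<Longrightarrow> B x x = 0 \<Longrightarrow> x = 0"
    and hw_t: "hw_vector mu t"
    and t_nonzero: "t \<noteq> 0"
begin

lemma B_zero_right: "B x 0 = 0"
  using B_scale_right[of x 0 0] by simp

lemma B_span_zero:
  assumes "\<And>s. s \<in> S \<Longrightarrow> B x s = 0" "y \<in> span S"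
  shows "B x y = 0"
  using assms(2)
  by (induction rule: span_induct_alt) (auto simp: B_zero_right B_add_right B_scale_right assms(1))

end

section \<open>The submodule generated by (v, t) as a graph\<close>

lemma sp_representation_prod:
  assumes "sp_representation s1 n r1" "sp_representation s2 n r2"
  shows "sp_representation (\<lambda>c (x, y). (s1 c x, s2 c y)) n (\<lambda>X (x, y). (r1 X x, r2 X y))"
proof -
  interpret r1: sp_representation s1 n r1 by fact
  interpret r2: sp_representation s2 n r2 by fact
  have vs: "vector_space (\<lambda>c (x, y). (s1 c x, s2 c y))"
    by unfold_locales
      (auto simp: r1.scale_right_distrib r2.scale_right_distrib r1.scale_left_distrib
        r2.scale_left_distrib)
  show ?thesis
  proof (intro sp_representation.intro sp_representation_axioms.intro vs)
    fix X assume "X \<in> sp n"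
    then show "Vector_Spaces.linear (\<lambda>c (x, y). (s1 c x, s2 c y)) (\<lambda>c (x, y). (s1 c x, s2 c y))
        (\<lambda>(x, y). (r1 X x, r2 X y))"
      unfolding linear_iff_module_hom module_hom_iff using vs
      by (auto simp: module_iff_vector_space r1.action_vec_add r2.action_vec_add
          r1.action_vec_scale r2.action_vec_scale)
  qed (auto simp: r1.action_add r2.action_add r1.action_smult r2.action_smult
      r1.action_bracket r2.action_bracket)
qed

locale comparison =
  V: irreducible_highest_weight_representation scale n \<rho> mu v +
  T: contravariant_sp_representation scale' n \<tau> B mu t
  for scale :: "complex \<Rightarrow> 'v::ab_group_add \<Rightarrow> 'v" and n \<rho> mu v
    and scale' :: "complex \<Rightarrow> 'w::ab_group_add \<Rightarrow> 'w" and \<tau> B t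
begin

abbreviation scaleP :: "complex \<Rightarrow> 'v \<times> 'w \<Rightarrow> 'v \<times> 'w" where
  "scaleP \<equiv> \<lambda>c (x, y). (scale c x, scale' c y)"

sublocale VT: sp_representation scaleP n "\<lambda>X (x, y). (\<rho> X x, \<tau> X y)"
  by (rule sp_representation_prod) (rule V.sp_representation_axioms, rule
      T.sp_representation_axioms)

abbreviation graph :: "('v \<times> 'w) set" where
  "graph \<equiv> VT.span (VT.fwords (v, t))"

lemma fword_pair: "VT.fword L (x, y) = (V.fword L x, T.fword L y)"
  by (induction L) auto

lemma hw_v: "V.hw_vector mu v"
  using V.positive_root_vectors V.highest_weight by (auto simp: V.hw_vector_def)

lemma hw_pair: "VT.hw_vector mu (v, t)"
  using hw_v T.hw_t by (auto simp: V.hw_vector_def T.hw_vector_def VT.hw_vector_def zero_prod_def)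

lemma span_fwords_v: "V.span (V.fwords v) = UNIV"
proof -
  have "v \<in> V.span (V.fwords v)"
    unfolding V.fwords_def by (intro V.span_base) (auto intro!: exI[of _ "[]"])
  moreover have "V.span (V.fwords v) = {0} \<or> V.span (V.fwords v) = UNIV"
    by (rule V.irreducible) (auto intro: V.subspace_span V.action_span_fwords[OF hw_v])
  ultimately show ?thesis using V.highest_weight_vector_nonzero by auto
qed

text \<open>The empty word contributes the same coefficient c to both components. This common c is
  the only link between the two sides, and everything else lies in the spans of the nonempty
  words.\<close>

lemma graph_decompose:
  assumes "p \<in> graph"
  obtains c y where "fst p = scale c v + fst y" "snd p = scale' c t + snd y"
    "fst y \<in> V.span {V.fword L v | L. set L \<subseteq> Pset n - Aset n \<and> L \<noteq> []}"
    "snd y \<in> T.span {T.fword L t | L. set L \<subseteq> Pset n - Aset n \<and> L \<noteq> []}"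
    "snd p \<in> T.span (T.fwords t)"
proof -
  let ?A = "V.span {V.fword L v | L. set L \<subseteq> Pset n - Aset n \<and> L \<noteq> []}"
  let ?B = "T.span {T.fword L t | L. set L \<subseteq> Pset n - Aset n \<and> L \<noteq> []}"
  have "\<exists>c a b. fst p = scale c v + a \<and> snd p = scale' c t + b \<and> a \<in> ?A \<and> b \<in> ?B
      \<and> snd p \<in> T.span (T.fwords t)"
    using assms
  proof (induction rule: VT.span_induct_alt)
    case base
    show ?case by (rule exI[of _ 0]) (auto intro: V.span_zero T.span_zero)
  next
    case (step c x y)
    obtain c' a b where IH: "fst y = scale c' v + a" "snd y = scale' c' t + b" "a \<in> ?A" "b \<in> ?B"
      "snd y \<in> T.span (T.fwords t)"
      using step(2) by blast
    obtain L where L: "x = (V.fword L v, T.fword L t)" "set L \<subseteq> Pset n - Aset n"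
      using step(1) by (auto simp: VT.fwords_def fword_pair)
    have m: "scale' c (T.fword L t) + snd y \<in> T.span (T.fwords t)"
      using L(2) by (intro T.span_add[OF _ IH(5)] T.span_scale T.span_base) (auto simp:
          T.fwords_def)
    show ?case
    proof (cases "L = []")
      case True
      then show ?thesis using L IH m
        by (intro exI[of _ "c + c'"] exI[of _ a] exI[of _ b])
          (auto simp: V.scale_left_distrib T.scale_left_distrib algebra_simps)
    next
      case False
      have "scale c (V.fword L v) + a \<in> ?A" "scale' c (T.fword L t) + b \<in> ?B"
        using L False
        by (intro V.span_add[OF _ IH(3)] V.span_scale V.span_base; auto)
          (intro T.span_add[OF _ IH(4)] T.span_scale T.span_base; use L False in auto)
      then show ?thesis using L IH m
        by (intro exI[of _ c'] exI[of _ "scale c (V.fword L v) + a"]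
            exI[of _ "scale' c (T.fword L t) + b"])
          (auto simp: algebra_simps)
    qed
  qed
  then obtain c a b where "fst p = scale c v + a" "snd p = scale' c t + b" "a \<in> ?A" "b \<in> ?B"
      "snd p \<in> T.span (T.fwords t)" by blast
  then show ?thesis using that[of c "(a, b)"] by simp
qed

text \<open>Contravariance moves the first factor of the word to t, where it becomes a raising
  operator and gives 0.\<close>

lemma B_t_lower:
  assumes "b \<in> T.span {T.fword L t | L. set L \<subseteq> Pset n - Aset n \<and> L \<noteq> []}"
  shows "B t b = 0"
proof (rule T.B_span_zero[OF _ assms])
  fix s assume "s \<in> {T.fword L t | L. set L \<subseteq> Pset n - Aset n \<and> L \<noteq> []}"
  then obtain L where L: "s = T.fword L t" "set L \<subseteq> Pset n - Aset n" "L \<noteq> []" by blast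
  then obtain i j L' where L': "L = (i, j) # L'" by (cases L) auto
  then have "B t s = B (\<tau> (transpose_mat (froot n i j)) t) (T.fword L' t)"
    using L by (simp add: T.B_contravariant)
  also have "\<tau> (transpose_mat (froot n i j)) t = 0"
    using T.hw_t L L' by (simp add: T.hw_vector_def)
  also have "B 0 (T.fword L' t) = 0"
    using T.B_symmetric[of 0 "T.fword L' t"] T.B_zero_right by simp
  finally show "B t s = 0" .
qed

text \<open>If (0, y) lies in the graph, the coefficient c of the empty word is 0, since otherwise v
  would be a combination of its proper descendants; so y is orthogonal to t. The pairs (0, y) are
  stable under raising operators, hence y is orthogonal to every descendant of t, in particular to
  itself.\<close>

lemma graph_left_zero:
  assumes "(0, y) \<in> graph"
  shows "y = 0"
proof -
  have lower: "B t y = 0" if g: "(0, y) \<in> graph" for y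
  proof -
    obtain c z where "fst (0 :: 'v, y) = scale c v + fst z" "snd (0 :: 'v, y) = scale' c t + snd z"
      and low: "fst z \<in> V.span {V.fword L v | L. set L \<subseteq> Pset n - Aset n \<and> L \<noteq> []}"
      "snd z \<in> T.span {T.fword L t | L. set L \<subseteq> Pset n - Aset n \<and> L \<noteq> []}"
      by (rule graph_decompose[OF g])
    then have z: "0 = scale c v + fst z" "y = scale' c t + snd z" by (simp_all only: fst_conv
        snd_conv)
    have "c = 0"
    proof (rule ccontr)
      assume "c \<noteq> 0"
      then have "v = scale (inverse c) (scale c v)" by (simp add: V.scale_scale)
      also have "scale c v = - fst z" using z(1) by (simp add: eq_neg_iff_add_eq_0)
      finally have v: "v = scale (inverse c) (- fst z)" .
      have "scale (inverse c) (- fst z) \<in> V.span {V.fword L v | L. set L \<subseteq> Pset n - Aset n \<and> L \<noteq>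
          []}"
        by (rule V.span_scale[OF V.span_neg[OF low(1)]])
      then have "v \<in> V.span {V.fword L v | L. set L \<subseteq> Pset n - Aset n \<and> L \<noteq> []}"
        unfolding v[symmetric] .
      then show False
        using V.hw_vector_not_in_lower_span[OF hw_v V.highest_weight_vector_nonzero] by blast
    qed
    then show ?thesis using z(2) B_t_lower[OF low(2)] by simp
  qed
  \<comment> \<open>By contravariance the factors of the word are moved onto y one by one; each step
    stays among the pairs with left component 0, so that \<open>lower\<close> applies at the
    end.\<close>
  have Bword: "B y (T.fword L t) = 0" if "(0, y) \<in> graph" "set L \<subseteq> Pset n - Aset n" for y L
    using that
  proof (induction L arbitrary: y)
    case Nil
    then show ?case using lower T.B_symmetric[of y t] by simp
  next
    case (Cons p L)
    obtain i j where p: "p = (i, j)" by fastforce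
    have ij: "(i, j) \<in> Pset n - Aset n" using Cons.prems p by auto
    have sp: "transpose_mat (froot n i j) \<in> sp n" using ij by (auto intro!: sp_transpose froot_sp)
    have "(0, \<tau> (transpose_mat (froot n i j)) y) \<in> graph"
      using VT.action_span_fwords[OF hw_pair sp Cons.prems(1)] by (simp add: V.action_vec_zero sp)
    then show ?case using Cons.IH Cons.prems p ij by (simp add: T.B_contravariant)
  qed
  have y: "y \<in> T.span (T.fwords t)"
    by (rule graph_decompose[OF assms]) (simp only: snd_conv)
  have "B y y = 0"
    by (rule T.B_span_zero[OF _ y]) (auto simp: T.fwords_def Bword[OF assms])
  then show ?thesis using T.B_definite y by blast
qed

text \<open>The x with (x, 0) in the graph form a submodule of V, so it is 0 or everything. It does
  not contain v: pairing the right component with t gives c = 0, and then v would lie in the span of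
  its proper descendants.\<close>

lemma graph_right_zero:
  assumes "(x, 0) \<in> graph"
  shows "x = 0"
proof -
  let ?W = "{x. (x, 0) \<in> graph}"
  have "?W = {0} \<or> ?W = UNIV"
  proof (rule V.irreducible)
    show "V.subspace ?W"
      unfolding V.subspace_def
      using VT.span_zero[of "VT.fwords (v, t)"] VT.span_add[of "(_, 0)" _ "(_, 0)"]
        VT.span_scale[of "(_, 0)" "VT.fwords (v, t)"]
      by (auto simp: zero_prod_def)
    fix X w assume "X \<in> sp n" "w \<in> ?W"
    then show "\<rho> X w \<in> ?W"
      using VT.action_span_fwords[OF hw_pair, of X "(w, 0)"] by (simp add: T.action_vec_zero)
  qed
  moreover have "(v, 0) \<notin> graph"
  proof
    assume "(v, 0) \<in> graph"
    then obtain c z where "fst (v, 0 :: 'w) = scale c v + fst z" "snd (v, 0 :: 'w) = scale' c t +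
        snd z"
      and low: "fst z \<in> V.span {V.fword L v | L. set L \<subseteq> Pset n - Aset n \<and> L \<noteq> []}"
      "snd z \<in> T.span {T.fword L t | L. set L \<subseteq> Pset n - Aset n \<and> L \<noteq> []}"
      by (rule graph_decompose)
    then have z: "v = scale c v + fst z" "0 = scale' c t + snd z" by (simp_all only: fst_conv
        snd_conv)
    have "t \<in> T.span (T.fwords t)"
      unfolding T.fwords_def by (intro T.span_base) (auto intro!: exI[of _ "[]"])
    then have "B t t \<noteq> 0" using T.B_definite T.t_nonzero by blast
    moreover have "0 = c * B t t"
      using arg_cong[OF z(2), of "B t"] B_t_lower[OF low(2)]
      by (simp add: T.B_zero_right T.B_add_right T.B_scale_right)
    ultimately have "c = 0" by simp
    then have "fst z = v" using z(1) by simp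
    note low(1)[unfolded this]
    then show False
      using V.hw_vector_not_in_lower_span[OF hw_v V.highest_weight_vector_nonzero] by blast
  qed
  ultimately show ?thesis using assms by blast
qed

lemma graph_sum:
  assumes "\<And>k. k \<in> F \<Longrightarrow> set (L k) \<subseteq> Pset n - Aset n"
  shows "((\<Sum>k\<in>F. scale (c k) (V.fword (L k) v)), (\<Sum>k\<in>F. scale' (c k) (T.fword (L k) t))) \<in> graph"
proof -
  have eq: "((\<Sum>k\<in>F. scale (c k) (V.fword (L k) v)), (\<Sum>k\<in>F. scale' (c k) (T.fword (L k) t)))
      = (\<Sum>k\<in>F. scaleP (c k) (VT.fword (L k) (v, t)))"
    by (simp add: prod_eq_iff fst_sum snd_sum fword_pair)
  have "\<dots> \<in> graph"
    using assms by (intro VT.span_sum VT.span_scale VT.span_base) (auto simp: VT.fwords_def)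
  then show ?thesis using eq by simp
qed

text \<open>This carries linear independence from the model back to V: a relation between words
  applied to v holds for the same words applied to t.\<close>

lemma transfer_relation:
  assumes "\<And>k. k \<in> F \<Longrightarrow> set (L k) \<subseteq> Pset n - Aset n"
    and "(\<Sum>k\<in>F. scale (c k) (V.fword (L k) v)) = 0"
  shows "(\<Sum>k\<in>F. scale' (c k) (T.fword (L k) t)) = 0"
  using graph_left_zero graph_sum[where F = F and c = c and L = L, OF assms(1)] assms(2) by simp

text \<open>Lift the expansion of a descendant of t to the graph. The lifted left component and the
  corresponding descendant of v have the same right component, so they agree by
  \<open>graph_right_zero\<close>.\<close>

lemma transfer_spanning:
  assumes L: "\<And>k. k \<in> I \<Longrightarrow> set (L k) \<subseteq> Pset n - Aset n"
    and span: "T.fwords t \<subseteq> T.span ((\<lambda>k. T.fword (L k) t) ` I)"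
  shows "V.span ((\<lambda>k. V.fword (L k) v) ` I) = UNIV"
proof -
  have "V.fwords v \<subseteq> V.span ((\<lambda>k. V.fword (L k) v) ` I)"
  proof
    fix x assume "x \<in> V.fwords v"
    then obtain M where M: "x = V.fword M v" "set M \<subseteq> Pset n - Aset n"
      by (auto simp: V.fwords_def)
    have "\<exists>x'\<in>V.span ((\<lambda>k. V.fword (L k) v) ` I). (x', y) \<in> graph"
      if "y \<in> T.span ((\<lambda>k. T.fword (L k) t) ` I)" for y
      using that
    proof (induction rule: T.span_induct_alt)
      case base
      show ?case using VT.span_zero V.span_zero by (auto simp: zero_prod_def intro!: bexI[of _ 0])
    next
      case (step c x y)
      then obtain k x' where k: "k \<in> I" "x = T.fword (L k) t"
        and x': "x' \<in> V.span ((\<lambda>k. V.fword (L k) v) ` I)" "(x', y) \<in> graph" by auto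
      have "scaleP c (VT.fword (L k) (v, t)) + (x', y) \<in> graph"
        using L[OF k(1)] by (intro VT.span_add VT.span_scale VT.span_base x'(2)) (auto simp:
            VT.fwords_def)
      then have "(scale c (V.fword (L k) v) + x', scale' c x + y) \<in> graph"
        by (simp add: fword_pair k)
      moreover have "scale c (V.fword (L k) v) + x' \<in> V.span ((\<lambda>k. V.fword (L k) v) ` I)"
        using k by (intro V.span_add V.span_scale V.span_base x') auto
      ultimately show ?case by blast
    qed
    moreover have "T.fword M t \<in> T.span ((\<lambda>k. T.fword (L k) t) ` I)"
      using span M by (auto simp: T.fwords_def)
    ultimately obtain x' where x': "x' \<in> V.span ((\<lambda>k. V.fword (L k) v) ` I)"
      "(x', T.fword M t) \<in> graph" by blast
    have "(x, T.fword M t) \<in> graph"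
      using M by (auto simp: VT.fwords_def fword_pair intro!: VT.span_base)
    then have "(x, T.fword M t) - (x', T.fword M t) \<in> graph"
      using x'(2) by (rule VT.span_diff)
    then have "x - x' = 0" by (intro graph_right_zero) simp
    then show "x \<in> V.span ((\<lambda>k. V.fword (L k) v) ` I)" using x'(1) by simp
  qed
  then have "V.span (V.fwords v) \<subseteq> V.span ((\<lambda>k. V.fword (L k) v) ` I)"
    by (rule V.span_minimal) (rule V.subspace_span)
  then show ?thesis using span_fwords_v by auto
qed

end


section \<open>The tensor model\<close>

type_synonym word = "nat \<times> nat \<Rightarrow> int"
type_synonym tensor = "word \<Rightarrow> complex"

definition tensor_scale :: "complex \<Rightarrow> tensor \<Rightarrow> tensor" where
  "tensor_scale c f = (\<lambda>w. c * f w)"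

interpretation tensor: vector_space tensor_scale
  by unfold_locales (auto simp: tensor_scale_def fun_eq_iff algebra_simps)

section \<open>Tensor powers as functions on fillings of columns\<close>

locale column_shape =
  fixes n m :: nat and h :: "nat \<Rightarrow> nat"
  assumes h_le: "c < m \<Longrightarrow> h c \<le> n"
    and h_antimono: "c \<le> c' \<Longrightarrow> c' < m \<Longrightarrow> h c' \<le> h c"
begin

definition Pos :: "(nat \<times> nat) set" where
  "Pos = (SIGMA c:{..<m}. {..<h c})"

definition Words :: "word set" where
  "Words = Pos \<rightarrow>\<^sub>E Nset n"

lemma finite_Pos [simp]: "finite Pos"
  by (simp add: Pos_def)

lemma finite_Words [simp]: "finite Words"
  by (simp add: Words_def finite_PiE)

lemma Pos_iff: "(c, r) \<in> Pos \<longleftrightarrow> c < m \<and> r < h c"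
  by (simp add: Pos_def)

lemma Words_upd [simp]: "w \<in> Words \<Longrightarrow> p \<in> Pos \<Longrightarrow> b \<in> Nset n \<Longrightarrow> w(p := b) \<in> Words"
  by (auto simp: Words_def PiE_iff extensional_def)

lemma Words_mem [simp]: "w \<in> Words \<Longrightarrow> p \<in> Pos \<Longrightarrow> w p \<in> Nset n"
  by (auto simp: Words_def)

lemma Words_undefined: "w \<in> Words \<Longrightarrow> p \<notin> Pos \<Longrightarrow> w p = undefined"
  by (auto simp: Words_def)

lemma Words_perm:
  assumes "w \<in> Words" "\<pi> permutes Pos"
  shows "w \<circ> \<pi> \<in> Words"
  unfolding Words_def
proof (rule PiE_I)
  fix p
  show "(w \<circ> \<pi>) p \<in> Nset n" if "p \<in> Pos"
    using that assms permutes_in_image[of \<pi> Pos p] by simp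
  show "(w \<circ> \<pi>) p = undefined" if "p \<notin> Pos"
    using that assms by (simp add: permutes_not_in Words_undefined)
qed

text \<open>The derivation action on a tensor power in coordinates, where f w is the coefficient of
  the basis tensor with letters \<open>w p\<close>.\<close>

definition act :: "complex mat \<Rightarrow> tensor \<Rightarrow> tensor" where
  "act X f w = (if w \<in> Words
     then \<Sum>p\<in>Pos. \<Sum>b\<in>Nset n. entry n X (w p) b * f (w(p := b)) else 0)"

lemma act_bracket:
  assumes X: "X \<in> carrier_mat (2 * n) (2 * n)" and Y: "Y \<in> carrier_mat (2 * n) (2 * n)"
  shows "act (X * Y - Y * X) f w = act X (act Y f) w - act Y (act X f) w"
proof (cases "w \<in> Words")
  case True
  have C: "X * Y \<in> carrier_mat (2 * n) (2 * n)" "Y * X \<in> carrier_mat (2 * n) (2 * n)"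
    using X Y by auto
  \<comment> \<open>The contribution of X changing the letter at p and Y the letter at q. For
    distinct positions the two changes commute and cancel in the bracket; at one position they
    compose to a matrix product.\<close>
  define G where "G X Y p q = (\<Sum>b\<in>Nset n. \<Sum>d\<in>Nset n.
    entry n X (w p) b * (entry n Y ((w(p := b)) q) d * f (w(p := b, q := d))))" for X Y p q
  have act2: "act X (act Y f) w = (\<Sum>p\<in>Pos. \<Sum>q\<in>Pos. G X Y p q)" for X Y
  proof -
    have "act X (act Y f) w = (\<Sum>p\<in>Pos. \<Sum>b\<in>Nset n. \<Sum>q\<in>Pos. \<Sum>d\<in>Nset n.
        entry n X (w p) b * (entry n Y ((w(p := b)) q) d * f (w(p := b, q := d))))"
      using True by (simp add: act_def sum_distrib_left)
    then show ?thesis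
      unfolding G_def by (simp add: sum.swap[of _ Pos "Nset n"])
  qed
  have G_swap: "G X Y p q = G Y X q p" if "p \<noteq> q" for p q
    using that unfolding G_def
    by (subst sum.swap) (auto intro!: sum.cong simp: fun_upd_twist)
  have G_same: "G X Y p p = (\<Sum>d\<in>Nset n. entry n (X * Y) (w p) d * f (w(p := d)))"
    if "p \<in> Pos" "X \<in> carrier_mat (2 * n) (2 * n)" "Y \<in> carrier_mat (2 * n) (2 * n)" for p X Y
    using that True unfolding G_def
    by (subst sum.swap) (auto intro!: sum.cong simp: entry_mult[of X n Y] sum_distrib_right
        mult.assoc)
  have "act X (act Y f) w - act Y (act X f) w
      = (\<Sum>p\<in>Pos. \<Sum>q\<in>Pos. G X Y p q) - (\<Sum>p\<in>Pos. \<Sum>q\<in>Pos. G Y X q p)"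
    using sum.swap[of "G Y X" Pos Pos] by (simp add: act2)
  also have "\<dots> = (\<Sum>p\<in>Pos. \<Sum>q\<in>Pos. G X Y p q - G Y X q p)"
    by (simp add: sum_subtractf)
  also have "\<dots> = (\<Sum>p\<in>Pos. \<Sum>q\<in>Pos. if q = p then G X Y p p - G Y X p p else 0)"
    by (intro sum.cong refl) (auto simp: G_swap)
  also have "\<dots> = (\<Sum>p\<in>Pos. G X Y p p - G Y X p p)"
    by simp
  also have "\<dots> = (\<Sum>p\<in>Pos. \<Sum>d\<in>Nset n. entry n (X * Y - Y * X) (w p) d * f (w(p := d)))"
    using X Y C True
    by (intro sum.cong refl)
      (simp add: G_same entry_diff left_diff_distrib flip: sum_subtractf)
  finally show ?thesis using True by (simp add: act_def)
qed (simp add: act_def)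

lemma act_scale_vec: "act X (tensor_scale c f) = tensor_scale c (act X f)"
  by (auto simp: fun_eq_iff act_def tensor_scale_def sum_distrib_left intro!: sum.cong)

lemma act_add_vec: "act X (f + g) = act X f + act X g"
  by (auto simp: fun_eq_iff act_def distrib_left sum.distrib)

lemma tensor_representation: "sp_representation tensor_scale n act"
proof (intro sp_representation.intro sp_representation_axioms.intro tensor.vector_space_axioms)
  show "Vector_Spaces.linear tensor_scale tensor_scale (act X)" if "X \<in> sp n" for X
    unfolding linear_iff_module_hom module_hom_iff
    by (auto simp: act_scale_vec act_add_vec tensor.module_axioms)
  show "act (X + Y) f = act X f + act Y f" if "X \<in> sp n" "Y \<in> sp n" for X Y f
    using that[THEN sp_carrier]
    by (auto simp: fun_eq_iff act_def entry_add distrib_right sum.distrib)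
  show "act (c \<cdot>\<^sub>m X) f = tensor_scale c (act X f)" if "X \<in> sp n" for X c f
    using that[THEN sp_carrier]
    by (auto simp: fun_eq_iff act_def entry_smult tensor_scale_def sum_distrib_left mult.assoc)
  show "act (X * Y - Y * X) f = act X (act Y f) - act Y (act X f)" if "X \<in> sp n" "Y \<in> sp n" for X
      Y f
    using that[THEN sp_carrier] by (auto simp: fun_eq_iff act_bracket)
qed

section \<open>The contravariant Hermitian form\<close>

definition inner_form :: "tensor \<Rightarrow> tensor \<Rightarrow> complex" where
  "inner_form f g = (\<Sum>w\<in>Words. cnj (f w) * g w)"

lemma inner_form_definite:
  assumes "inner_form f f = 0" "\<And>w. w \<notin> Words \<Longrightarrow> f w = 0"
  shows "f = 0"
proof -
  have "inner_form f f = of_real (\<Sum>w\<in>Words. (cmod (f w))\<^sup>2)"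
    unfolding inner_form_def of_real_sum
    by (intro sum.cong refl) (metis complex_norm_square mult.commute)
  then have "(\<Sum>w\<in>Words. (cmod (f w))\<^sup>2) = 0"
    using assms(1) by (metis of_real_eq_0_iff)
  then have "\<forall>w\<in>Words. (cmod (f w))\<^sup>2 = 0"
    by (subst (asm) sum_nonneg_eq_0_iff) auto
  then show ?thesis using assms(2) by (auto simp: fun_eq_iff)
qed

text \<open>Changing a single letter is reversible: (w, b) -> (w(p := b), w p) is an involution that
  exchanges the two indices of the entry of X, hence transposes X.\<close>

lemma inner_form_adjoint:
  assumes X: "X \<in> carrier_mat (2 * n) (2 * n)"
    and real: "\<And>a b. a \<in> Nset n \<Longrightarrow> b \<in> Nset n \<Longrightarrow> cnj (entry n X a b) = entry n X a b"
  shows "inner_form f (act X g) = inner_form (act (transpose_mat X) f) g"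
proof -
  have "inner_form f (act X g)
      = (\<Sum>w\<in>Words. \<Sum>p\<in>Pos. \<Sum>b\<in>Nset n. cnj (f w) * (entry n X (w p) b * g (w(p := b))))"
    by (simp add: inner_form_def act_def sum_distrib_left)
  also have "\<dots> = (\<Sum>p\<in>Pos. \<Sum>w\<in>Words. \<Sum>b\<in>Nset n. cnj (f w) * (entry n X (w p) b * g (w(p := b))))"
    by (rule sum.swap)
  also have "\<dots> = (\<Sum>p\<in>Pos. \<Sum>w\<in>Words. \<Sum>b\<in>Nset n.
      cnj (entry n (transpose_mat X) (w p) b * f (w(p := b))) * g w)"
  proof (rule sum.cong[OF refl])
    fix p assume p: "p \<in> Pos"
    have "(\<Sum>w\<in>Words. \<Sum>b\<in>Nset n. cnj (f w) * (entry n X (w p) b * g (w(p := b))))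
        = (\<Sum>(w, b)\<in>Words \<times> Nset n. cnj (f w) * (entry n X (w p) b * g (w(p := b))))"
      by (rule sum.cartesian_product)
    also have "\<dots> = (\<Sum>(w, b)\<in>Words \<times> Nset n.
        cnj (entry n (transpose_mat X) (w p) b * f (w(p := b))) * g w)"
      by (rule sum.reindex_bij_witness[of _ "\<lambda>(w, b). (w(p := b), w p)" "\<lambda>(w, b). (w(p := b), w
          p)"])
        (use p X real in \<open>auto simp: entry_transpose\<close>)
    finally show "(\<Sum>w\<in>Words. \<Sum>b\<in>Nset n. cnj (f w) * (entry n X (w p) b * g (w(p := b))))
        = (\<Sum>w\<in>Words. \<Sum>b\<in>Nset n. cnj (entry n (transpose_mat X) (w p) b * f (w(p := b))) * g w)"
      by (simp add: sum.cartesian_product)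
  qed
  also have "\<dots> = (\<Sum>w\<in>Words. \<Sum>p\<in>Pos. \<Sum>b\<in>Nset n.
      cnj (entry n (transpose_mat X) (w p) b * f (w(p := b))) * g w)"
    by (rule sum.swap)
  also have "\<dots> = inner_form (act (transpose_mat X) f) g"
    by (simp add: inner_form_def act_def sum_distrib_right)
  finally show ?thesis .
qed

lemma act_perm:
  assumes "\<pi> permutes Pos" "w \<in> Words"
  shows "act X f (w \<circ> \<pi>)
    = (\<Sum>p\<in>Pos. \<Sum>b\<in>Nset n. entry n X (w p) b * f (w(p := b) \<circ> \<pi>))"
proof -
  have upd: "(w \<circ> \<pi>)(p := b) = w(\<pi> p := b) \<circ> \<pi>" for p b
    using permutes_inj[OF assms(1)] by (auto simp: fun_eq_iff inj_eq)
  have "act X f (w \<circ> \<pi>)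
      = (\<Sum>p\<in>Pos. \<Sum>b\<in>Nset n. entry n X (w (\<pi> p)) b * f (w(\<pi> p := b) \<circ> \<pi>))"
    using Words_perm[OF assms(2,1)] by (simp add: act_def upd)
  also have "\<dots> = (\<Sum>p\<in>Pos. \<Sum>b\<in>Nset n. entry n X (w p) b * f (w(p := b) \<circ> \<pi>))"
    by (rule sum.reindex_bij_betw[OF permutes_imp_bij[OF assms(1)]])
  finally show ?thesis .
qed

text \<open>Antisymmetry in each column, the Garnir relations between two columns, and vanishing
  contractions with the symplectic form.\<close>

definition straight_tensor :: "tensor \<Rightarrow> bool" where
  "straight_tensor f \<longleftrightarrow>
    (\<forall>c r s w. (c, r) \<in> Pos \<longrightarrow> (c, s) \<in> Pos \<longrightarrow> r \<noteq> s \<longrightarrow> w \<in> Words \<longrightarrow>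
      f (w \<circ> Transposition.transpose (c, r) (c, s)) = - f w) \<and>
    (\<forall>c c' S w. c < c' \<longrightarrow> S \<subseteq> Pos \<inter> ({c, c'} \<times> UNIV) \<longrightarrow> h c < card S \<longrightarrow> w \<in> Words \<longrightarrow>
      (\<Sum>\<pi> | \<pi> permutes S. of_int (sign \<pi>) * f (w \<circ> \<pi>)) = 0) \<and>
    (\<forall>p q w. p \<in> Pos \<longrightarrow> q \<in> Pos \<longrightarrow> p \<noteq> q \<longrightarrow> w \<in> Words \<longrightarrow>
      (\<Sum>a\<in>Nset n. of_int (sgn a) * f (w(p := a, q := - a))) = 0)"

lemma straight_tensor_swap:
  assumes "straight_tensor f" "w \<in> Words" "(c, r) \<in> Pos" "(c, s) \<in> Pos" "r \<noteq> s"
  shows "f (w \<circ> Transposition.transpose (c, r) (c, s)) = - f w"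
  using assms unfolding straight_tensor_def by (elim conjE) blast

lemma straight_tensor_garnir:
  assumes "straight_tensor f" "w \<in> Words"
    and "c < c'" "S \<subseteq> Pos \<inter> ({c, c'} \<times> UNIV)" "h c < card S"
  shows "(\<Sum>\<pi> | \<pi> permutes S. of_int (sign \<pi>) * f (w \<circ> \<pi>)) = 0"
  using assms unfolding straight_tensor_def by (elim conjE) simp

lemma straight_tensor_contraction:
  assumes "straight_tensor f" "w \<in> Words" "p \<in> Pos" "q \<in> Pos" "p \<noteq> q"
  shows "(\<Sum>a\<in>Nset n. of_int (sgn a) * f (w(p := a, q := - a))) = 0"
  using assms unfolding straight_tensor_def by (elim conjE) blast

text \<open>The symplectic form is invariant. The terms in which X acts at p and at q cancel by the
  antidiagonal symmetry \<open>sp_entry\<close>; in the remaining terms X acts elsewhere and leaves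
  contractions that are 0 by assumption.\<close>

lemma contraction_act:
  assumes X: "X \<in> sp n" and pq: "p \<in> Pos" "q \<in> Pos" "p \<noteq> q" and w: "w \<in> Words"
    and f: "\<And>w. w \<in> Words \<Longrightarrow> (\<Sum>a\<in>Nset n. of_int (sgn a) * f (w(p := a, q := - a))) = 0"
  shows "(\<Sum>a\<in>Nset n. of_int (sgn a) * act X f (w(p := a, q := - a))) = 0"
proof -
  define g where "g a p' = (\<Sum>b\<in>Nset n. of_int (sgn a) *
    (entry n X ((w(p := a, q := - a)) p') b * f (w(p := a, q := - a, p' := b))))" for a p'
  have "(\<Sum>a\<in>Nset n. of_int (sgn a) * act X f (w(p := a, q := - a)))
      = (\<Sum>a\<in>Nset n. \<Sum>p'\<in>Pos. g a p')"
    using pq w by (intro sum.cong refl) (simp add: act_def g_def sum_distrib_left)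
  also have "\<dots> = (\<Sum>p'\<in>Pos. \<Sum>a\<in>Nset n. g a p')"
    by (rule sum.swap)
  also have "\<dots> = (\<Sum>a\<in>Nset n. g a p) + ((\<Sum>a\<in>Nset n. g a q) + (\<Sum>p'\<in>Pos - {p} - {q}. \<Sum>a\<in>Nset n. g a
      p'))"
    using pq by (simp add: sum.remove[of Pos p] sum.remove[of "Pos - {p}" q])
  also have "(\<Sum>p'\<in>Pos - {p} - {q}. \<Sum>a\<in>Nset n. g a p') = 0"
  proof (rule sum.neutral, rule ballI)
    fix p' assume p': "p' \<in> Pos - {p} - {q}"
    then have upd: "w(p := a, q := - a, p' := b) = w(p' := b, p := a, q := - a)" for a b
      by (auto simp: fun_eq_iff)
    have "(\<Sum>a\<in>Nset n. g a p') = (\<Sum>b\<in>Nset n. \<Sum>a\<in>Nset n. entry n X (w p') b *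
        (of_int (sgn a) * f (w(p' := b, p := a, q := - a))))"
      unfolding g_def upd using p' by (subst sum.swap) (simp add: mult_ac)
    also have "\<dots> = (\<Sum>b\<in>Nset n. entry n X (w p') b *
        (\<Sum>a\<in>Nset n. of_int (sgn a) * f (w(p' := b, p := a, q := - a))))"
      by (simp add: sum_distrib_left)
    also have "\<dots> = 0" using p' w f by (intro sum.neutral) auto
    finally show "(\<Sum>a\<in>Nset n. g a p') = 0" .
  qed
  also have "(\<Sum>a\<in>Nset n. g a q) = - (\<Sum>a\<in>Nset n. g a p)"
  proof -
    have "(\<Sum>a\<in>Nset n. g a q) = (\<Sum>a\<in>Nset n. \<Sum>b\<in>Nset n.
        of_int (sgn a) * (entry n X (- a) b * f (w(p := a, q := b))))"
      unfolding g_def by simp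
    also have "\<dots> = (\<Sum>a\<in>Nset n. \<Sum>b\<in>Nset n.
        of_int (sgn a) * (entry n X (- a) (- b) * f (w(p := a, q := - b))))"
      by (intro sum.cong refl sum.reindex_bij_witness[of _ uminus uminus]) auto
    also have "\<dots> = (\<Sum>a\<in>Nset n. \<Sum>b\<in>Nset n.
        - (of_int (sgn b) * (entry n X b a * f (w(p := a, q := - b)))))"
    proof (intro sum.cong refl)
      fix a b assume ab: "a \<in> Nset n" "b \<in> Nset n"
      then have "sgn a * sgn a = 1" by (auto simp: Nset_iff sgn_if)
      then have "of_int (sgn a) * (of_int (sgn a) * x) = x" for x :: complex
        by (metis mult.assoc mult_1 of_int_1 of_int_mult)
      then show "of_int (sgn a) * (entry n X (- a) (- b) * f (w(p := a, q := - b)))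
          = - (of_int (sgn b) * (entry n X b a * f (w(p := a, q := - b))))"
        using sp_entry[OF X ab(2,1)] by (simp add: mult_ac)
    qed
    also have "\<dots> = - (\<Sum>b\<in>Nset n. \<Sum>a\<in>Nset n.
        of_int (sgn b) * (entry n X b a * f (w(p := a, q := - b))))"
      by (subst sum.swap) (simp add: sum_negf)
    also have "\<dots> = - (\<Sum>a\<in>Nset n. g a p)"
      unfolding g_def using pq(3) by (simp add: fun_upd_twist)
    finally show ?thesis .
  qed
  finally show ?thesis by (simp only: add.right_neutral add.right_inverse)
qed

text \<open>Permuting positions commutes with the action, so antisymmetry and the Garnir relations
  are inherited; contractions are inherited by invariance of the form.\<close>

lemma straight_tensor_act:
  assumes X: "X \<in> sp n" and f: "straight_tensor f"
  shows "straight_tensor (act X f)"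
  unfolding straight_tensor_def
proof (intro conjI allI impI)
  fix c r s w assume *: "(c, r) \<in> Pos" "(c, s) \<in> Pos" "r \<noteq> s" "w \<in> Words"
  then have perm: "Transposition.transpose (c, r) (c, s) permutes Pos"
    by (intro permutes_swap_id)
  show "act X f (w \<circ> Transposition.transpose (c, r) (c, s)) = - act X f w"
    using * straight_tensor_swap[OF f]
    by (subst act_perm[OF perm *(4)]) (simp add: act_def flip: sum_negf)
next
  fix c c' S w
  assume *: "c < c'" "S \<subseteq> Pos \<inter> ({c, c'} \<times> UNIV)" "h c < card S" "w \<in> Words"
  have "(\<Sum>\<pi> | \<pi> permutes S. of_int (sign \<pi>) * act X f (w \<circ> \<pi>))
      = (\<Sum>\<pi> | \<pi> permutes S. \<Sum>p\<in>Pos. \<Sum>b\<in>Nset n.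
          entry n X (w p) b * (of_int (sign \<pi>) * f (w(p := b) \<circ> \<pi>)))"
  proof (rule sum.cong[OF refl])
    fix \<pi> assume "\<pi> \<in> {\<pi>. \<pi> permutes S}"
    then have \<pi>: "\<pi> permutes Pos" using *(2) by (auto intro: permutes_subset)
    show "of_int (sign \<pi>) * act X f (w \<circ> \<pi>) = (\<Sum>p\<in>Pos. \<Sum>b\<in>Nset n.
        entry n X (w p) b * (of_int (sign \<pi>) * f (w(p := b) \<circ> \<pi>)))"
      unfolding act_perm[OF \<pi> *(4)] by (simp add: sum_distrib_left mult.left_commute)
  qed
  also have "\<dots> = (\<Sum>p\<in>Pos. \<Sum>b\<in>Nset n. \<Sum>\<pi> | \<pi> permutes S.
          entry n X (w p) b * (of_int (sign \<pi>) * f (w(p := b) \<circ> \<pi>)))"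
    by (subst sum.swap, rule sum.cong[OF refl], rule sum.swap)
  also have "\<dots> = (\<Sum>p\<in>Pos. \<Sum>b\<in>Nset n. entry n X (w p) b *
      (\<Sum>\<pi> | \<pi> permutes S. of_int (sign \<pi>) * f (w(p := b) \<circ> \<pi>)))"
    by (simp add: sum_distrib_left)
  also have "\<dots> = 0"
    by (intro sum.neutral ballI) (simp add: straight_tensor_garnir[OF f _ *(1-3)] *(4))
  finally show "(\<Sum>\<pi> | \<pi> permutes S. of_int (sign \<pi>) * act X f (w \<circ> \<pi>)) = 0" .
next
  fix p q w assume "p \<in> Pos" "q \<in> Pos" "p \<noteq> q" "w \<in> Words"
  then show "(\<Sum>a\<in>Nset n. of_int (sgn a) * act X f (w(p := a, q := - a))) = 0"
    by (intro contraction_act[OF X] straight_tensor_contraction[OF f])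
qed

end


section \<open>The highest weight tensor\<close>

lemma det_permute_cols:
  assumes A: "A \<in> carrier_mat k k" and p: "p permutes {0..<k}"
  shows "det (mat k k (\<lambda>(i, j). A $$ (i, p j))) = signof p * det A"
proof -
  have pk: "p j < k" if "j < k" for j
    using permutes_in_image[OF p, of j] that by simp
  have eq: "transpose_mat (mat k k (\<lambda>(i, j). A $$ (i, p j)))
      = mat k k (\<lambda>(i, j). transpose_mat A $$ (p i, j))"
    using A pk by (intro eq_matI) auto
  have "det (mat k k (\<lambda>(i, j). A $$ (i, p j)))
      = det (transpose_mat (mat k k (\<lambda>(i, j). A $$ (i, p j))))"
    by (rule det_transpose[of _ k, symmetric]) simp
  also have "\<dots> = signof p * det (transpose_mat A)"
    unfolding eq using A p by (intro det_permute_rows) auto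
  finally show ?thesis using A by (simp add: det_transpose)
qed

lemma det_zero_row:
  assumes "A \<in> carrier_mat k k" "i < k" "\<And>j. j < k \<Longrightarrow> A $$ (i, j) = 0"
  shows "det A = 0"
proof -
  have "(\<Prod>r = 0..<k. A $$ (r, p r)) = 0" if "p permutes {0..<k}" for p
    using assms permutes_in_image[OF that, of i] by (intro prod_zero) (auto intro!: bexI[of _ i])
  then show ?thesis by (simp add: det_def'[OF assms(1)])
qed

text \<open>Composing with the transposition of x and y leaves the word unchanged and reverses every
  sign, so the sum equals its own negative.\<close>

lemma signed_sum_repeated:
  fixes g :: "('a \<Rightarrow> 'b) \<Rightarrow> 'c::{ring_char_0,idom}"
  assumes "finite S" "x \<in> S" "y \<in> S" "x \<noteq> y" "w x = w y"
  shows "(\<Sum>\<pi> | \<pi> permutes S. of_int (sign \<pi>) * g (w \<circ> \<pi>)) = 0"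
proof -
  let ?\<tau> = "Transposition.transpose x y"
  have w: "w \<circ> ?\<tau> = w"
    using assms(5) by (auto simp: fun_eq_iff Transposition.transpose_def)
  have \<tau>: "?\<tau> permutes S" using assms by (intro permutes_swap_id)
  have sgn: "sign (?\<tau> \<circ> \<pi>) = - sign \<pi>" if "\<pi> permutes S" for \<pi>
    using that \<tau> assms(1,4)
    by (subst sign_compose) (auto simp: sign_swap_id permutation_permutes)
  have invol: "?\<tau> \<circ> (?\<tau> \<circ> \<pi>) = \<pi>" for \<pi> :: "'a \<Rightarrow> 'a"
    by (auto simp: fun_eq_iff)
  have "(\<Sum>\<pi> | \<pi> permutes S. of_int (sign \<pi>) * g (w \<circ> \<pi>))
      = (\<Sum>\<pi> | \<pi> permutes S. of_int (sign (?\<tau> \<circ> \<pi>)) * g (w \<circ> (?\<tau> \<circ> \<pi>)))"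
    by (rule sum.reindex_bij_witness[of _ "\<lambda>\<pi>. ?\<tau> \<circ> \<pi>" "\<lambda>\<pi>. ?\<tau> \<circ> \<pi>"])
      (auto intro: permutes_compose \<tau> simp: invol)
  also have "\<dots> = - (\<Sum>\<pi> | \<pi> permutes S. of_int (sign \<pi>) * g (w \<circ> \<pi>))"
    unfolding sum_negf[symmetric]
    by (intro sum.cong refl) (simp add: sgn o_assoc w)
  finally show ?thesis by simp
qed

lemma cnj_entry_froot:
  assumes "i \<in> Nset n" "j \<in> Nset n" "a \<in> Nset n" "b \<in> Nset n"
  shows "cnj (entry n (froot n i j) a b) = entry n (froot n i j) a b"
proof -
  have "entry n (froot n i j) a b
      = of_int (of_bool (a = j \<and> b = i) - sgn j * of_bool (a = - i \<and> b = - j))"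
    unfolding entry_froot[OF assms] by simp
  then show ?thesis by (simp only: complex_cnj_of_int)
qed

context column_shape
begin

text \<open>One formula for two objects: with the Kronecker delta for \<open>\<phi>\<close> it gives
  the coefficients of the highest weight tensor, with the variables z_{a,b} it gives the products
  D_w. Both are then expanded over the same column permutations.\<close>

definition column_minors :: "(int \<Rightarrow> int \<Rightarrow> 'a::comm_ring_1) \<Rightarrow> word \<Rightarrow> 'a" where
  "column_minors \<phi> w = (\<Prod>c<m. det (mat (h c) (h c) (\<lambda>(r, s). \<phi> (int r + 1) (w (c, s)))))"

text \<open>The tensor product over all columns of the antisymmetrization of e_1, ..., e_k, where k
  = \<open>h c\<close>: the coefficient is a product of signs if every column is a permutation of 1,
  ..., k, and 0 otherwise.\<close>

definition hw_tensor :: tensor where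
  "hw_tensor w = (if w \<in> Words then column_minors (\<lambda>a b. of_bool (a = b)) w else 0)"

lemma column_minors_swap:
  assumes "(c, r) \<in> Pos" "(c, s) \<in> Pos" "r \<noteq> s"
  shows "column_minors \<phi> (w \<circ> Transposition.transpose (c, r) (c, s)) = - column_minors \<phi> w"
proof -
  let ?w = "w \<circ> Transposition.transpose (c, r) (c, s)"
  let ?M = "\<lambda>w c. mat (h c) (h c) (\<lambda>(r, s). \<phi> (int r + 1) (w (c, s)))"
  have c: "c < m" "r < h c" "s < h c" using assms by (auto simp: Pos_iff)
  have perm: "Transposition.transpose r s permutes {0..<h c}"
    using c by (intro permutes_swap_id) auto
  have "?M ?w c = mat (h c) (h c) (\<lambda>(i, j). ?M w c $$ (i, Transposition.transpose r s j))"
    using c by (intro eq_matI) (auto simp: Transposition.transpose_def)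
  then have "det (?M ?w c) = - det (?M w c)"
    using assms(3) by (simp add: det_permute_cols[OF _ perm] sign_swap_id)
  moreover have "?M ?w c' = ?M w c'" if "c' \<noteq> c" for c'
    using that by (intro eq_matI) (auto simp: Transposition.transpose_def)
  ultimately show ?thesis
    using c(1) unfolding column_minors_def
    by (simp add: prod.remove[of "{..<m}" c])
qed

lemma hw_tensor_letters:
  assumes "hw_tensor w \<noteq> 0" "c < m"
  shows "(\<lambda>s. w (c, s)) ` {..<h c} = {1..int (h c)}" "inj_on (\<lambda>s. w (c, s)) {..<h c}"
proof -
  let ?A = "mat (h c) (h c) (\<lambda>(r, s). of_bool (int r + 1 = w (c, s)) :: complex)"
  have det: "det ?A \<noteq> 0"
    using assms by (auto simp: hw_tensor_def column_minors_def split: if_splits)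
  have sub: "{1..int (h c)} \<subseteq> (\<lambda>s. w (c, s)) ` {..<h c}"
  proof
    fix i assume i: "i \<in> {1..int (h c)}"
    show "i \<in> (\<lambda>s. w (c, s)) ` {..<h c}"
    proof (rule ccontr)
      assume "i \<notin> (\<lambda>s. w (c, s)) ` {..<h c}"
      then have "det ?A = 0"
        using i by (intro det_zero_row[of _ "h c" "nat (i - 1)"]) auto
      then show False using det by simp
    qed
  qed
  have "card ((\<lambda>s. w (c, s)) ` {..<h c}) \<le> card {1..int (h c)}"
    using card_image_le[of "{..<h c}" "\<lambda>s. w (c, s)"] by simp
  with sub show *: "(\<lambda>s. w (c, s)) ` {..<h c} = {1..int (h c)}"
    by (metis card_seteq finite_imageI finite_lessThan)
  show "inj_on (\<lambda>s. w (c, s)) {..<h c}"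
    by (rule eq_card_imp_inj_on) (simp_all add: *)
qed

lemma hw_tensor_letter:
  assumes "hw_tensor w \<noteq> 0" "(c, s) \<in> Pos"
  shows "0 < w (c, s)" "w (c, s) \<le> int (h c)"
proof -
  have "w (c, s) \<in> (\<lambda>s. w (c, s)) ` {..<h c}" "c < m"
    using assms(2) by (auto simp: Pos_iff)
  then have "w (c, s) \<in> {1..int (h c)}"
    using hw_tensor_letters(1)[OF assms(1)] by simp
  then show "0 < w (c, s)" "w (c, s) \<le> int (h c)" by auto
qed

lemma hw_tensor_outside: "w \<notin> Words \<Longrightarrow> hw_tensor w = 0"
  by (simp add: hw_tensor_def)

lemma hw_tensor_swap:
  assumes "(c, r) \<in> Pos" "(c, s) \<in> Pos" "r \<noteq> s" "w \<in> Words"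
  shows "hw_tensor (w \<circ> Transposition.transpose (c, r) (c, s)) = - hw_tensor w"
  using assms Words_perm[OF assms(4) permutes_swap_id[OF assms(1,2)]]
  by (simp add: hw_tensor_def column_minors_swap)

text \<open>For the Garnir relations: where the tensor is nonzero, columns c and c' contain only
  letters up to \<open>h c\<close>, and S has more positions than that. So either a letter is
  repeated and the signed sum cancels, or every term is 0. Contractions vanish because a and -a are
  not both positive.\<close>

lemma hw_tensor_straight: "straight_tensor hw_tensor"
  unfolding straight_tensor_def
proof (intro conjI allI impI)
  fix c r s w assume "(c, r) \<in> Pos" "(c, s) \<in> Pos" "r \<noteq> s" "w \<in> Words"
  then show "hw_tensor (w \<circ> Transposition.transpose (c, r) (c, s)) = - hw_tensor w"
    by (rule hw_tensor_swap)
next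
  fix c c' S w
  assume *: "c < c'" "S \<subseteq> Pos \<inter> ({c, c'} \<times> UNIV)" "h c < card S" "w \<in> Words"
  have fin: "finite S" using * by (auto intro: finite_subset[OF _ finite_Pos])
  show "(\<Sum>\<pi> | \<pi> permutes S. of_int (sign \<pi>) * hw_tensor (w \<circ> \<pi>)) = 0"
  proof (cases "inj_on w S")
    case False
    then obtain x y where "x \<in> S" "y \<in> S" "x \<noteq> y" "w x = w y" by (auto simp: inj_on_def)
    then show ?thesis by (intro signed_sum_repeated[OF fin])
  next
    case True
    have "hw_tensor (w \<circ> \<pi>) = 0" if \<pi>: "\<pi> permutes S" for \<pi>
    proof (rule ccontr)
      assume nz: "hw_tensor (w \<circ> \<pi>) \<noteq> 0"
      have "(w \<circ> \<pi>) p \<in> {1..int (h c)}" if "p \<in> S" for p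
      proof -
        obtain d s where ds: "p = (d, s)" by fastforce
        then have p: "p = (d, s)" "(d, s) \<in> Pos" "d = c \<or> d = c'"
          using that *(2) by auto
        have "h d \<le> h c" using p *(1) h_antimono[of c d] by (auto simp: Pos_iff)
        then show ?thesis using hw_tensor_letter[OF nz p(2)] p(1) by auto
      qed
      then have "(w \<circ> \<pi>) ` S \<subseteq> {1..int (h c)}" by blast
      then have "w ` S \<subseteq> {1..int (h c)}"
        using permutes_image[OF \<pi>] by (metis image_comp)
      then have "card (w ` S) \<le> h c"
        using card_mono[of "{1..int (h c)}" "w ` S"] by simp
      then show False using *(3) True by (simp add: card_image)
    qed
    then show ?thesis by (intro sum.neutral) auto
  qed
next
  fix p q w assume *: "p \<in> Pos" "q \<in> Pos" "p \<noteq> q" "w \<in> Words"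
  have "hw_tensor (w(p := a, q := - a)) = 0" for a
  proof (rule ccontr)
    assume nz: "hw_tensor (w(p := a, q := - a)) \<noteq> 0"
    have "0 < (w(p := a, q := - a)) p" "0 < (w(p := a, q := - a)) q"
      using hw_tensor_letter(1)[OF nz, of "fst p" "snd p"] hw_tensor_letter(1)[OF nz, of "fst q"
          "snd q"] *(1,2)
      by (simp_all only: prod.collapse)
    then show False using *(3) by simp
  qed
  then show "(\<Sum>a\<in>Nset n. of_int (sgn a) * hw_tensor (w(p := a, q := - a))) = 0" by simp
qed

lemma hw_tensor_nonzero: "hw_tensor \<noteq> 0"
proof -
  define w where "w = restrict (\<lambda>(c, s). int s + 1) Pos"
  have "int s + 1 \<in> Nset n" if "(c, s) \<in> Pos" for c s
    using that h_le[of c] by (simp add: Pos_iff Nset_iff)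
  then have "w \<in> Words"
    unfolding w_def Words_def by (intro PiE_I) auto
  moreover have "mat (h c) (h c) (\<lambda>(r, s). of_bool (int r + 1 = w (c, s))) = (1\<^sub>m (h c) :: complex
      mat)"
    if "c < m" for c
    using that by (intro eq_matI) (auto simp: w_def Pos_iff)
  ultimately have "hw_tensor w = 1"
    by (simp add: hw_tensor_def column_minors_def)
  then show ?thesis by (auto dest: fun_cong[of _ _ w])
qed

text \<open>If replacing some i by j gives a nonzero coefficient, the new column is a permutation of
  an initial segment containing i < j. Hence the old column contained i exactly twice, and the two
  replacements differ by a transposition, so they cancel.\<close>

lemma raising_sum_zero:
  assumes ij: "0 < i" "i < j" "j \<in> Nset n" and w: "w \<in> Words" and c: "c < m"
  shows "(\<Sum>s | s < h c \<and> w (c, s) = i. hw_tensor (w((c, s) := j))) = 0"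
proof (cases "\<forall>s. s < h c \<and> w (c, s) = i \<longrightarrow> hw_tensor (w((c, s) := j)) = 0")
  case False
  then obtain s where s: "s < h c" "w (c, s) = i" "hw_tensor (w((c, s) := j)) \<noteq> 0" by blast
  let ?w = "w((c, s) := j)"
  note L = hw_tensor_letters[OF s(3) c]
  have "j \<le> int (h c)" using L(1) s(1) by (auto simp: set_eq_iff image_iff)
  then have "i \<in> (\<lambda>s. ?w (c, s)) ` {..<h c}" unfolding L(1) using ij by simp
  then obtain s' where s': "s' < h c" "?w (c, s') = i" by auto
  have ne: "s' \<noteq> s" using s' ij by auto
  have S: "{s. s < h c \<and> w (c, s) = i} = {s, s'}"
  proof (intro equalityI subsetI)
    fix x assume x: "x \<in> {s. s < h c \<and> w (c, s) = i}"
    show "x \<in> {s, s'}"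
    proof (cases "x = s")
      case False
      then have "?w (c, x) = ?w (c, s')" using x s' by simp
      then show ?thesis using inj_onD[OF L(2), of x s'] x s' by auto
    qed simp
  qed (use s s' ne in auto)
  have "w((c, s') := j) = ?w \<circ> Transposition.transpose (c, s) (c, s')"
    using s s' ne by (auto simp: fun_eq_iff Transposition.transpose_def)
  moreover have "?w \<in> Words" using w ij s c by (simp add: Pos_iff)
  ultimately have "hw_tensor (w((c, s') := j)) = - hw_tensor ?w"
    using hw_tensor_swap[of c s s' ?w] s s' c ne by (simp add: Pos_iff)
  then show ?thesis using ne by (simp add: S)
qed auto

lemma hw_tensor_raising:
  assumes ij: "(i, j) \<in> Pset n - Aset n"
  shows "act (transpose_mat (froot n i j)) hw_tensor = 0"
proof
  fix w
  note P = Pset_minus_AsetD[OF ij]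
  show "act (transpose_mat (froot n i j)) hw_tensor w = 0 w"
  proof (cases "w \<in> Words")
    case True
    \<comment> \<open>A transposed root vector evaluates the tensor after replacing i by j or -j by
      -i. The second replacement produces a negative letter and is removed by this fact, as is the
      first one when j is negative.\<close>
    have neg: "hw_tensor (w(p := b)) = 0" if "p \<in> Pos" "b < 0" for p b
      using hw_tensor_letter(1)[of "w(p := b)" "fst p" "snd p"] that by auto
    have "act (transpose_mat (froot n i j)) hw_tensor w
        = (\<Sum>p\<in>Pos. if w p = i then hw_tensor (w(p := j)) else 0)"
    proof -
      have "(\<Sum>b\<in>Nset n. entry n (transpose_mat (froot n i j)) (w p) b * hw_tensor (w(p := b)))
          = (if w p = i then hw_tensor (w(p := j)) else 0)" if p: "p \<in> Pos" for p
      proof -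
        have "(\<Sum>b\<in>Nset n. entry n (transpose_mat (froot n i j)) (w p) b * hw_tensor (w(p := b)))
            = (\<Sum>b\<in>Nset n. if b = j then (if w p = i then hw_tensor (w(p := j)) else 0) else 0)"
          using p True P neg[OF p]
          by (intro sum.cong refl) (auto simp: entry_transpose entry_froot)
        then show ?thesis using P by simp
      qed
      then show ?thesis using True by (simp add: act_def)
    qed
    also have "\<dots> = (\<Sum>c<m. \<Sum>s<h c. if w (c, s) = i then hw_tensor (w((c, s) := j)) else 0)"
      unfolding Pos_def by (subst sum.Sigma) auto
    also have "\<dots> = (\<Sum>c<m. \<Sum>s | s < h c \<and> w (c, s) = i. hw_tensor (w((c, s) := j)))"
    proof (rule sum.cong[OF refl])
      fix c
      show "(\<Sum>s<h c. if w (c, s) = i then hw_tensor (w((c, s) := j)) else 0)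
          = (\<Sum>s | s < h c \<and> w (c, s) = i. hw_tensor (w((c, s) := j)))"
        by (rule sum.mono_neutral_cong_right) auto
    qed
    also have "\<dots> = 0"
    proof (cases "j < 0")
      case True
      then show ?thesis by (intro sum.neutral ballI) (auto intro!: neg simp: Pos_iff)
    next
      case False
      then have "i < j" using P by auto
      then show ?thesis using raising_sum_zero[OF P(3) _ P(2) True] by simp
    qed
    finally show ?thesis by simp
  qed (simp add: act_def)
qed

text \<open>At positive i, the i-th coordinate of the sum of the fundamental weights belonging to
  the column heights.\<close>

definition shape_weight :: weight where
  "shape_weight i = int (card {c. c < m \<and> i \<le> int (h c)})"

lemma hw_tensor_diagonal:
  assumes H: "H \<in> sp n" "diagonal_mat H" and lam: "\<And>i. i \<in> {1..int n} \<Longrightarrow> lam i = shape_weight i"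
  shows "act H hw_tensor = tensor_scale (weight_eval n lam H) hw_tensor"
proof
  fix w
  show "act H hw_tensor w = tensor_scale (weight_eval n lam H) hw_tensor w"
  proof (cases "w \<in> Words")
    case True
    have diag: "entry n H a b = 0" if "a \<in> Nset n" "b \<in> Nset n" "a \<noteq> b" for a b
    proof -
      have "N_index n a \<noteq> N_index n b"
        using that bij_betw_N_index[of n] by (auto simp: bij_betw_def inj_on_def)
      then show ?thesis
        using H that sp_carrier[OF H(1)] by (auto simp: entry_def diagonal_mat_def N_index_less)
    qed
    have "act H hw_tensor w = (\<Sum>p\<in>Pos. entry n H (w p) (w p)) * hw_tensor w"
    proof -
      have "(\<Sum>b\<in>Nset n. entry n H (w p) b * hw_tensor (w(p := b)))
          = entry n H (w p) (w p) * hw_tensor w" if p: "p \<in> Pos" for p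
      proof -
        have "(\<Sum>b\<in>Nset n. entry n H (w p) b * hw_tensor (w(p := b)))
            = (\<Sum>b\<in>Nset n. if b = w p then entry n H (w p) (w p) * hw_tensor w else 0)"
          using p True diag by (intro sum.cong refl) auto
        then show ?thesis using p True by simp
      qed
      then show ?thesis using True by (simp add: act_def sum_distrib_right)
    qed
    also have "\<dots> = weight_eval n lam H * hw_tensor w"
    proof (cases "hw_tensor w = 0")
      case nz: False
      have "(\<Sum>p\<in>Pos. entry n H (w p) (w p)) = (\<Sum>c<m. \<Sum>s<h c. entry n H (w (c, s)) (w (c, s)))"
        unfolding Pos_def by (subst sum.Sigma) auto
      also have "\<dots> = (\<Sum>c<m. \<Sum>i\<in>{1..int (h c)}. entry n H i i)"
      proof (rule sum.cong[OF refl])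
        fix c assume "c \<in> {..<m}"
        then have "bij_betw (\<lambda>s. w (c, s)) {..<h c} {1..int (h c)}"
          using hw_tensor_letters[OF nz, of c] by (simp add: bij_betw_def)
        then show "(\<Sum>s<h c. entry n H (w (c, s)) (w (c, s))) = (\<Sum>i\<in>{1..int (h c)}. entry n H i i)"
          by (rule sum.reindex_bij_betw)
      qed
      also have "\<dots> = (\<Sum>c<m. \<Sum>i\<in>{1..int n}. if i \<le> int (h c) then entry n H i i else 0)"
      proof (rule sum.cong[OF refl])
        fix c assume "c \<in> {..<m}"
        then show "(\<Sum>i\<in>{1..int (h c)}. entry n H i i)
            = (\<Sum>i\<in>{1..int n}. if i \<le> int (h c) then entry n H i i else 0)"
          using h_le[of c] by (intro sum.mono_neutral_cong_left) auto
      qed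
      also have "\<dots> = (\<Sum>i\<in>{1..int n}. \<Sum>c<m. if i \<le> int (h c) then entry n H i i else 0)"
        by (rule sum.swap)
      also have "\<dots> = (\<Sum>i\<in>{1..int n}. of_int (lam i) * entry n H i i)"
      proof (rule sum.cong[OF refl])
        fix i assume i: "i \<in> {1..int n}"
        have "(\<Sum>c<m. if i \<le> int (h c) then entry n H i i else 0)
            = (\<Sum>c | c < m \<and> i \<le> int (h c). entry n H i i)"
          by (rule sum.mono_neutral_cong_right) auto
        then show "(\<Sum>c<m. if i \<le> int (h c) then entry n H i i else 0) = of_int (lam i) * entry n H
            i i"
          using lam[OF i] by (simp add: shape_weight_def)
      qed
      also have "\<dots> = weight_eval n lam H"
        unfolding weight_eval_def
        by (rule sum.reindex_bij_witness[of _ "\<lambda>r. int r + 1" "\<lambda>i. nat (i - 1)"])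
          (auto simp: entry_def N_index_def)
      finally show ?thesis by simp
    qed simp
    finally show ?thesis by (simp add: tensor_scale_def)
  qed (simp add: act_def tensor_scale_def hw_tensor_outside)
qed

lemma hw_tensor_span_outside:
  assumes "f \<in> tensor.span (sp_representation.fwords n act hw_tensor)" "w \<notin> Words"
  shows "f w = 0"
proof -
  interpret sp_representation tensor_scale n act by (rule tensor_representation)
  have *: "fword L hw_tensor w = 0" for L
    using assms(2) by (cases L) (auto simp: act_def hw_tensor_outside)
  show ?thesis
    using assms(1) by (induction rule: tensor.span_induct_alt) (auto simp: tensor_scale_def
        fwords_def *)
qed

lemma tensor_contravariant:
  assumes lam: "\<And>i. i \<in> {1..int n} \<Longrightarrow> lam i = shape_weight i"
  shows "contravariant_sp_representation tensor_scale n act inner_form lam hw_tensor"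
proof -
  interpret sp_representation tensor_scale n act by (rule tensor_representation)
  have adjoint: "inner_form f (act (froot n i j) g) = inner_form (act (transpose_mat (froot n i
      j)) f) g"
    if "(i, j) \<in> Pset n - Aset n" for i j f g
    by (rule inner_form_adjoint[OF froot_carrier cnj_entry_froot[OF Pset_minus_AsetD(1,2)[OF
        that]]])
  have definite: "f = 0" if "f \<in> tensor.span (fwords hw_tensor)" "inner_form f f = 0" for f
    by (rule inner_form_definite[OF that(2) hw_tensor_span_outside[OF that(1)]])
  show ?thesis
  proof (intro contravariant_sp_representation.intro contravariant_sp_representation_axioms.intro
      tensor_representation)
    show "inner_form f (g + k) = inner_form f g + inner_form f k" for f g k
      by (simp add: inner_form_def distrib_left sum.distrib)
    show "inner_form f (tensor_scale c g) = c * inner_form f g" for f c g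
      by (simp add: inner_form_def tensor_scale_def sum_distrib_left mult_ac)
    show "inner_form g f = cnj (inner_form f g)" for f g
      by (simp add: inner_form_def mult.commute)
    show "hw_vector lam hw_tensor"
      by (auto simp: hw_vector_def hw_tensor_raising intro!: hw_tensor_diagonal lam)
  qed (use adjoint definite hw_tensor_nonzero in blast)+
qed

lemma fword_straight:
  assumes "set L \<subseteq> Pset n - Aset n"
  shows "straight_tensor (foldr (\<lambda>(i, j). act (froot n i j)) L hw_tensor)"
  using assms
proof (induction L)
  case (Cons p L)
  then show ?case by (cases p) (simp add: straight_tensor_act froot_sp)
qed (simp add: hw_tensor_straight)

end


section \<open>Straightening\<close>

text \<open>Equal sizes give a bijection from U - V to V - U along which every value drops. It
  serves the Garnir step, the moves of pairs in a column and the rearrangement inequality.\<close>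

lemma sum_less_exchange:
  fixes g :: "'a \<Rightarrow> nat"
  assumes fin: "finite U" "finite V" and card: "card U = card V" and ne: "U \<noteq> V"
    and less: "\<And>x y. x \<in> U - V \<Longrightarrow> y \<in> V - U \<Longrightarrow> g y < g x"
  shows "sum g V < sum g U"
proof -
  have c: "card (U - V) = card (V - U)"
    using fin card by (metis card_Diff_subset_Int Int_commute finite_Int)
  then obtain b where b: "bij_betw b (U - V) (V - U)"
    using fin by (metis finite_Diff finite_same_card_bij)
  have "U - V \<noteq> {}"
  proof
    assume "U - V = {}"
    then have "U \<subseteq> V" by blast
    then show False using ne card card_subset_eq[OF fin(2)] by blast
  qed
  have "sum g (V - U) = (\<Sum>x\<in>U - V. g (b x))"
    by (rule sum.reindex_bij_betw[OF b, symmetric])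
  also have "\<dots> < sum g (U - V)"
    using b fin \<open>U - V \<noteq> {}\<close> by (intro sum_strict_mono) (auto simp: bij_betw_def intro!: less)
  finally show ?thesis
    using fin by (simp add: sum.Int_Diff[of V g U] sum.Int_Diff[of U g V] Int_commute)
qed

text \<open>The position of a letter in King's order \<open>1 < -1 < 2 < -2 < \<dots> < n < -n\<close>.\<close>

definition kappa :: "int \<Rightarrow> nat" where
  "kappa b = (if b > 0 then nat (2 * b - 1) else nat (- 2 * b))"

lemma kappa_less_imp_abs_le: "kappa a < kappa b \<Longrightarrow> \<bar>a\<bar> \<le> \<bar>b\<bar>"
  by (auto simp: kappa_def split: if_splits)

lemma kappa_eq_iff: "kappa a = kappa b \<longleftrightarrow> a = b"
proof
  assume "kappa a = kappa b"
  moreover have "2 * b - 1 \<noteq> - 2 * a" "2 * a - 1 \<noteq> - 2 * b" by presburger+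
  ultimately show "a = b" by (auto simp: kappa_def split: if_splits)
qed simp

section \<open>King tableaux and the Garnir step\<close>

context column_shape
begin

text \<open>King's symplectic tableaux, ordered by \<open>kappa\<close>. Rows are numbered from 0,
  so the condition on absolute values says that row s + 1, counted from 1, has letters of absolute
  value at least s + 1.\<close>

definition king :: "word \<Rightarrow> bool" where
  "king w \<longleftrightarrow> w \<in> Words \<and>
    (\<forall>c r s. (c, s) \<in> Pos \<longrightarrow> r < s \<longrightarrow> kappa (w (c, r)) < kappa (w (c, s))) \<and>
    (\<forall>c s. (c, s) \<in> Pos \<longrightarrow> int s < \<bar>w (c, s)\<bar>) \<and>
    (\<forall>c r. (Suc c, r) \<in> Pos \<longrightarrow> kappa (w (c, r)) \<le> kappa (w (Suc c, r)))"

lemma finite_king: "finite {w. king w}"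
  by (rule finite_subset[OF _ finite_Words]) (auto simp: king_def)

text \<open>The coefficients do not depend on f, so the identity holds between coordinate
  functionals on the whole submodule and not only for a single tensor.\<close>

definition straightens :: "word \<Rightarrow> bool" where
  "straightens w \<longleftrightarrow> (\<exists>a. \<forall>f. straight_tensor f \<longrightarrow> f w = (\<Sum>u | king u. a u * f u))"

lemma straightens_king: "king w \<Longrightarrow> straightens w"
  unfolding straightens_def
  by (intro exI[of _ "\<lambda>u. of_bool (u = w)"]) (simp add: finite_king)

lemma straightens_combination:
  assumes "finite A" "\<And>x. x \<in> A \<Longrightarrow> b x \<noteq> 0 \<Longrightarrow> straightens (u x)"
    and f: "\<And>f. straight_tensor f \<Longrightarrow> f w = (\<Sum>x\<in>A. b x * f (u x))"
  shows "straightens w"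
proof -
  have "\<forall>x\<in>A. \<exists>a. \<forall>f. straight_tensor f \<longrightarrow> b x * f (u x) = b x * (\<Sum>v | king v. a v * f v)"
  proof
    fix x assume x: "x \<in> A"
    show "\<exists>a. \<forall>f. straight_tensor f \<longrightarrow> b x * f (u x) = b x * (\<Sum>v | king v. a v * f v)"
    proof (cases "b x = 0")
      case False
      then obtain a where a: "\<forall>f. straight_tensor f \<longrightarrow> f (u x) = (\<Sum>v | king v. a v * f v)"
        using assms(2)[OF x] unfolding straightens_def by blast
      show ?thesis
      proof (intro exI[of _ a] allI impI)
        fix f assume "straight_tensor f"
        then have "f (u x) = (\<Sum>v | king v. a v * f v)" using a by blast
        then show "b x * f (u x) = b x * (\<Sum>v | king v. a v * f v)" by (rule arg_cong)
      qed
    qed simp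
  qed
  from bchoice[OF this] obtain a where a: "\<forall>x\<in>A. \<forall>f. straight_tensor f \<longrightarrow>
      b x * f (u x) = b x * (\<Sum>v | king v. a x v * f v)"
    by blast
  have "f w = (\<Sum>v | king v. (\<Sum>x\<in>A. b x * a x v) * f v)" if st: "straight_tensor f" for f
  proof -
    have "f w = (\<Sum>x\<in>A. b x * f (u x))" by (rule f[OF st])
    also have "\<dots> = (\<Sum>x\<in>A. \<Sum>v | king v. b x * a x v * f v)"
    proof (rule sum.cong[OF refl])
      fix x assume "x \<in> A"
      then have "b x * f (u x) = b x * (\<Sum>v | king v. a x v * f v)" using a st by blast
      then show "b x * f (u x) = (\<Sum>v | king v. b x * a x v * f v)"
        by (simp only: sum_distrib_left mult.assoc)
    qed
    also have "\<dots> = (\<Sum>v | king v. \<Sum>x\<in>A. b x * a x v * f v)" by (rule sum.swap)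
    finally show ?thesis by (simp only: sum_distrib_right)
  qed
  then show ?thesis
    unfolding straightens_def by (intro exI[of _ "\<lambda>v. \<Sum>x\<in>A. b x * a x v"] allI impI)
qed

lemma straightens_zero:
  assumes "\<And>f. straight_tensor f \<Longrightarrow> f w = 0"
  shows "straightens w"
  unfolding straightens_def
proof (intro exI[of _ "\<lambda>_. 0"] allI impI)
  fix f assume "straight_tensor f"
  then have "f w = 0" by (rule assms)
  then show "f w = (\<Sum>u | king u. 0 * f u)" by simp
qed

lemma straight_tensor_repeated:
  assumes "straight_tensor f" "w \<in> Words" "(c, r) \<in> Pos" "(c, s) \<in> Pos" "r \<noteq> s" "w (c, r) = w (c,
      s)"
  shows "f w = 0"
proof -
  have "w \<circ> Transposition.transpose (c, r) (c, s) = w"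
    using assms(6) by (auto simp: fun_eq_iff Transposition.transpose_def)
  then have "f w = - f w" using straight_tensor_swap[OF assms(1-5)] by (simp only:)
  then show ?thesis by simp
qed

lemma straight_tensor_column_perm:
  assumes f: "straight_tensor f" and S: "S \<subseteq> Pos \<inter> ({c} \<times> UNIV)" and \<pi>: "\<pi> permutes S" and w: "w \<in>
      Words"
  shows "f (w \<circ> \<pi>) = of_int (sign \<pi>) * f w"
proof -
  have fin: "finite S" using S by (auto intro: finite_subset[OF _ finite_Pos])
  have "\<forall>w\<in>Words. f (w \<circ> \<pi>) = of_int (sign \<pi>) * f w"
    using \<pi> fin
  proof (induction rule: permutes_induct)
    case (swap a b p)
    define r s where "r = snd a" and "s = snd b"
    then have ab: "a = (c, r)" "b = (c, s)"
      using swap(1,2) S by auto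
    then have ab: "a = (c, r)" "b = (c, s)" "(c, r) \<in> Pos" "(c, s) \<in> Pos" "r \<noteq> s"
      using swap(1-3) S by auto
    let ?\<tau> = "Transposition.transpose a b"
    have \<tau>: "?\<tau> permutes Pos" using ab by (intro permutes_swap_id) auto
    have sgn: "sign (?\<tau> \<circ> p) = - sign p"
      using swap fin by (subst sign_compose)
        (auto simp: sign_swap_id permutation_swap_id intro: permutes_imp_permutation)
    show ?case
    proof
      fix w assume w: "w \<in> Words"
      have "f (w \<circ> (?\<tau> \<circ> p)) = f ((w \<circ> ?\<tau>) \<circ> p)" by (simp add: o_assoc)
      also have "\<dots> = of_int (sign p) * f (w \<circ> ?\<tau>)"
        using swap.IH Words_perm[OF w \<tau>] by blast
      also have "f (w \<circ> ?\<tau>) = - f w"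
        unfolding ab(1,2) by (rule straight_tensor_swap[OF f w ab(3-5)])
      finally show "f (w \<circ> (?\<tau> \<circ> p)) = of_int (sign (?\<tau> \<circ> p)) * f w"
        by (simp only: sgn of_int_minus mult_minus_left mult_minus_right)
    qed
  qed simp
  then show ?thesis using w by blast
qed

text \<open>The first of three measures, compared lexicographically. \<open>defect\<close> drops
  when contractions push absolute values up; \<open>column_disorder\<close> weights left columns
  more and drops when smaller letters in King's order move left; \<open>row_disorder\<close> weights
  upper rows more and drops when a column is sorted.\<close>

definition defect :: "word \<Rightarrow> nat" where
  "defect w = (\<Sum>p\<in>Pos. nat (int n - \<bar>w p\<bar>))"

definition column_disorder :: "word \<Rightarrow> nat" where
  "column_disorder w = (\<Sum>p\<in>Pos. (m - fst p) * kappa (w p))"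

definition row_disorder :: "word \<Rightarrow> nat" where
  "row_disorder w = (\<Sum>p\<in>Pos. (n - snd p) * kappa (w p))"

lemma defect_perm: "\<pi> permutes Pos \<Longrightarrow> defect (w \<circ> \<pi>) = defect w"
  unfolding defect_def
  using sum.reindex_bij_betw[OF permutes_imp_bij, of \<pi> Pos "\<lambda>p. nat (int n - \<bar>w p\<bar>)"] by simp

lemma column_swap_decreases:
  assumes rs: "(c, r) \<in> Pos" "(c, s) \<in> Pos" "r < s" and gt: "kappa (w (c, s)) < kappa (w (c, r))"
  defines "w' \<equiv> w \<circ> Transposition.transpose (c, r) (c, s)"
  shows "defect w' = defect w" "column_disorder w' = column_disorder w"
    "row_disorder w' < row_disorder w"
proof -
  let ?\<tau> = "Transposition.transpose (c, r) (c, s)"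
  have \<tau>: "?\<tau> permutes Pos" using rs by (intro permutes_swap_id) auto
  show "defect w' = defect w" unfolding w'_def by (rule defect_perm[OF \<tau>])
  have fst: "fst (?\<tau> p) = fst p" for p by (auto simp: Transposition.transpose_def)
  have "column_disorder w' = (\<Sum>p\<in>Pos. (m - fst (?\<tau> p)) * kappa (w (?\<tau> p)))"
    unfolding column_disorder_def w'_def fst by simp
  also have "\<dots> = column_disorder w"
    unfolding column_disorder_def by (rule sum.reindex_bij_betw[OF permutes_imp_bij[OF \<tau>]])
  finally show "column_disorder w' = column_disorder w" .
  have split: "row_disorder u = (n - r) * kappa (u (c, r)) + ((n - s) * kappa (u (c, s))
      + (\<Sum>p\<in>Pos - {(c, r)} - {(c, s)}. (n - snd p) * kappa (u p)))" for u
    unfolding row_disorder_def using rs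
    by (simp add: sum.remove[of Pos "(c, r)"] sum.remove[of "Pos - {(c, r)}" "(c, s)"])
  have "(\<Sum>p\<in>Pos - {(c, r)} - {(c, s)}. (n - snd p) * kappa (w' p))
      = (\<Sum>p\<in>Pos - {(c, r)} - {(c, s)}. (n - snd p) * kappa (w p))"
    by (intro sum.cong refl) (auto simp: w'_def Transposition.transpose_def)
  moreover have "w' (c, r) = w (c, s)" "w' (c, s) = w (c, r)" by (auto simp: w'_def)
  moreover have "(n - r) * kappa (w (c, s)) + (n - s) * kappa (w (c, r))
      < (n - r) * kappa (w (c, r)) + (n - s) * kappa (w (c, s))"
  proof -
    have "s < n" using rs h_le[of c] by (auto simp: Pos_iff)
    then obtain d where d: "n - r = (n - s) + Suc d"
      using rs(3) by (metis less_imp_Suc_add diff_less_mono2 add_Suc_right order.strict_trans)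
    obtain e where e: "kappa (w (c, r)) = kappa (w (c, s)) + Suc e"
      using gt less_imp_Suc_add by fastforce
    show ?thesis unfolding d e by (simp add: algebra_simps)
  qed
  ultimately show "row_disorder w' < row_disorder w"
    by (simp only: split)
qed

lemma permutes_on_part:
  assumes \<pi>: "\<pi> permutes S" and T: "T \<subseteq> S" "\<pi> ` T = T"
  shows "(\<lambda>x. if x \<in> T then \<pi> x else x) permutes T"
proof (rule bij_imp_permutes)
  have "bij_betw \<pi> T T"
    using T permutes_inj_on[OF \<pi>] by (auto simp: bij_betw_def)
  then show "bij_betw (\<lambda>x. if x \<in> T then \<pi> x else x) T T"
    by (rule bij_betw_cong[THEN iffD1, rotated]) simp
qed simp

text \<open>The classical Garnir set: column c from row r downwards and column c + 1 down to row r,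
  together \<open>h c + 1\<close> positions. Columns are strict and row r has a descent, so all
  letters of the left part exceed all letters of the right part. A permutation that mixes the parts
  thus moves smaller letters to the left.\<close>

lemma straightens_garnir:
  assumes w: "w \<in> Words" and r: "(Suc c, r) \<in> Pos" "kappa (w (Suc c, r)) < kappa (w (c, r))"
    and strict: "\<And>c r s. (c, s) \<in> Pos \<Longrightarrow> r < s \<Longrightarrow> kappa (w (c, r)) < kappa (w (c, s))"
    and IH: "\<And>u. u \<in> Words \<Longrightarrow> defect u = defect w \<Longrightarrow> column_disorder u < column_disorder w \<Longrightarrow>
        straightens u"
  shows "straightens w"
proof -
  define S1 where "S1 = {c} \<times> {r..<h c}"
  define S2 where "S2 = {Suc c} \<times> {..r}"
  define S where "S = S1 \<union> S2"
  have c: "Suc c < m" "r < h (Suc c)" "h (Suc c) \<le> h c"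
    using r h_antimono[of c "Suc c"] by (auto simp: Pos_iff)
  have fin: "finite S1" "finite S2" "finite S" by (auto simp: S_def S1_def S2_def)
  have disj: "S1 \<inter> S2 = {}" by (auto simp: S1_def S2_def)
  have sub: "S1 \<subseteq> Pos \<inter> ({c} \<times> UNIV)" "S2 \<subseteq> Pos \<inter> ({Suc c} \<times> UNIV)"
    "S \<subseteq> Pos \<inter> ({c, Suc c} \<times> UNIV)"
    using c by (auto simp: S_def S1_def S2_def Pos_iff)
  have "card S = (h c - r) + Suc r"
    unfolding S_def using fin disj by (simp add: card_Un_disjoint S1_def S2_def
        card_cartesian_product)
  then have card: "h c < card S" using c by simp
  have less: "kappa (w y) < kappa (w x)" if "x \<in> S1" "y \<in> S2" for x y
  proof -
    obtain r1 r2 where xy: "x = (c, r1)" "y = (Suc c, r2)" "r \<le> r1" "r1 < h c" "r2 \<le> r"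
      using \<open>x \<in> S1\<close> \<open>y \<in> S2\<close> by (auto simp: S1_def S2_def)
    have "kappa (w (c, r)) \<le> kappa (w (c, r1))"
      using strict[of c r1 r] xy c by (cases "r = r1") (auto simp: Pos_iff)
    moreover have "kappa (w (Suc c, r2)) \<le> kappa (w (Suc c, r))"
      using strict[of "Suc c" r r2] xy r by (cases "r = r2") auto
    ultimately show ?thesis using r(2) xy by simp
  qed
  define G where "G = {\<pi>. \<pi> permutes S \<and> \<pi> ` S1 = S1}"
  define O' where "O' = {\<pi>. \<pi> permutes S \<and> \<pi> ` S1 \<noteq> S1}"
  have finP: "finite {\<pi>. \<pi> permutes S}" by (intro finite_permutations fin)
  have finGO: "finite G" "finite O'" and GO: "{\<pi>. \<pi> permutes S} = G \<union> O'" "G \<inter> O' = {}"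
    using finP by (auto simp: G_def O'_def elim!: rev_finite_subset)
  have "id \<in> G" by (simp add: G_def permutes_id)
  then have cardG: "card G \<noteq> 0" using finGO by auto
  have permPos: "\<pi> permutes Pos" if "\<pi> permutes S" for \<pi>
    using that sub(3) by (auto intro: permutes_subset)
  \<comment> \<open>A permutation preserving the left part splits into one permutation in each
    column, and its sign cancels against the antisymmetry of f. So these terms add up to a nonzero
    multiple of \<open>f w\<close>.\<close>
  have G_term: "of_int (sign \<pi>) * f (w \<circ> \<pi>) = f w" if f: "straight_tensor f" and \<pi>: "\<pi> \<in> G" for f \<pi>
  proof -
    have \<pi>S: "\<pi> permutes S" and \<pi>1: "\<pi> ` S1 = S1" using \<pi> by (auto simp: G_def)
    have "\<pi> ` (S - S1) = S - S1"
      using permutes_inj[OF \<pi>S] permutes_image[OF \<pi>S] \<pi>1 by (simp add: image_set_diff)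
    then have \<pi>2: "\<pi> ` S2 = S2" using disj by (simp add: S_def Un_Diff Diff_triv Int_commute)
    define p1 where "p1 = (\<lambda>x. if x \<in> S1 then \<pi> x else x)"
    define p2 where "p2 = (\<lambda>x. if x \<in> S2 then \<pi> x else x)"
    have p1: "p1 permutes S1" and p2: "p2 permutes S2"
      unfolding p1_def p2_def using \<pi>1 \<pi>2
      by (auto intro!: permutes_on_part[OF \<pi>S] simp: S_def)
    have eq: "\<pi> = p1 \<circ> p2"
    proof
      fix x
      show "\<pi> x = (p1 \<circ> p2) x"
      proof (cases "x \<in> S2")
        case True
        then have "\<pi> x \<in> S2" using \<pi>2 by blast
        then show ?thesis using True disj by (auto simp: p1_def p2_def)
      next
        case False
        then show ?thesis using permutes_not_in[OF \<pi>S, of x] by (auto simp: p1_def p2_def S_def)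
      qed
    qed
    have perms: "permutation p1" "permutation p2"
      using p1 p2 fin by (auto intro: permutes_imp_permutation)
    have wp: "w \<circ> p1 \<in> Words"
      using w p1 sub(1) by (intro Words_perm) (auto intro: permutes_subset)
    have "f (w \<circ> \<pi>) = f ((w \<circ> p1) \<circ> p2)" by (simp add: eq o_assoc)
    also have "\<dots> = of_int (sign p2) * (of_int (sign p1) * f w)"
      using straight_tensor_column_perm[OF f sub(2) p2 wp] straight_tensor_column_perm[OF f sub(1)
          p1 w]
      by simp
    finally have *: "f (w \<circ> \<pi>) = of_int (sign p2) * (of_int (sign p1) * f w)" .
    have sign: "sign \<pi> = sign p1 * sign p2" by (simp add: eq sign_compose perms)
    show ?thesis unfolding * sign by (simp add: sign_def)
  qed
  have decrease: "column_disorder (w \<circ> \<pi>) < column_disorder w" if \<pi>: "\<pi> \<in> O'" for \<pi>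
  proof -
    have \<pi>S: "\<pi> permutes S" and \<pi>1: "\<pi> ` S1 \<noteq> S1" using \<pi> by (auto simp: O'_def)
    have inj: "inj \<pi>" using permutes_inj[OF \<pi>S] .
    \<comment> \<open>The two columns carry weights differing by 1. Separating the common weight
      leaves the plain sum over the left part \<open>S1\<close> as the only quantity that a
      permutation of S can change.\<close>
    have split: "column_disorder u = (\<Sum>p\<in>Pos - S. (m - fst p) * kappa (u p))
        + (m - Suc c) * (\<Sum>p\<in>S. kappa (u p)) + (\<Sum>p\<in>S1. kappa (u p))" for u
    proof -
      have "column_disorder u = (\<Sum>p\<in>Pos - S. (m - fst p) * kappa (u p)) + (\<Sum>p\<in>S. (m - fst p) *
          kappa (u p))"
        unfolding column_disorder_def using sub(3) by (intro sum.subset_diff) auto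
      also have "(\<Sum>p\<in>S. (m - fst p) * kappa (u p))
          = (\<Sum>p\<in>S. (m - Suc c) * kappa (u p) + (if p \<in> S1 then kappa (u p) else 0))"
      proof (rule sum.cong[OF refl])
        fix p assume p: "p \<in> S"
        show "(m - fst p) * kappa (u p) = (m - Suc c) * kappa (u p) + (if p \<in> S1 then kappa (u p)
            else 0)"
        proof (cases "p \<in> S1")
          case True
          then have "m - fst p = Suc (m - Suc c)" using c by (auto simp: S1_def)
          then show ?thesis using True by simp
        next
          case False
          then have "fst p = Suc c" using p by (auto simp: S_def S2_def)
          then show ?thesis using False by simp
        qed
      qed
      also have "\<dots> = (m - Suc c) * (\<Sum>p\<in>S. kappa (u p)) + (\<Sum>p\<in>S. if p \<in> S1 then kappa (u p) else 0)"
        by (simp add: sum.distrib sum_distrib_left)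
      also have "(\<Sum>p\<in>S. if p \<in> S1 then kappa (u p) else 0) = (\<Sum>p\<in>S1. kappa (u p))"
        using fin by (intro sum.mono_neutral_cong_right) (auto simp: S_def)
      finally show ?thesis by simp
    qed
    have 1: "(\<Sum>p\<in>Pos - S. (m - fst p) * kappa ((w \<circ> \<pi>) p)) = (\<Sum>p\<in>Pos - S. (m - fst p) * kappa (w
        p))"
      using permutes_not_in[OF \<pi>S] by (intro sum.cong refl) auto
    have 2: "(\<Sum>p\<in>S. kappa ((w \<circ> \<pi>) p)) = (\<Sum>p\<in>S. kappa (w p))"
      using sum.reindex_bij_betw[OF permutes_imp_bij[OF \<pi>S], of "\<lambda>p. kappa (w p)"] by simp
    have "(\<Sum>p\<in>S1. kappa ((w \<circ> \<pi>) p)) = (\<Sum>p\<in>\<pi> ` S1. kappa (w p))"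
      using inj by (simp add: sum.reindex inj_on_subset)
    also have "\<dots> < (\<Sum>p\<in>S1. kappa (w p))"
    proof (rule sum_less_exchange)
      show "card S1 = card (\<pi> ` S1)" using inj by (simp add: card_image inj_on_subset)
      have sub: "\<pi> ` S1 \<subseteq> S" using permutes_image[OF \<pi>S] by (auto simp: S_def)
      show "kappa (w y) < kappa (w x)" if "x \<in> S1 - \<pi> ` S1" "y \<in> \<pi> ` S1 - S1" for x y
        using that sub by (intro less) (auto simp: S_def)
    qed (use fin \<pi>1 in auto)
    finally show ?thesis unfolding split 1 2 by simp
  qed
  have combination: "f w = (\<Sum>\<pi>\<in>O'. - (of_int (sign \<pi>) / of_nat (card G)) * f (w \<circ> \<pi>))"
    if f: "straight_tensor f" for f
  proof -
    define X where "X = (\<Sum>\<pi>\<in>O'. of_int (sign \<pi>) * f (w \<circ> \<pi>))"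
    have "0 = (\<Sum>\<pi>\<in>G \<union> O'. of_int (sign \<pi>) * f (w \<circ> \<pi>))"
      using straight_tensor_garnir[OF f w _ sub(3) card] by (simp add: GO(1))
    also have "\<dots> = (\<Sum>\<pi>\<in>G. of_int (sign \<pi>) * f (w \<circ> \<pi>)) + X"
      unfolding X_def using finGO GO(2) by (rule sum.union_disjoint)
    also have "(\<Sum>\<pi>\<in>G. of_int (sign \<pi>) * f (w \<circ> \<pi>)) = of_nat (card G) * f w"
      using G_term[OF f] by simp
    finally have "of_nat (card G) * f w = - X"
      by (metis add_eq_0_iff2 neg_equal_iff_equal minus_minus)
    then have "f w = - X / of_nat (card G)"
      using cardG by (simp add: field_simps)
    also have "\<dots> = (\<Sum>\<pi>\<in>O'. - (of_int (sign \<pi>) / of_nat (card G)) * f (w \<circ> \<pi>))"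
      unfolding X_def sum_negf[symmetric] sum_divide_distrib
      by (rule sum.cong[OF refl]) simp
    finally show ?thesis .
  qed
  show ?thesis
  proof (rule straightens_combination[OF finGO(2) _ combination])
    fix \<pi> assume \<pi>: "\<pi> \<in> O'"
    then have "\<pi> permutes Pos" by (auto simp: O'_def intro: permPos)
    then show "straightens (w \<circ> \<pi>)"
      by (intro IH Words_perm w defect_perm decrease \<pi>)
  qed
qed

end

section \<open>Contractions inside a column with too many small letters\<close>

lemma sum_PiE_insert:
  fixes g :: "('a \<Rightarrow> 'b) \<Rightarrow> 'c::comm_monoid_add"
  assumes "i \<notin> S"
  shows "(\<Sum>y\<in>insert i S \<rightarrow>\<^sub>E A. g y) = (\<Sum>a\<in>A. \<Sum>y\<in>S \<rightarrow>\<^sub>E A. g (y(i := a)))"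
proof -
  have inj: "inj_on (\<lambda>(a, y). y(i := a)) (A \<times> (S \<rightarrow>\<^sub>E A))"
  proof (rule inj_onI, clarify)
    fix a y b z assume *: "y \<in> S \<rightarrow>\<^sub>E A" "z \<in> S \<rightarrow>\<^sub>E A" "y(i := a) = z(i := b)"
    have "a = b" using fun_cong[OF *(3), of i] by simp
    moreover have "y x = z x" for x
    proof (cases "x = i")
      case True
      then show ?thesis using * assms by (auto simp: PiE_iff extensional_def)
    next
      case False
      then show ?thesis using fun_cong[OF *(3), of x] by simp
    qed
    ultimately show "a = b \<and> y = z" by auto
  qed
  have "(\<Sum>y\<in>insert i S \<rightarrow>\<^sub>E A. g y) = (\<Sum>(a, y)\<in>A \<times> (S \<rightarrow>\<^sub>E A). g (y(i := a)))"
    unfolding PiE_insert_eq by (subst sum.reindex[OF inj]) (simp add: case_prod_beta comp_def)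
  then show ?thesis by (simp add: sum.cartesian_product)
qed

text \<open>Exchanging the ranges \<open>A\<close> and \<open>B\<close> one argument at a time, at the cost of a sign each.\<close>

lemma sum_PiE_exchange:
  fixes g :: "('a \<Rightarrow> 'b) \<Rightarrow> 'c::comm_ring_1"
  assumes "finite S" and AB: "finite A" "finite B" "A \<inter> B = {}"
    and "\<And>i y. i \<in> S \<Longrightarrow> (\<And>j. j \<in> S \<Longrightarrow> j \<noteq> i \<Longrightarrow> y j \<in> A \<union> B) \<Longrightarrow> (\<Sum>a\<in>A \<union> B. g (y(i := a))) = 0"
  shows "(\<Sum>y\<in>S \<rightarrow>\<^sub>E A. g y) = (- 1) ^ card S * (\<Sum>y\<in>S \<rightarrow>\<^sub>E B. g y)"
  using assms(1,5)
proof (induction S arbitrary: g rule: finite_induct)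
  case (insert i S)
  have IH: "(\<Sum>y\<in>S \<rightarrow>\<^sub>E A. g (y(i := a))) = (- 1) ^ card S * (\<Sum>y\<in>S \<rightarrow>\<^sub>E B. g (y(i := a)))"
    if a: "a \<in> A \<union> B" for a
  proof (rule insert.IH)
    fix k y assume k: "k \<in> S" "\<And>j. j \<in> S \<Longrightarrow> j \<noteq> k \<Longrightarrow> y j \<in> A \<union> B"
    then have ki: "k \<noteq> i" using insert by auto
    have "(\<Sum>b\<in>A \<union> B. g ((y(i := a))(k := b))) = 0"
      by (rule insert.prems) (use k a in auto)
    then show "(\<Sum>b\<in>A \<union> B. g (y(k := b, i := a))) = 0"
      by (simp only: fun_upd_twist[OF ki])
  qed
  have ex: "(\<Sum>a\<in>A. g (y(i := a))) = - (\<Sum>a\<in>B. g (y(i := a)))" if y: "y \<in> S \<rightarrow>\<^sub>E B" for y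
  proof -
    have "(\<Sum>a\<in>A \<union> B. g (y(i := a))) = 0"
      by (rule insert.prems) (use y in auto)
    then show ?thesis using AB by (simp add: sum.union_disjoint add_eq_0_iff2)
  qed
  have "(\<Sum>y\<in>insert i S \<rightarrow>\<^sub>E A. g y) = (\<Sum>a\<in>A. (- 1) ^ card S * (\<Sum>y\<in>S \<rightarrow>\<^sub>E B. g (y(i := a))))"
    unfolding sum_PiE_insert[OF insert.hyps(2)] by (intro sum.cong refl IH) simp
  also have "\<dots> = (- 1) ^ card S * (\<Sum>y\<in>S \<rightarrow>\<^sub>E B. \<Sum>a\<in>A. g (y(i := a)))"
    unfolding sum_distrib_left[symmetric] by (subst sum.swap) (rule refl)
  also have "(\<Sum>y\<in>S \<rightarrow>\<^sub>E B. \<Sum>a\<in>A. g (y(i := a))) = (\<Sum>y\<in>S \<rightarrow>\<^sub>E B. - (\<Sum>a\<in>B. g (y(i := a))))"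
    by (intro sum.cong refl ex)
  also have "\<dots> = - (\<Sum>y\<in>insert i S \<rightarrow>\<^sub>E B. g y)"
    unfolding sum_PiE_insert[OF insert.hyps(2)] sum_negf by (subst sum.swap) (rule refl)
  finally show ?case using insert.hyps by simp
qed simp

context column_shape
begin

text \<open>Exchanging the two positions of one column turns the term of a into the term of -a with
  the opposite sign, which the sign of the symplectic form undoes. The full contraction is therefore
  twice the sum over positive a.\<close>

lemma contraction_half:
  assumes f: "straight_tensor f" and w: "w \<in> Words" and rs: "(c, r) \<in> Pos" "(c, s) \<in> Pos" "r \<noteq> s"
  shows "(\<Sum>a\<in>{1..int n}. f (w((c, r) := a, (c, s) := - a))) = 0"
proof -
  define g where "g a = f (w((c, r) := a, (c, s) := - a))" for a
  have anti: "g (- a) = - g a" if a: "a \<in> {1..int n}" for a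
  proof -
    let ?w = "w((c, r) := a, (c, s) := - a)"
    have "w((c, r) := - a, (c, s) := - (- a)) = ?w \<circ> Transposition.transpose (c, r) (c, s)"
      using rs(3) by (auto simp: fun_eq_iff Transposition.transpose_def)
    moreover have "?w \<in> Words" using w rs a by (simp add: Nset_iff)
    ultimately show ?thesis unfolding g_def using straight_tensor_swap[OF f _ rs, of ?w] by metis
  qed
  have "0 = (\<Sum>a\<in>Nset n. of_int (sgn a) * g a)"
    using straight_tensor_contraction[OF f w rs(1,2)] rs(3) by (simp add: g_def)
  also have "\<dots> = (\<Sum>a\<in>{1..int n}. of_int (sgn a) * g a) + (\<Sum>a\<in>{- int n..- 1}. of_int (sgn a) * g a)"
    unfolding Nset_def by (intro sum.union_disjoint) auto
  also have "(\<Sum>a\<in>{- int n..- 1}. of_int (sgn a) * g a) = (\<Sum>a\<in>{1..int n}. of_int (sgn (- a)) * g (-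
      a))"
    by (rule sum.reindex_bij_witness[of _ uminus uminus]) auto
  also have "\<dots> = (\<Sum>a\<in>{1..int n}. g a)"
    by (intro sum.cong refl) (simp add: anti sgn_minus del: minus_minus)
  also have "(\<Sum>a\<in>{1..int n}. of_int (sgn a) * g a) = (\<Sum>a\<in>{1..int n}. g a)"
    by (intro sum.cong refl) simp
  finally have "2 * (\<Sum>a\<in>{1..int n}. g a) = 0" by simp
  then show ?thesis by (simp add: g_def)
qed

lemma defect_less_iff:
  assumes "u \<in> Words" "w \<in> Words"
  shows "defect u < defect w \<longleftrightarrow> (\<Sum>p\<in>Pos. \<bar>w p\<bar>) < (\<Sum>p\<in>Pos. \<bar>u p\<bar>)"
proof -
  have "int (defect v) = int n * int (card Pos) - (\<Sum>p\<in>Pos. \<bar>v p\<bar>)" if v: "v \<in> Words" for v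
  proof -
    have "int (defect v) = (\<Sum>p\<in>Pos. int n - \<bar>v p\<bar>)"
      unfolding defect_def of_nat_sum
    proof (rule sum.cong[OF refl])
      fix p assume "p \<in> Pos"
      then have "v p \<in> Nset n" using v by simp
      then show "int (nat (int n - \<bar>v p\<bar>)) = int n - \<bar>v p\<bar>" by (simp add: Nset_iff)
    qed
    then show ?thesis by (simp add: sum_subtractf)
  qed
  from this[OF assms(1)] this[OF assms(2)] show ?thesis by linarith
qed

end

text \<open>A column violating King's condition has more pairs \<open>j, -j\<close> with \<open>j \<le> l\<close> than there are
  \<open>j \<le> l\<close> with neither sign present. Moving the pairs by contractions to new values either leads
  beyond \<open>l\<close> or repeats a letter.\<close>

locale crowded_column = column_shape +
  fixes w :: word and c :: nat and l :: int
  assumes w: "w \<in> Words" and c: "c < m"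
    and inj: "inj_on (\<lambda>s. w (c, s)) {..<h c}"
    and l_nonneg: "0 \<le> l" and crowded: "l < int (card {s. s < h c \<and> \<bar>w (c, s)\<bar> \<le> l})" and l_le: "l
        \<le> int n"
begin

definition letters :: "int set" where
  "letters = (\<lambda>s. w (c, s)) ` {..<h c}"

definition place :: "int \<Rightarrow> nat" where
  "place x = the_inv_into {..<h c} (\<lambda>s. w (c, s)) x"

definition pairs :: "int set" where
  "pairs = {j\<in>{1..l}. j \<in> letters \<and> - j \<in> letters}"

definition replace :: "(int \<Rightarrow> int) \<Rightarrow> word" where
  "replace y p = (if p \<in> Pos \<and> fst p = c \<and> \<bar>w p\<bar> \<in> pairs then sgn (w p) * y \<bar>w p\<bar> else w p)"

lemma place: "x \<in> letters \<Longrightarrow> place x < h c \<and> w (c, place x) = x"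
  unfolding letters_def place_def
  using the_inv_into_into[OF inj, of x "{..<h c}"] f_the_inv_into_f[OF inj, of x] by auto

lemma place_unique: "s < h c \<Longrightarrow> w (c, s) = x \<Longrightarrow> place x = s"
  unfolding place_def using the_inv_into_f_f[OF inj, of s] by auto

lemma place_Pos: "x \<in> letters \<Longrightarrow> (c, place x) \<in> Pos"
  using place c by (simp add: Pos_iff)

lemma pairsD:
  assumes "j \<in> pairs"
  shows "1 \<le> j" "j \<le> l" "j \<in> letters" "- j \<in> letters"
  using assms by (auto simp: pairs_def)

lemma finite_pairs: "finite pairs"
  by (rule finite_subset[of _ "{1..l}"]) (auto simp: pairs_def)

lemma replace_place:
  assumes "j \<in> pairs"
  shows "replace y (c, place j) = y j" "replace y (c, place (- j)) = - y j"
  using pairsD[OF assms] place[of j] place[of "- j"] place_Pos[of j] place_Pos[of "- j"] assms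
  by (auto simp: replace_def)

lemma place_neq:
  assumes "j \<in> pairs"
  shows "place j \<noteq> place (- j)"
  using pairsD[OF assms] place[of j] place[of "- j"] by auto

lemma replace_Words:
  assumes "\<And>j. j \<in> pairs \<Longrightarrow> y j \<in> {1..int n}"
  shows "replace y \<in> Words"
  unfolding Words_def
proof (rule PiE_I)
  fix p
  show "replace y p \<in> Nset n" if p: "p \<in> Pos"
  proof (cases "fst p = c \<and> \<bar>w p\<bar> \<in> pairs")
    case True
    moreover have "w p \<in> Nset n" using w p by simp
    ultimately show ?thesis
      using assms[of "\<bar>w p\<bar>"] p by (auto simp: replace_def Nset_iff abs_mult sgn_0_0)
  next
    case False
    then show ?thesis using w p by (auto simp: replace_def)
  qed
  show "replace y p = undefined" if "p \<notin> Pos"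
    using that w by (auto simp: replace_def Words_undefined)
qed

lemma replace_upd:
  assumes "i \<in> pairs"
  shows "replace (y(i := a)) = (replace y)((c, place i) := a, (c, place (- i)) := - a)"
proof
  fix p
  show "replace (y(i := a)) p = ((replace y)((c, place i) := a, (c, place (- i)) := - a)) p"
  proof (cases "p \<in> Pos \<and> fst p = c \<and> \<bar>w p\<bar> = i")
    case True
    then obtain s where s: "p = (c, s)" "s < h c" "\<bar>w (c, s)\<bar> = i"
      by (cases p) (auto simp: Pos_iff)
    then consider "w (c, s) = i" | "w (c, s) = - i" by linarith
    then show ?thesis
    proof cases
      case 1
      then have "place i = s" using s by (intro place_unique)
      then show ?thesis
        using replace_place(1)[OF assms, of "y(i := a)"] place_neq[OF assms] s by auto
    next
      case 2
      then have "place (- i) = s" using s by (intro place_unique)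
      then show ?thesis
        using replace_place(2)[OF assms, of "y(i := a)"] place_neq[OF assms] s by auto
    qed
  next
    case False
    have "p \<noteq> (c, place i)" "p \<noteq> (c, place (- i))"
      using False pairsD[OF assms] place[of i] place[of "- i"] place_Pos[of i] place_Pos[of "- i"]
          by auto
    then show ?thesis using False by (auto simp: replace_def)
  qed
qed

text \<open>The half contraction at the two places of the pair i, with the other pairs already moved
  to arbitrary values.\<close>

lemma replace_sum_zero:
  assumes f: "straight_tensor f" and i: "i \<in> pairs"
    and y: "\<And>j. j \<in> pairs \<Longrightarrow> j \<noteq> i \<Longrightarrow> y j \<in> {1..int n}"
  shows "(\<Sum>a\<in>{1..int n}. f (replace (y(i := a)))) = 0"
proof -
  have "1 \<le> int n" using pairsD[OF i] l_le by linarith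
  then have W: "replace (y(i := 1)) \<in> Words" using y by (intro replace_Words) auto
  have upd: "replace (y(i := a)) = (replace (y(i := 1)))((c, place i) := a, (c, place (- i)) := -
      a)" for a
    using replace_upd[OF i, of "y(i := 1)" a] by (simp only: fun_upd_upd)
  have "(\<Sum>a\<in>{1..int n}. f (replace (y(i := a))))
      = (\<Sum>a\<in>{1..int n}. f ((replace (y(i := 1)))((c, place i) := a, (c, place (- i)) := - a)))"
    by (intro sum.cong refl arg_cong[of _ _ f] upd)
  also have "\<dots> = 0"
    using pairsD[OF i] place_neq[OF i] by (intro contraction_half[OF f W] place_Pos)
  finally show ?thesis .
qed

text \<open>Inclusion-exclusion for the j \<le> l that occur in the column positively and those that
  occur negatively: the two sets have more than l elements in total, their union misses just the
  absent j, and their intersection is \<open>pairs\<close>.\<close>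

lemma letters_count: "int (card pairs) > int (card {b\<in>{1..l}. b \<notin> letters \<and> - b \<notin> letters})"
proof -
  define U where "U = {j\<in>{1..l}. j \<in> letters}"
  define V where "V = {j\<in>{1..l}. - j \<in> letters}"
  define E where "E = {b\<in>{1..l}. b \<notin> letters \<and> - b \<notin> letters}"
  have fin: "finite U" "finite V" "finite E"
    by (rule finite_subset[of _ "{1..l}"]; auto simp: U_def V_def E_def)+
  have "card {s. s < h c \<and> \<bar>w (c, s)\<bar> \<le> l} = card {x\<in>letters. \<bar>x\<bar> \<le> l}"
  proof (rule bij_betw_same_card)
    show "bij_betw (\<lambda>s. w (c, s)) {s. s < h c \<and> \<bar>w (c, s)\<bar> \<le> l} {x\<in>letters. \<bar>x\<bar> \<le> l}"
      unfolding bij_betw_def letters_def by (auto intro: inj_on_subset[OF inj])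
  qed
  also have "{x\<in>letters. \<bar>x\<bar> \<le> l} = U \<union> uminus ` V"
  proof (intro equalityI subsetI)
    fix x assume x: "x \<in> {x\<in>letters. \<bar>x\<bar> \<le> l}"
    then obtain s where "s < h c" "x = w (c, s)" by (auto simp: letters_def)
    then have "x \<in> Nset n" using w c by (simp add: Pos_iff)
    then have "x \<in> U \<or> - x \<in> V" using x by (auto simp: U_def V_def Nset_iff)
    then show "x \<in> U \<union> uminus ` V" using image_eqI[of x uminus "- x" V] by auto
  qed (auto simp: U_def V_def)
  also have "card \<dots> = card U + card (uminus ` V)"
    using fin by (intro card_Un_disjoint) (auto simp: U_def V_def)
  also have "card (uminus ` V) = card V" by (simp add: card_image inj_on_def)
  also have "card U + card V = card (U \<union> V) + card (U \<inter> V)"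
    by (rule card_Un_Int[OF fin(1,2)])
  also have "U \<inter> V = pairs" by (auto simp: U_def V_def pairs_def)
  also have "U \<union> V = {1..l} - E" by (auto simp: U_def V_def E_def)
  also have "card ({1..l} - E) = card {1..l} - card E"
    using fin by (intro card_Diff_subset) (auto simp: E_def)
  finally have "l < int (card {1..l} - card E) + int (card pairs)" using crowded by simp
  moreover have "card E \<le> card {1..l}" by (rule card_mono) (auto simp: E_def)
  ultimately have "card E < card pairs" using l_nonneg by simp
  then show ?thesis by (simp add: E_def)
qed

lemma replace_repeated_zero:
  assumes f: "straight_tensor f" and W: "replace y \<in> Words"
    and "r < h c" "s < h c" "r \<noteq> s" "replace y (c, r) = replace y (c, s)"
  shows "f (replace y) = 0"
  using straight_tensor_repeated[OF f W, of c r s] assms c by (simp add: Pos_iff)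

lemma replace_non_injective_zero:
  assumes f: "straight_tensor f" and y: "\<And>j. j \<in> pairs \<Longrightarrow> y j \<in> {1..int n}"
    and "\<not> inj_on y pairs"
  shows "f (replace y) = 0"
proof -
  obtain i j where ij: "i \<in> pairs" "j \<in> pairs" "i \<noteq> j" "y i = y j"
    using assms(3) by (auto simp: inj_on_def)
  have "place i \<noteq> place j"
    using place[of i] place[of j] pairsD[OF ij(1)] pairsD[OF ij(2)] ij(3) by auto
  then show ?thesis
    using replace_repeated_zero[where y = y and r = "place i" and s = "place j", OF f
        replace_Words[OF y]]
      replace_place ij
      place[of i] place[of j] pairsD[OF ij(1)] pairsD[OF ij(2)] by simp
qed

text \<open>If the value were nonzero, y would be injective, and no \<open>y j\<close> could be a
  letter of the column with either sign, because such a letter stays in place and would be repeated.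
  By \<open>letters_count\<close> there are fewer such values than pairs.\<close>

lemma replace_low_zero:
  assumes f: "straight_tensor f" and y: "y \<in> pairs \<rightarrow>\<^sub>E {1..l} - pairs"
  shows "f (replace y) = 0"
proof (rule ccontr)
  assume nz: "f (replace y) \<noteq> 0"
  have yn: "y j \<in> {1..int n}" if "j \<in> pairs" for j
    using PiE_mem[OF y that] l_le by auto
  have W: "replace y \<in> Words" using yn by (rule replace_Words)
  have inj_y: "inj_on y pairs" using nz replace_non_injective_zero[where y = y, OF f yn] by blast
  have "y j \<notin> letters \<and> - y j \<notin> letters" if j: "j \<in> pairs" for j
  proof -
    have b: "y j \<notin> pairs" "y j > 0" using PiE_mem[OF y j] by auto
    have fixed: "replace y (c, place x) = x" if x: "x \<in> letters" "\<bar>x\<bar> \<notin> pairs" for x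
      using place[OF x(1)] x by (simp add: replace_def)
    have "y j \<notin> letters"
    proof
      assume y_letter: "y j \<in> letters"
      have "place (y j) \<noteq> place j" using place[OF y_letter] place[of j] pairsD[OF j] b j by auto
      moreover have "replace y (c, place (y j)) = replace y (c, place j)"
        using fixed[OF y_letter] b replace_place(1)[OF j] by simp
      ultimately show False
        using nz replace_repeated_zero[OF f W] place[OF y_letter] place[of j] pairsD[OF j] by blast
    qed
    moreover have "- y j \<notin> letters"
    proof
      assume y_letter: "- y j \<in> letters"
      have "place (- y j) \<noteq> place (- j)"
        using place[OF y_letter] place[of "- j"] pairsD[OF j] b j by auto
      moreover have "replace y (c, place (- y j)) = replace y (c, place (- j))"
        using fixed[OF y_letter] b replace_place(2)[OF j] by simp
      ultimately show False
        using nz replace_repeated_zero[OF f W] place[OF y_letter] place[of "- j"] pairsD[OF j] by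
            blast
    qed
    ultimately show ?thesis by blast
  qed
  then have "y ` pairs \<subseteq> {b\<in>{1..l}. b \<notin> letters \<and> - b \<notin> letters}"
    using PiE_mem[OF y] by blast
  then have "card (y ` pairs) \<le> card {b\<in>{1..l}. b \<notin> letters \<and> - b \<notin> letters}"
    by (rule card_mono[rotated]) (rule finite_subset[of _ "{1..l}"], auto)
  then show False using letters_count inj_y by (simp add: card_image)
qed

text \<open>Exchanging two pairs takes two transpositions of places, one for the positive and one
  for the negative letters, so the signs cancel.\<close>

lemma replace_permutation:
  assumes f: "straight_tensor f" and \<pi>: "\<pi> permutes pairs"
  shows "f (replace \<pi>) = f w"
  using finite_pairs \<pi>
proof (induction rule: permutes_rev_induct)
  case id
  have "replace id = w"
    by (auto simp: fun_eq_iff replace_def sgn_mult_abs)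
  then show ?case by (simp only:)
next
  case (swap a b p)
  let ?\<tau> = "Transposition.transpose a b"
  define T1 where "T1 = Transposition.transpose (c, place a) (c, place b)"
  define T2 where "T2 = Transposition.transpose (c, place (- a)) (c, place (- b))"
  note A = pairsD[OF swap(1)] and B = pairsD[OF swap(2)]
  note place_ab = place[OF A(3)] place[OF A(4)] place[OF B(3)] place[OF B(4)]
  have ne: "place a \<noteq> place b" "place a \<noteq> place (- a)" "place a \<noteq> place (- b)"
    "place b \<noteq> place (- a)" "place b \<noteq> place (- b)" "place (- a) \<noteq> place (- b)"
    using place_ab A(1) B(1) swap(3) by auto
  have W: "replace p \<in> Words"
    using permutes_in_image[OF swap(4)] l_le by (intro replace_Words) (fastforce simp: pairs_def)
  have T1: "T1 permutes Pos"
    unfolding T1_def using A B by (intro permutes_swap_id place_Pos)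
  have eq: "replace (p \<circ> ?\<tau>) = (replace p \<circ> T1) \<circ> T2"
  proof
    fix q
    show "replace (p \<circ> ?\<tau>) q = ((replace p \<circ> T1) \<circ> T2) q"
    proof (cases "q \<in> {(c, place a), (c, place b), (c, place (- a)), (c, place (- b))}")
      case True
      then show ?thesis
        using replace_place[OF swap(1), of p] replace_place[OF swap(2), of p] ne
          replace_place[OF swap(1), of "p \<circ> ?\<tau>"] replace_place[OF swap(2), of "p \<circ> ?\<tau>"]
        by (auto simp: T1_def T2_def Transposition.transpose_def)
    next
      case False
      have "?\<tau> \<bar>w q\<bar> = \<bar>w q\<bar>" if q: "q \<in> Pos" "fst q = c" "\<bar>w q\<bar> \<in> pairs"
      proof (rule transpose_apply_other)
        have *: "q = (c, place (w q))"
          using q place_unique[of "snd q" "w q"] by (cases q) (auto simp: Pos_iff)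
        show "\<bar>w q\<bar> \<noteq> a" "\<bar>w q\<bar> \<noteq> b"
          using False * by (auto simp: abs_if split: if_splits)
      qed
      then show ?thesis using False
        by (auto simp: T1_def T2_def Transposition.transpose_def[of "(_, _)"] replace_def)
    qed
  qed
  have "f (replace (p \<circ> ?\<tau>)) = - f (replace p \<circ> T1)"
    unfolding eq T2_def using ne A B Words_perm[OF W T1]
    by (intro straight_tensor_swap[OF f] place_Pos) auto
  also have "\<dots> = f (replace p)"
    unfolding T1_def using straight_tensor_swap[OF f W place_Pos[OF A(3)] place_Pos[OF B(3)]] ne
        by simp
  also have "\<dots> = f w" by (rule swap.IH)
  finally show ?case .
qed

lemma replace_permutation_restricted:
  assumes f: "straight_tensor f" and y: "inj_on y pairs" "y ` pairs = pairs"
  shows "f (replace y) = f w"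
proof -
  let ?\<pi> = "\<lambda>j. if j \<in> pairs then y j else j"
  have "bij_betw y pairs pairs" using y by (simp add: bij_betw_def)
  then have "bij_betw ?\<pi> pairs pairs"
    by (rule bij_betw_cong[THEN iffD1, rotated]) simp
  then have "?\<pi> permutes pairs" by (rule bij_imp_permutes) simp
  moreover have "replace ?\<pi> = replace y" by (auto simp: fun_eq_iff replace_def)
  ultimately show ?thesis using replace_permutation[OF f] by metis
qed

text \<open>New values outside \<open>pairs\<close> exceed l, hence exceed all the values they
  displace. The absolute values grow in total, and the defect drops.\<close>

lemma replace_decreases_defect:
  assumes y: "\<And>j. j \<in> pairs \<Longrightarrow> y j \<in> pairs \<union> {l<..int n}" and inj: "inj_on y pairs" and ne: "y `
      pairs \<noteq> pairs"
  shows "defect (replace y) < defect w"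
proof -
  have yn: "y j \<in> {1..int n}" if "j \<in> pairs" for j
    using y[OF that] l_nonneg l_le by (auto dest: pairsD)
  have W: "replace y \<in> Words" using yn by (rule replace_Words)
  define S1 where "S1 = (\<lambda>j. (c, place j)) ` pairs"
  define S2 where "S2 = (\<lambda>j. (c, place (- j))) ` pairs"
  have inj1: "inj_on (\<lambda>j. (c, place j)) pairs" "inj_on (\<lambda>j. (c, place (- j))) pairs"
    using place pairsD by (auto intro!: inj_onI) (metis neg_equal_iff_equal)+
  have disj: "S1 \<inter> S2 = {}"
  proof -
    have "place i \<noteq> place (- j)" if "i \<in> pairs" "j \<in> pairs" for i j
      using place[OF pairsD(3)[OF that(1)]] place[OF pairsD(4)[OF that(2)]] pairsD(1)[OF that(1)]
        pairsD(1)[OF that(2)] by auto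
    then show ?thesis by (auto simp: S1_def S2_def)
  qed
  have sub: "S1 \<union> S2 \<subseteq> Pos" using place_Pos pairsD by (auto simp: S1_def S2_def)
  have fin: "finite S1" "finite S2" using finite_pairs by (auto simp: S1_def S2_def)
  have split: "(\<Sum>p\<in>Pos. g p) = (\<Sum>p\<in>Pos - (S1 \<union> S2). g p) + (\<Sum>j\<in>pairs. g (c, place j)) + (\<Sum>j\<in>pairs.
      g (c, place (- j)))"
    for g :: "nat \<times> nat \<Rightarrow> int"
  proof -
    have "(\<Sum>p\<in>Pos. g p) = (\<Sum>p\<in>Pos - (S1 \<union> S2). g p) + (\<Sum>p\<in>S1 \<union> S2. g p)"
      using sub by (intro sum.subset_diff) auto
    also have "(\<Sum>p\<in>S1 \<union> S2. g p) = (\<Sum>p\<in>S1. g p) + (\<Sum>p\<in>S2. g p)"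
      using fin disj by (rule sum.union_disjoint)
    finally show ?thesis using inj1 by (simp add: S1_def S2_def sum.reindex)
  qed
  have "(\<Sum>p\<in>Pos - (S1 \<union> S2). \<bar>replace y p\<bar>) = (\<Sum>p\<in>Pos - (S1 \<union> S2). \<bar>w p\<bar>)"
  proof (rule sum.cong[OF refl])
    fix p assume p: "p \<in> Pos - (S1 \<union> S2)"
    have "\<not> (fst p = c \<and> \<bar>w p\<bar> \<in> pairs)"
    proof
      assume *: "fst p = c \<and> \<bar>w p\<bar> \<in> pairs"
      then have eq: "p = (c, place (w p))"
        using p place_unique[of "snd p" "w p"] by (cases p) (auto simp: Pos_iff)
      show False
      proof (cases "w p \<ge> 0")
        case True
        then have "p \<in> S1" unfolding S1_def using * eq by (intro image_eqI[of _ _ "w p"]) auto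
        then show False using p by blast
      next
        case False
        then have "p \<in> S2" unfolding S2_def using * eq by (intro image_eqI[of _ _ "- w p"]) auto
        then show False using p by blast
      qed
    qed
    then show "\<bar>replace y p\<bar> = \<bar>w p\<bar>" by (auto simp: replace_def)
  qed
  moreover have "(\<Sum>j\<in>pairs. \<bar>replace y (c, place j)\<bar>) = (\<Sum>j\<in>pairs. y j)"
    "(\<Sum>j\<in>pairs. \<bar>replace y (c, place (- j))\<bar>) = (\<Sum>j\<in>pairs. y j)"
  proof -
    have "\<bar>y j\<bar> = y j" if "j \<in> pairs" for j using yn[OF that] by simp
    then show "(\<Sum>j\<in>pairs. \<bar>replace y (c, place j)\<bar>) = (\<Sum>j\<in>pairs. y j)"
      "(\<Sum>j\<in>pairs. \<bar>replace y (c, place (- j))\<bar>) = (\<Sum>j\<in>pairs. y j)"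
      by (auto intro!: sum.cong simp: replace_place)
  qed
  moreover have "(\<Sum>j\<in>pairs. \<bar>w (c, place j)\<bar>) = (\<Sum>j\<in>pairs. j)"
    "(\<Sum>j\<in>pairs. \<bar>w (c, place (- j))\<bar>) = (\<Sum>j\<in>pairs. j)"
  proof -
    have "\<bar>w (c, place j)\<bar> = j" "\<bar>w (c, place (- j))\<bar> = j" if "j \<in> pairs" for j
      using place[of j] place[of "- j"] pairsD[OF that] by auto
    then show "(\<Sum>j\<in>pairs. \<bar>w (c, place j)\<bar>) = (\<Sum>j\<in>pairs. j)"
      "(\<Sum>j\<in>pairs. \<bar>w (c, place (- j))\<bar>) = (\<Sum>j\<in>pairs. j)"
      by (auto intro!: sum.cong)
  qed
  moreover have "(\<Sum>j\<in>pairs. j) < (\<Sum>j\<in>pairs. y j)"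
  proof -
    have "(\<Sum>j\<in>pairs. nat j) < (\<Sum>j\<in>y ` pairs. nat j)"
    proof (rule sum_less_exchange)
      show "card (y ` pairs) = card pairs" by (rule card_image[OF inj])
      show "nat b < nat a" if "a \<in> y ` pairs - pairs" "b \<in> pairs - y ` pairs" for a b
        using that y pairsD[of b] by fastforce
    qed (use finite_pairs ne in auto)
    also have "\<dots> = (\<Sum>j\<in>pairs. nat (y j))" by (simp add: sum.reindex[OF inj])
    finally have "int (\<Sum>j\<in>pairs. nat j) < int (\<Sum>j\<in>pairs. nat (y j))"
      by (simp only: of_nat_less_iff)
    moreover have "int (\<Sum>j\<in>pairs. nat j) = (\<Sum>j\<in>pairs. j)"
      unfolding of_nat_sum
    proof (rule sum.cong[OF refl])
      show "int (nat j) = j" if "j \<in> pairs" for j using pairsD(1)[OF that] by simp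
    qed
    moreover have "int (\<Sum>j\<in>pairs. nat (y j)) = (\<Sum>j\<in>pairs. y j)"
      unfolding of_nat_sum
    proof (rule sum.cong[OF refl])
      show "int (nat (y j)) = y j" if "j \<in> pairs" for j using yn[OF that] by simp
    qed
    ultimately show ?thesis by (simp only:)
  qed
  ultimately have "(\<Sum>p\<in>Pos. \<bar>w p\<bar>) < (\<Sum>p\<in>Pos. \<bar>replace y p\<bar>)"
    unfolding split[of "\<lambda>p. \<bar>w p\<bar>"] split[of "\<lambda>p. \<bar>replace y p\<bar>"] by linarith
  then show ?thesis using defect_less_iff[OF W w] by blast
qed

text \<open>Let A consist of \<open>pairs\<close> and the values above l, and B of the remaining
  values. By \<open>sum_PiE_exchange\<close> the sum over maps into A is, up to sign, the sum over
  maps into B, which is 0. Among the maps into A, each bijection onto \<open>pairs\<close> gives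
  \<open>f w\<close>, a non-injective map gives 0, and any other lowers the defect.\<close>

lemma straightens_crowded:
  assumes IH: "\<And>u. u \<in> Words \<Longrightarrow> defect u < defect w \<Longrightarrow> straightens u"
  shows "straightens w"
proof -
  define A where "A = pairs \<union> {l<..int n}"
  define Y where "Y = pairs \<rightarrow>\<^sub>E A"
  define G where "G = {y \<in> Y. inj_on y pairs \<and> y ` pairs = pairs}"
  have A_n: "A \<union> ({1..l} - pairs) = {1..int n}" "A \<inter> ({1..l} - pairs) = {}"
    using l_le l_nonneg by (auto simp: A_def pairs_def)
  have finA: "finite A" using finite_pairs by (simp add: A_def)
  have finY: "finite Y" using finA finite_pairs by (simp add: Y_def finite_PiE)
  have finG: "finite G" using finY by (simp add: G_def)
  have Yn: "y j \<in> {1..int n}" if "y \<in> Y" "j \<in> pairs" for y j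
    using that A_n by (auto simp: Y_def)
  have "restrict id pairs \<in> G"
    by (auto simp: G_def Y_def A_def inj_on_def image_def)
  then have cardG: "card G \<noteq> 0" using finG by auto
  have combination: "f w = (\<Sum>y\<in>Y - G. - (1 / of_nat (card G)) * f (replace y))" if f:
      "straight_tensor f" for f
  proof -
    have "(\<Sum>y\<in>Y. f (replace y)) = (- 1) ^ card pairs * (\<Sum>y\<in>pairs \<rightarrow>\<^sub>E {1..l} - pairs. f (replace y))"
      unfolding Y_def
    proof (rule sum_PiE_exchange)
      fix i and y :: "int \<Rightarrow> int"
      assume "i \<in> pairs" "\<And>j. j \<in> pairs \<Longrightarrow> j \<noteq> i \<Longrightarrow> y j \<in> A \<union> ({1..l} - pairs)"
      then show "(\<Sum>a\<in>A \<union> ({1..l} - pairs). f (replace (y(i := a)))) = 0"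
        unfolding A_n(1) by (rule replace_sum_zero[OF f])
    qed (use finA finite_pairs A_n in auto)
    also have "(\<Sum>y\<in>pairs \<rightarrow>\<^sub>E {1..l} - pairs. f (replace y)) = 0"
      by (intro sum.neutral ballI replace_low_zero[OF f])
    finally have "0 = (\<Sum>y\<in>Y. f (replace y))" by simp
    also have "\<dots> = (\<Sum>y\<in>Y - G. f (replace y)) + (\<Sum>y\<in>G. f (replace y))"
      using finY by (intro sum.subset_diff) (auto simp: G_def)
    also have "(\<Sum>y\<in>G. f (replace y)) = of_nat (card G) * f w"
      using replace_permutation_restricted[OF f] by (simp add: G_def)
    finally have "of_nat (card G) * f w = - (\<Sum>y\<in>Y - G. f (replace y))"
      by (metis add_eq_0_iff)
    then have "f w = - (\<Sum>y\<in>Y - G. f (replace y)) / of_nat (card G)"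
      using cardG by (simp add: field_simps)
    also have "\<dots> = (\<Sum>y\<in>Y - G. - (1 / of_nat (card G)) * f (replace y))"
      unfolding sum_negf[symmetric] sum_divide_distrib
      by (rule sum.cong[OF refl]) simp
    finally show ?thesis .
  qed
  show ?thesis
  proof (rule straightens_combination[where A = "Y - G" and u = replace, OF _ _ combination])
    show "finite (Y - G)" using finY by simp
    fix y assume y: "y \<in> Y - G"
    show "straightens (replace y)"
    proof (cases "inj_on y pairs")
      case True
      have "y j \<in> pairs \<union> {l<..int n}" if "j \<in> pairs" for j
        using y that by (auto simp: Y_def A_def)
      moreover have "y ` pairs \<noteq> pairs" using y True by (auto simp: G_def)
      ultimately have "defect (replace y) < defect w"
        using True by (intro replace_decreases_defect)
      moreover have "replace y \<in> Words" using y Yn by (intro replace_Words) auto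
      ultimately show ?thesis by (intro IH)
    next
      case False
      have "y j \<in> {1..int n}" if "j \<in> pairs" for j using y Yn that by blast
      then show ?thesis
        using False by (intro straightens_zero replace_non_injective_zero)
    qed
  qed
qed

end

section \<open>The straightening induction\<close>

context column_shape
begin

lemma straightens_all:
  assumes "w \<in> Words"
  shows "straightens w"
  using assms
proof (induction w rule: wf_induct_rule[OF wf_measures[of "[defect, column_disorder,
    row_disorder]"]])
  case (1 w)
  note w = \<open>w \<in> Words\<close>
  have IH: "straightens u" if "u \<in> Words" "defect u < defect w \<or> defect u = defect w \<and>
    (column_disorder u < column_disorder w \<or> column_disorder u = column_disorder w \<and>
     row_disorder u < row_disorder w)" for u
  proof -
    have "(u, w) \<in> measures [defect, column_disorder, row_disorder]"
      using that(2) by (simp only: in_measures simp_thms)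
    then show ?thesis using 1(1) that(1) by blast
  qed
  show ?case
  proof (cases "\<exists>c r s. (c, s) \<in> Pos \<and> r < s \<and> \<not> kappa (w (c, r)) < kappa (w (c, s))")
    case True
    then obtain c r s where unsorted: "(c, s) \<in> Pos" "r < s" "\<not> kappa (w (c, r)) < kappa (w (c, s))"
      by blast
    have cr: "(c, r) \<in> Pos" using unsorted by (auto simp: Pos_iff)
    let ?\<tau> = "Transposition.transpose (c, r) (c, s)"
    have \<tau>: "?\<tau> permutes Pos" using unsorted cr by (intro permutes_swap_id) auto
    show ?thesis
    proof (cases "w (c, r) = w (c, s)")
      case True
      then show ?thesis
        using unsorted cr straight_tensor_repeated[OF _ w cr unsorted(1)] by (intro
            straightens_zero) auto
    next
      case False
      then have "kappa (w (c, s)) < kappa (w (c, r))"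
        using unsorted(3) kappa_eq_iff[of "w (c, r)" "w (c, s)"] by linarith
      note d = column_swap_decreases[OF cr unsorted(1,2) this]
      have "straightens (w \<circ> ?\<tau>)"
        using d by (intro IH Words_perm[OF w \<tau>]) auto
      moreover have comb: "f w = (\<Sum>x\<in>{w \<circ> ?\<tau>}. - 1 * f x)" if "straight_tensor f" for f
      proof -
        have "f (w \<circ> ?\<tau>) = - f w"
          using unsorted(2) by (intro straight_tensor_swap[OF that w cr unsorted(1)]) simp
        then show ?thesis by simp
      qed
      ultimately have *: "x \<in> {w \<circ> ?\<tau>} \<Longrightarrow> straightens x" for x by blast
      show ?thesis
        by (rule straightens_combination[where u = "\<lambda>x. x", OF _ _ comb]) (use * in blast)+
    qed
  next
    case False
    then have strict: "\<And>c r s. (c, s) \<in> Pos \<Longrightarrow> r < s \<Longrightarrow> kappa (w (c, r)) < kappa (w (c, s))"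
      by blast
    consider (crowded) "\<exists>c s. (c, s) \<in> Pos \<and> \<bar>w (c, s)\<bar> \<le> int s"
      | (garnir) "\<exists>c r. (Suc c, r) \<in> Pos \<and> kappa (w (Suc c, r)) < kappa (w (c, r))"
      | (neither) "\<not> (\<exists>c s. (c, s) \<in> Pos \<and> \<bar>w (c, s)\<bar> \<le> int s)"
        "\<not> (\<exists>c r. (Suc c, r) \<in> Pos \<and> kappa (w (Suc c, r)) < kappa (w (c, r)))"
      by blast
    then show ?thesis
    proof cases
      case crowded
      then obtain c s where cs_Pos: "(c, s) \<in> Pos" and low: "\<bar>w (c, s)\<bar> \<le> int s" by blast
      have cs: "c < m" "s < h c" using cs_Pos by (auto simp: Pos_iff)
      \<comment> \<open>Take for l the absolute value of the violating letter. The letters in rows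
        0, ..., s do not exceed it in King's order, so s + 1 letters have absolute value at most l,
        and l \<le> s.\<close>
      interpret crowded_column n m h w c "\<bar>w (c, s)\<bar>"
      proof unfold_locales
        have smono: "strict_mono_on {..<h c} (\<lambda>s. kappa (w (c, s)))"
          using strict cs(1) by (auto intro!: strict_mono_onI simp: Pos_iff)
        show "inj_on (\<lambda>s. w (c, s)) {..<h c}"
          using strict_mono_on_imp_inj_on[OF smono] by (auto simp: inj_on_def)
        have "{..s} \<subseteq> {r. r < h c \<and> \<bar>w (c, r)\<bar> \<le> \<bar>w (c, s)\<bar>}"
        proof
          fix r assume "r \<in> {..s}"
          then show "r \<in> {r. r < h c \<and> \<bar>w (c, r)\<bar> \<le> \<bar>w (c, s)\<bar>}"
            using strict[OF cs_Pos, of r] cs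
            by (cases "r = s") (auto dest: kappa_less_imp_abs_le)
        qed
        then have "card {..s} \<le> card {r. r < h c \<and> \<bar>w (c, r)\<bar> \<le> \<bar>w (c, s)\<bar>}"
          by (intro card_mono) auto
        then show "\<bar>w (c, s)\<bar> < int (card {r. r < h c \<and> \<bar>w (c, r)\<bar> \<le> \<bar>w (c, s)\<bar>})"
          using low by simp
        have "w (c, s) \<in> Nset n" using w cs_Pos by simp
        then show "\<bar>w (c, s)\<bar> \<le> int n" by (simp add: Nset_iff)
      qed (use w cs in auto)
      show ?thesis by (rule straightens_crowded) (auto intro: IH)
    next
      case garnir
      then obtain c r where "(Suc c, r) \<in> Pos" "kappa (w (Suc c, r)) < kappa (w (c, r))" by blast
      then show ?thesis by (rule straightens_garnir[OF w _ _ strict]) (auto intro: IH)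
    next
      case neither
      have "king w"
        unfolding king_def
      proof (intro conjI allI impI w)
        show "int s < \<bar>w (c, s)\<bar>" if "(c, s) \<in> Pos" for c s
          using neither(1) that by (meson not_le)
        show "kappa (w (c, r)) \<le> kappa (w (Suc c, r))" if "(Suc c, r) \<in> Pos" for c r
          using neither(2) that by (meson not_le)
      qed (rule strict)
      then show ?thesis by (rule straightens_king)
    qed
  qed
qed

end


section \<open>Leading coefficients of the PBW monomials\<close>

lemma set_root_list: "set (root_list n) = Pset n - Aset n"
  by (auto simp: root_list_def Pset_def Aset_def image_iff abs_if split: if_splits)

lemma distinct_root_list: "distinct (root_list n)"
proof -
  have "distinct (concat (map (\<lambda>i. map (Pair i) (X i)) is))"
    if "distinct is" "\<And>i. i \<in> set is \<Longrightarrow> distinct (X i)" for X :: "int \<Rightarrow> int list" and "is"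
    using that by (induction "is") (auto simp: distinct_map inj_on_def)
  from this[of "[1..int n]" "\<lambda>i. [i + 1..int n] @ [- int n..- i]"] show ?thesis
    unfolding root_list_def by auto
qed

lemma sorted_root_list: "sorted_wrt (\<lambda>p q. fst p \<le> fst q) (root_list n)"
proof -
  have *: "sorted_wrt (\<lambda>p q. fst p \<le> fst q) (concat (map (\<lambda>i. map (Pair i) (X i)) is))"
    if "sorted is" for X :: "int \<Rightarrow> int list" and "is"
    using that
  proof (induction "is")
    case (Cons i "is")
    have "sorted_wrt (\<lambda>p q. fst p \<le> fst q) (map (Pair i) (X i))"
      by (simp add: sorted_wrt_map)
    then show ?case using Cons by (auto simp: sorted_wrt_append)
  qed simp
  show ?thesis unfolding root_list_def by (rule *) simp
qed

definition root_degree :: "int \<times> int \<Rightarrow> int" where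
  "root_degree ij = \<bar>snd ij\<bar> - fst ij"

definition mono_degree :: "nat \<Rightarrow> mono \<Rightarrow> int" where
  "mono_degree n d = (\<Sum>ij\<in>Pset n. int (Poly_Mapping.lookup d ij) * root_degree ij)"

text \<open>For j = -i both summands of the root vector are E_{-i,i}, which makes it twice a matrix
  unit.\<close>

definition root_multiplier :: "int \<times> int \<Rightarrow> complex" where
  "root_multiplier ij = (if snd ij = - fst ij then 2 else 1)"

section \<open>Top coefficients of the vectors f^d t\<close>

context column_shape
begin

definition letter_sum :: "word \<Rightarrow> int" where
  "letter_sum w = (\<Sum>p\<in>Pos. \<bar>w p\<bar>)"

definition base_sum :: int where
  "base_sum = (\<Sum>p\<in>Pos. int (snd p) + 1)"

definition lowering :: "int \<times> int \<Rightarrow> tensor \<Rightarrow> tensor" where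
  "lowering ij f w = (if w \<in> Words
     then root_multiplier ij * (\<Sum>p | p \<in> Pos \<and> w p = snd ij. f (w(p := fst ij))) else 0)"

text \<open>The filtration of tensors by letter sum: f lies in level l and has top part g. Nothing
  is recorded about words of smaller letter sum.\<close>

definition leading_part :: "int \<Rightarrow> tensor \<Rightarrow> tensor \<Rightarrow> bool" where
  "leading_part l f g \<longleftrightarrow> (\<forall>w\<in>Words. (letter_sum w = l \<longrightarrow> f w = g w) \<and> (letter_sum w > l \<longrightarrow> f w = 0))"

lemma letter_sum_upd: "p \<in> Pos \<Longrightarrow> letter_sum (w(p := b)) = letter_sum w - \<bar>w p\<bar> + \<bar>b\<bar>"
  unfolding letter_sum_def by (simp add: sum.remove[of Pos p])

lemma act_froot:
  assumes ij: "(i, j) \<in> Pset n - Aset n" and w: "w \<in> Words"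
  shows "act (froot n i j) f w = (\<Sum>p | p \<in> Pos \<and> w p = j. f (w(p := i)))
    - of_int (sgn j) * (\<Sum>p | p \<in> Pos \<and> w p = - i. f (w(p := - j)))"
proof -
  note P = Pset_minus_AsetD[OF ij]
  have "(\<Sum>b\<in>Nset n. entry n (froot n i j) (w p) b * f (w(p := b)))
      = (if w p = j then f (w(p := i)) else 0) - (if w p = - i then of_int (sgn j) * f (w(p := -
          j)) else 0)"
    if p: "p \<in> Pos" for p
  proof -
    have "(\<Sum>b\<in>Nset n. entry n (froot n i j) (w p) b * f (w(p := b)))
        = (\<Sum>b\<in>Nset n. (if b = i then (if w p = j then f (w(p := i)) else 0) else 0)
            - (if b = - j then (if w p = - i then of_int (sgn j) * f (w(p := - j)) else 0) else 0))"
    proof (rule sum.cong[OF refl])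
      fix b assume b: "b \<in> Nset n"
      have e: "entry n (froot n i j) (w p) b = of_bool (w p = j \<and> b = i) - of_int (sgn j) *
          of_bool (w p = - i \<and> b = - j)"
        using P b p w by (intro entry_froot) auto
      show "entry n (froot n i j) (w p) b * f (w(p := b))
          = (if b = i then (if w p = j then f (w(p := i)) else 0) else 0)
            - (if b = - j then (if w p = - i then of_int (sgn j) * f (w(p := - j)) else 0) else 0)"
        unfolding e by (auto simp: algebra_simps)
    qed
    also have "\<dots> = (if w p = j then f (w(p := i)) else 0) - (if w p = - i then of_int (sgn j) * f
        (w(p := - j)) else 0)"
      using P by (simp add: sum_subtractf)
    finally show ?thesis .
  qed
  then have "act (froot n i j) f w = (\<Sum>p\<in>Pos. (if w p = j then f (w(p := i)) else 0)
      - (if w p = - i then of_int (sgn j) * f (w(p := - j)) else 0))"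
    using w by (simp add: act_def)
  also have "\<dots> = (\<Sum>p\<in>Pos. if w p = j then f (w(p := i)) else 0)
      - (\<Sum>p\<in>Pos. if w p = - i then of_int (sgn j) * f (w(p := - j)) else 0)"
    by (rule sum_subtractf)
  also have "(\<Sum>p\<in>Pos. if w p = j then f (w(p := i)) else 0) = (\<Sum>p | p \<in> Pos \<and> w p = j. f (w(p :=
      i)))"
    by (rule sum.mono_neutral_cong_right) auto
  also have "(\<Sum>p\<in>Pos. if w p = - i then of_int (sgn j) * f (w(p := - j)) else 0)
      = (\<Sum>p | p \<in> Pos \<and> w p = - i. of_int (sgn j) * f (w(p := - j)))"
    by (rule sum.mono_neutral_cong_right) auto
  finally show ?thesis by (simp only: sum_distrib_left)
qed

text \<open>At a word of letter sum at least the new level, the summand E_{j,i} evaluates f at a sum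
  smaller by the root degree. For j different from -i the other summand evaluates f strictly above
  level l, where it vanishes; for j = -i it doubles the first.\<close>

lemma leading_part_froot:
  assumes ij: "(i, j) \<in> Pset n - Aset n" and fg: "leading_part l f g"
  shows "leading_part (l + root_degree (i, j)) (act (froot n i j) f) (lowering (i, j) g)"
  unfolding leading_part_def
proof (intro ballI)
  fix w assume w: "w \<in> Words"
  note P = Pset_minus_AsetD[OF ij]
  have ls: "letter_sum (w(p := i)) = letter_sum w - root_degree (i, j)" if "p \<in> Pos" "w p = j" for p
    using that P by (simp add: letter_sum_upd root_degree_def)
  have W: "w(p := i) \<in> Words" "w(p := - j) \<in> Words" if "p \<in> Pos" for p
    using that w P by auto
  have second: "(\<Sum>p | p \<in> Pos \<and> w p = - i. f (w(p := - j))) = 0"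
    if "l + root_degree (i, j) \<le> letter_sum w" "j \<noteq> - i"
  proof (rule sum.neutral, rule ballI)
    fix p assume p: "p \<in> {p. p \<in> Pos \<and> w p = - i}"
    then have "letter_sum (w(p := - j)) = letter_sum w + root_degree (i, j)"
      using P by (simp add: letter_sum_upd root_degree_def)
    moreover have "root_degree (i, j) > 0" using P that(2) by (auto simp: root_degree_def)
    ultimately have "letter_sum (w(p := - j)) > l" using that(1) by simp
    then show "f (w(p := - j)) = 0" using fg W p by (auto simp: leading_part_def)
  qed
  have act: "act (froot n i j) f w = root_multiplier (i, j) * (\<Sum>p | p \<in> Pos \<and> w p = j. f (w(p :=
      i)))"
    if "l + root_degree (i, j) \<le> letter_sum w"
  proof (cases "j = - i")
    case True
    then show ?thesis using P act_froot[OF ij w, of f] by (simp add: root_multiplier_def)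
  next
    case False
    then show ?thesis using act_froot[OF ij w, of f] second[OF that] by (simp add:
        root_multiplier_def)
  qed
  show "(letter_sum w = l + root_degree (i, j) \<longrightarrow> act (froot n i j) f w = lowering (i, j) g w) \<and>
      (l + root_degree (i, j) < letter_sum w \<longrightarrow> act (froot n i j) f w = 0)"
  proof (intro conjI impI)
    assume eq: "letter_sum w = l + root_degree (i, j)"
    have "(\<Sum>p | p \<in> Pos \<and> w p = j. f (w(p := i))) = (\<Sum>p | p \<in> Pos \<and> w p = j. g (w(p := i)))"
      using fg W ls eq by (intro sum.cong refl) (auto simp: leading_part_def)
    then show "act (froot n i j) f w = lowering (i, j) g w"
      using act eq w by (simp add: lowering_def)
  next
    assume gt: "l + root_degree (i, j) < letter_sum w"
    have "(\<Sum>p | p \<in> Pos \<and> w p = j. f (w(p := i))) = 0"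
      using fg W ls gt by (intro sum.neutral) (auto simp: leading_part_def)
    then show "act (froot n i j) f w = 0" using act gt by simp
  qed
qed

lemma leading_part_froot_power:
  assumes ij: "(i, j) \<in> Pset n - Aset n" and fg: "leading_part l f g"
  shows "leading_part (l + int k * root_degree (i, j)) ((act (froot n i j) ^^ k) f) ((lowering (i,
      j) ^^ k) g)"
proof (induction k)
  case (Suc k)
  show ?case using leading_part_froot[OF ij Suc.IH] by (simp add: algebra_simps)
qed (simp add: fg)

lemma leading_part_foldr:
  assumes "set L \<subseteq> Pset n - Aset n" and fg: "leading_part l f g"
  shows "leading_part (l + (\<Sum>ij\<leftarrow>L. int (d ij) * root_degree ij))
    (foldr (\<lambda>(i, j). act (froot n i j) ^^ d (i, j)) L f) (foldr (\<lambda>ij. lowering ij ^^ d ij) L g)"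
  using assms(1)
proof (induction L)
  case (Cons ij L)
  obtain i j where ij: "ij = (i, j)" by fastforce
  have "leading_part ((l + (\<Sum>ij\<leftarrow>L. int (d ij) * root_degree ij)) + int (d (i, j)) * root_degree
      (i, j))
    ((act (froot n i j) ^^ d (i, j)) (foldr (\<lambda>(i, j). act (froot n i j) ^^ d (i, j)) L f))
    ((lowering (i, j) ^^ d (i, j)) (foldr (\<lambda>ij. lowering ij ^^ d ij) L g))"
    using Cons ij by (intro leading_part_froot_power) auto
  then show ?case by (simp add: ij algebra_simps)
qed (simp add: fg)

text \<open>Describes the composites of lowerings in which no letter moves twice. Chains of moves
  are excluded by the order of the factors in f^d.\<close>

definition transition :: "(int \<times> int) list \<Rightarrow> (int \<times> int \<Rightarrow> nat) \<Rightarrow> word \<Rightarrow> word \<Rightarrow> bool" where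
  "transition L d u w \<longleftrightarrow> (\<forall>p\<in>Pos. u p = w p \<or> (u p, w p) \<in> set L) \<and>
    (\<forall>ij\<in>set L. card {p\<in>Pos. (u p, w p) = ij} = d ij)"

text \<open>This undoes the last move from i to j at p. No pair of \<open>L\<close> ends in i, so
  the letter i at p must have been there from the beginning, which is the condition
  \<open>u p = i\<close>.\<close>

lemma transition_step:
  assumes ij: "(i, j) \<notin> set L" "i \<noteq> j" "\<And>a. (a, i) \<notin> set L" and p: "p \<in> Pos" "w p = j"
  shows "transition ((i, j) # L) (d((i, j) := k)) u (w(p := i))
    \<longleftrightarrow> u p = i \<and> transition ((i, j) # L) (d((i, j) := Suc k)) u w"
proof (cases "u p = i")
  case True
  have eq: "{q\<in>Pos. (u q, w q) = (a, b)} = {q\<in>Pos. (u q, (w(p := i)) q) = (a, b)}" if "(a, b) \<in>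
      set L" for a b
    using that True p ij by (auto split: if_splits)
  have "{q\<in>Pos. (u q, w q) = (i, j)} = insert p {q\<in>Pos. (u q, (w(p := i)) q) = (i, j)}"
    using True p ij by (auto split: if_splits)
  then have card: "card {q\<in>Pos. (u q, w q) = (i, j)} = Suc (card {q\<in>Pos. (u q, (w(p := i)) q) =
      (i, j)})"
    using ij p by simp
  have mem: "(\<forall>q\<in>Pos. u q = (w(p := i)) q \<or> (u q, (w(p := i)) q) \<in> set ((i, j) # L))
      \<longleftrightarrow> (\<forall>q\<in>Pos. u q = w q \<or> (u q, w q) \<in> set ((i, j) # L))"
    using True p by auto
  have counts: "(\<forall>ab\<in>set L. card {q\<in>Pos. (u q, (w(p := i)) q) = ab} = (d((i, j) := k)) ab)
      \<longleftrightarrow> (\<forall>ab\<in>set L. card {q\<in>Pos. (u q, w q) = ab} = (d((i, j) := Suc k)) ab)"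
  proof (rule ball_cong[OF refl])
    fix ab assume ab: "ab \<in> set L"
    then have "ab \<noteq> (i, j)" using ij by blast
    then show "card {q\<in>Pos. (u q, (w(p := i)) q) = ab} = (d((i, j) := k)) ab
        \<longleftrightarrow> card {q\<in>Pos. (u q, w q) = ab} = (d((i, j) := Suc k)) ab"
      using eq[of "fst ab" "snd ab"] ab by simp
  qed
  show ?thesis
    unfolding transition_def mem using True counts card by (simp del: fun_upd_apply) simp
next
  case False
  then show ?thesis using p ij unfolding transition_def by auto
qed

lemma transition_zero:
  assumes "(i, j) \<notin> set L" "i \<noteq> j"
  shows "transition ((i, j) # L) (d((i, j) := 0)) u w \<longleftrightarrow> transition L d u w"
proof
  assume t: "transition ((i, j) # L) (d((i, j) := 0)) u w"
  then have "{p\<in>Pos. (u p, w p) = (i, j)} = {}" by (auto simp: transition_def)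
  then show "transition L d u w" using t assms unfolding transition_def by auto
next
  assume t: "transition L d u w"
  then have "{p\<in>Pos. (u p, w p) = (i, j)} = {}" using assms by (auto simp: transition_def)
  then show "transition ((i, j) # L) (d((i, j) := 0)) u w"
    using t assms unfolding transition_def by auto
qed

text \<open>The last of the k moves may be at any of the k positions with
  \<open>(u p, w p) = (i, j)\<close>, so every transition is counted \<open>fact k\<close> times;
  \<open>root_multiplier\<close> enters once per move.\<close>

lemma lowering_power:
  assumes ij: "(i, j) \<notin> set L" "i \<noteq> j" "\<And>a. (a, i) \<notin> set L" "i \<in> Nset n"
    and F: "\<And>w. w \<in> Words \<Longrightarrow> F w = C * (\<Sum>u\<in>Words. f u * of_bool (transition L d u w))"
    and w: "w \<in> Words"
  shows "(lowering (i, j) ^^ k) F w = root_multiplier (i, j) ^ k * fact k * C *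
    (\<Sum>u\<in>Words. f u * of_bool (transition ((i, j) # L) (d((i, j) := k)) u w))"
  using w
proof (induction k arbitrary: w)
  case 0
  then show ?case unfolding transition_zero[OF ij(1,2)] by (simp only: F funpow_0 power_0 fact_0
      mult_1)
next
  case (Suc k)
  let ?c = "root_multiplier (i, j) ^ k * fact k * C"
  have "(lowering (i, j) ^^ Suc k) F w
      = root_multiplier (i, j) * (\<Sum>p | p \<in> Pos \<and> w p = j. (lowering (i, j) ^^ k) F (w(p := i)))"
    using Suc.prems by (simp add: lowering_def)
  also have "(\<Sum>p | p \<in> Pos \<and> w p = j. (lowering (i, j) ^^ k) F (w(p := i)))
      = (\<Sum>p | p \<in> Pos \<and> w p = j. ?c * (\<Sum>u\<in>Words. f u *
          of_bool (u p = i \<and> transition ((i, j) # L) (d((i, j) := Suc k)) u w)))"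
  proof (rule sum.cong[OF refl])
    fix p assume "p \<in> {p. p \<in> Pos \<and> w p = j}"
    then have p: "p \<in> Pos" "w p = j" by auto
    have "w(p := i) \<in> Words" using Suc.prems ij(4) p by simp
    then show "(lowering (i, j) ^^ k) F (w(p := i)) = ?c * (\<Sum>u\<in>Words. f u *
          of_bool (u p = i \<and> transition ((i, j) # L) (d((i, j) := Suc k)) u w))"
      unfolding transition_step[where p = p and w = w, OF ij(1-3) p, symmetric] by (rule Suc.IH)
  qed
  also have "\<dots> = ?c * (\<Sum>u\<in>Words. \<Sum>p | p \<in> Pos \<and> w p = j. f u *
          of_bool (u p = i \<and> transition ((i, j) # L) (d((i, j) := Suc k)) u w))"
    unfolding sum_distrib_left by (rule sum.swap)
  also have "(\<Sum>u\<in>Words. \<Sum>p | p \<in> Pos \<and> w p = j. f u *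
          of_bool (u p = i \<and> transition ((i, j) # L) (d((i, j) := Suc k)) u w))
      = (\<Sum>u\<in>Words. of_nat (Suc k) * (f u * of_bool (transition ((i, j) # L) (d((i, j) := Suc k)) u
          w)))"
  proof (rule sum.cong[OF refl])
    fix u assume "u \<in> Words"
    show "(\<Sum>p | p \<in> Pos \<and> w p = j. f u * of_bool (u p = i \<and> transition ((i, j) # L) (d((i, j) :=
        Suc k)) u w))
        = of_nat (Suc k) * (f u * of_bool (transition ((i, j) # L) (d((i, j) := Suc k)) u w))"
    proof (cases "transition ((i, j) # L) (d((i, j) := Suc k)) u w")
      case True
      then have "card {p\<in>Pos. (u p, w p) = (i, j)} = Suc k" by (simp add: transition_def)
      moreover have "(\<Sum>p | p \<in> Pos \<and> w p = j. f u * of_bool (u p = i)) = (\<Sum>p | p \<in> Pos \<and> (u p, w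
          p) = (i, j). f u)"
        by (rule sum.mono_neutral_cong_right) auto
      ultimately show ?thesis using True by simp
    qed simp
  qed
  also have "\<dots> = of_nat (Suc k) * (\<Sum>u\<in>Words. f u * of_bool (transition ((i, j) # L) (d((i, j) :=
      Suc k)) u w))"
    by (simp only: sum_distrib_left)
  finally show ?case by (simp only: power_Suc fact_Suc mult_ac)
qed

lemma foldr_lowering:
  assumes "sorted_wrt (\<lambda>p q. fst p \<le> fst q) L" "distinct L" "set L \<subseteq> Pset n - Aset n" "w \<in> Words"
  shows "foldr (\<lambda>ij. lowering ij ^^ d ij) L f w
    = (\<Prod>ij\<leftarrow>L. root_multiplier ij ^ d ij * fact (d ij)) * (\<Sum>u\<in>Words. f u * of_bool (transition L d
        u w))"
  using assms
proof (induction L arbitrary: w)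
  case Nil
  have "transition [] d u w \<longleftrightarrow> u = w" if "u \<in> Words" for u
    using that Nil.prems by (auto simp: transition_def Words_def intro: PiE_ext)
  then have "(\<Sum>u\<in>Words. f u * of_bool (transition [] d u w)) = (\<Sum>u\<in>Words. if u = w then f w else 0)"
    by (intro sum.cong refl) auto
  then show ?case using Nil.prems by simp
next
  case (Cons ij L)
  obtain i j where ij: "ij = (i, j)" by fastforce
  have P: "(i, j) \<in> Pset n - Aset n" using Cons.prems ij by simp
  note PD = Pset_minus_AsetD[OF P]
  \<comment> \<open>The factors to the right have first index a \<ge> i. A pair (a, i) would also
    satisfy a \<le> i, hence be diagonal, and diagonal pairs are not roots.\<close>
  have no: "(a, i) \<notin> set L" for a
  proof
    assume a: "(a, i) \<in> set L"
    then have "(a, i) \<in> Pset n - Aset n" "i \<le> a" using Cons.prems ij by auto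
    then show False using PD(3) Pset_minus_AsetD(4,5)[of a i n] by auto
  qed
  have "(lowering (i, j) ^^ d (i, j)) (foldr (\<lambda>ij. lowering ij ^^ d ij) L f) w
      = root_multiplier (i, j) ^ d (i, j) * fact (d (i, j)) * (\<Prod>ij\<leftarrow>L. root_multiplier ij ^ d ij *
          fact (d ij)) *
        (\<Sum>u\<in>Words. f u * of_bool (transition ((i, j) # L) (d((i, j) := d (i, j))) u w))"
    using Cons ij PD no by (intro lowering_power) auto
  then show ?case by (simp add: ij)
qed

lemma hw_tensor_letter_sum:
  assumes "w \<in> Words" "hw_tensor w \<noteq> 0"
  shows "letter_sum w = base_sum"
proof -
  have "letter_sum w = (\<Sum>c<m. \<Sum>s<h c. \<bar>w (c, s)\<bar>)"
    unfolding letter_sum_def Pos_def by (subst sum.Sigma) auto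
  also have "\<dots> = (\<Sum>c<m. \<Sum>s<h c. int s + 1)"
  proof (rule sum.cong[OF refl])
    fix c assume "c \<in> {..<m}"
    then have "bij_betw (\<lambda>s. w (c, s)) {..<h c} {1..int (h c)}"
      using hw_tensor_letters[OF assms(2), of c] by (simp add: bij_betw_def)
    then have "(\<Sum>s<h c. \<bar>w (c, s)\<bar>) = (\<Sum>i\<in>{1..int (h c)}. \<bar>i\<bar>)"
      by (rule sum.reindex_bij_betw)
    also have "\<dots> = (\<Sum>s<h c. int s + 1)"
      by (rule sum.reindex_bij_witness[of _ "\<lambda>s. int s + 1" "\<lambda>i. nat (i - 1)"]) auto
    finally show "(\<Sum>s<h c. \<bar>w (c, s)\<bar>) = (\<Sum>s<h c. int s + 1)" .
  qed
  also have "\<dots> = base_sum"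
    unfolding base_sum_def Pos_def by (subst sum.Sigma) (auto simp: case_prod_beta)
  finally show ?thesis .
qed

definition f_multiplier :: "mono \<Rightarrow> complex" where
  "f_multiplier d = (\<Prod>ij\<leftarrow>root_list n. root_multiplier ij ^ Poly_Mapping.lookup d ij * fact
      (Poly_Mapping.lookup d ij))"

lemma f_multiplier_nonzero: "f_multiplier d \<noteq> 0"
  by (auto simp: f_multiplier_def prod_list_zero_iff root_multiplier_def split: if_splits)

lemma mono_degree_root_list:
  "mono_degree n d = (\<Sum>ij\<leftarrow>root_list n. int (Poly_Mapping.lookup d ij) * root_degree ij)"
proof -
  have fin: "finite (Pset n)"
    by (rule finite_subset[of _ "{1..int n} \<times> {- int n..int n}"]) (auto simp: Pset_def)
  have "(\<Sum>ij\<leftarrow>root_list n. int (Poly_Mapping.lookup d ij) * root_degree ij)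
      = (\<Sum>ij\<in>Pset n - Aset n. int (Poly_Mapping.lookup d ij) * root_degree ij)"
    by (simp add: sum_list_distinct_conv_sum_set distinct_root_list set_root_list)
  also have "\<dots> = mono_degree n d"
    unfolding mono_degree_def using fin
    by (intro sum.mono_neutral_left) (auto simp: Aset_def root_degree_def)
  finally show ?thesis by simp
qed

lemma f_power_leading:
  assumes w: "w \<in> Words"
  shows f_power_leading_eq: "letter_sum w = base_sum + mono_degree n d \<Longrightarrow> f_power n act d hw_tensor w
      = f_multiplier d * (\<Sum>u\<in>Words. hw_tensor u * of_bool (transition (root_list n)
          (Poly_Mapping.lookup d) u w))"
    and f_power_beyond: "letter_sum w > base_sum + mono_degree n d \<Longrightarrow> f_power n act d hw_tensor w =
        0"
proof -
  have "leading_part base_sum hw_tensor hw_tensor"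
    using hw_tensor_letter_sum unfolding leading_part_def by fastforce
  then have "leading_part (base_sum + mono_degree n d) (f_power n act d hw_tensor)
      (foldr (\<lambda>ij. lowering ij ^^ Poly_Mapping.lookup d ij) (root_list n) hw_tensor)"
    unfolding mono_degree_root_list f_power_def by (intro leading_part_foldr) (simp_all add:
        set_root_list)
  moreover have "foldr (\<lambda>ij. lowering ij ^^ Poly_Mapping.lookup d ij) (root_list n) hw_tensor w
      = f_multiplier d * (\<Sum>u\<in>Words. hw_tensor u * of_bool (transition (root_list n)
          (Poly_Mapping.lookup d) u w))"
    unfolding f_multiplier_def
    by (intro foldr_lowering sorted_root_list distinct_root_list w) (simp add: set_root_list)
  ultimately show "letter_sum w = base_sum + mono_degree n d \<Longrightarrow> f_power n act d hw_tensor w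
      = f_multiplier d * (\<Sum>u\<in>Words. hw_tensor u * of_bool (transition (root_list n)
          (Poly_Mapping.lookup d) u w))"
    and "letter_sum w > base_sum + mono_degree n d \<Longrightarrow> f_power n act d hw_tensor w = 0"
    using w by (simp_all add: leading_part_def)
qed

end


section \<open>Determinants as polynomials\<close>

lemma lookup_poly_scale: "Poly_Mapping.lookup (poly_scale c p) d = c * Poly_Mapping.lookup p d"
  unfolding poly_scale_def mult_map_scale_conv_mult[symmetric] by (simp add:
      Poly_Mapping.map.rep_eq when_def)

interpretation poly: vector_space poly_scale
  by (rule vector_space_poly_scale)

lemma lookup_of_int_mult:
  "Poly_Mapping.lookup (of_int k * p :: cpoly) d = of_int k * Poly_Mapping.lookup p d"
  using lookup_poly_scale[of "of_int k" p d] by (simp add: poly_scale_def)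

lemma lookup_monomial: "Poly_Mapping.lookup (monomial d) e = of_bool (d = e)"
  by (simp add: monomial_def lookup_single when_def)

lemma monomial_sum: "monomial (\<Sum>x\<in>A. f x) = (\<Prod>x\<in>A. monomial (f x))"
proof (induction A rule: infinite_finite_induct)
  case (insert x A)
  have "monomial (f x + (\<Sum>x\<in>A. f x)) = monomial (f x) * monomial (\<Sum>x\<in>A. f x)"
    by (simp add: monomial_def mult_single)
  then show ?case using insert by simp
qed (simp_all add: monomial_def)

lemma finite_Pset [simp]: "finite (Pset n)"
  by (rule finite_subset[of _ "{1..int n} \<times> {- int n..int n}"]) (auto simp: Pset_def)

lemma sum_counting:
  fixes X :: "'b \<Rightarrow> int"
  assumes "finite A" "finite B" "\<And>p. p \<in> A \<Longrightarrow> g p \<in> B"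
  shows "(\<Sum>b\<in>B. int (card {p\<in>A. g p = b}) * X b) = (\<Sum>p\<in>A. X (g p))"
proof -
  have "(\<Sum>b\<in>B. int (card {p\<in>A. g p = b}) * X b) = (\<Sum>b\<in>B. \<Sum>p | p \<in> A \<and> g p = b. X (g p))"
    by (intro sum.cong refl) simp
  also have "\<dots> = (\<Sum>p\<in>A. X (g p))"
    using sum.group[OF assms(1,2), of g "\<lambda>p. X (g p)"] assms(3) by (simp add: image_subset_iff)
  finally show ?thesis .
qed

text \<open>Rearrangement inequality with its equality case, by layers: \<open>x s\<close> is the
  number of thresholds t \<le> \<open>x s\<close>. For each t the set of s with t \<le>
  \<open>x s\<close> is as large as the final segment of s with t \<le> \<open>Suc s\<close>. As
  \<kappa> increases, the final segment has the larger sum, strictly so unless the two sets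
  agree.\<close>

lemma rearrangement:
  fixes x \<kappa> :: "nat \<Rightarrow> nat"
  assumes x: "bij_betw x {..<k} {1..k}" and \<kappa>: "\<And>r s. r < s \<Longrightarrow> s < k \<Longrightarrow> \<kappa> r < \<kappa> s"
  shows "(\<Sum>s<k. x s * \<kappa> s) \<le> (\<Sum>s<k. Suc s * \<kappa> s)"
    and "(\<Sum>s<k. x s * \<kappa> s) = (\<Sum>s<k. Suc s * \<kappa> s) \<Longrightarrow> s < k \<Longrightarrow> x s = Suc s"
proof -
  define U where "U t = {s. s < k \<and> t \<le> Suc s}" for t
  define V where "V t = {s. s < k \<and> t \<le> x s}" for t
  have layers: "(\<Sum>s<k. y s * \<kappa> s) = (\<Sum>t\<in>{1..k}. \<Sum>s | s < k \<and> t \<le> y s. \<kappa> s)"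
    if y: "\<And>s. s < k \<Longrightarrow> y s \<in> {1..k}" for y
  proof -
    have "(\<Sum>s<k. y s * \<kappa> s) = (\<Sum>s<k. \<Sum>t\<in>{1..k}. if t \<le> y s then \<kappa> s else 0)"
    proof (rule sum.cong[OF refl])
      fix s assume "s \<in> {..<k}"
      then have "{t\<in>{1..k}. t \<le> y s} = {1..y s}" using y[of s] by auto
      then have "card {t\<in>{1..k}. t \<le> y s} = y s" by simp
      moreover have "(\<Sum>t\<in>{1..k}. if t \<le> y s then \<kappa> s else 0) = (\<Sum>t\<in>{t\<in>{1..k}. t \<le> y s}. \<kappa> s)"
        by (rule sum.mono_neutral_cong_right) auto
      ultimately show "y s * \<kappa> s = (\<Sum>t\<in>{1..k}. if t \<le> y s then \<kappa> s else 0)" by simp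
    qed
    also have "\<dots> = (\<Sum>t\<in>{1..k}. \<Sum>s<k. if t \<le> y s then \<kappa> s else 0)" by (rule sum.swap)
    also have "\<dots> = (\<Sum>t\<in>{1..k}. \<Sum>s | s < k \<and> t \<le> y s. \<kappa> s)"
      by (intro sum.cong refl sum.mono_neutral_cong_right) auto
    finally show ?thesis .
  qed
  have xs: "x s \<in> {1..k}" if "s < k" for s using x that by (auto simp: bij_betw_def)
  have card: "card (U t) = card (V t)" if t: "t \<in> {1..k}" for t
  proof -
    have "bij_betw Suc (U t) {t..k}"
      using t by (intro bij_betw_byWitness[where f' = "\<lambda>s. s - 1"]) (auto simp: U_def)
    moreover have "bij_betw x (V t) {t..k}"
    proof -
      have "x ` V t = {t..k}"
      proof (intro equalityI subsetI)
        fix y assume "y \<in> {t..k}"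
        then have "y \<in> x ` {..<k}" using x t by (auto simp: bij_betw_def)
        then show "y \<in> x ` V t" using \<open>y \<in> {t..k}\<close> by (auto simp: V_def)
      qed (use xs in \<open>auto simp: V_def\<close>)
      moreover have "inj_on x (V t)"
        using x by (auto simp: bij_betw_def V_def intro: inj_on_subset)
      ultimately show ?thesis by (simp add: bij_betw_def)
    qed
    ultimately show ?thesis by (metis bij_betw_same_card)
  qed
  have less: "sum \<kappa> (V t) < sum \<kappa> (U t)" if t: "t \<in> {1..k}" "U t \<noteq> V t" for t
  proof (rule sum_less_exchange)
    show "\<kappa> b < \<kappa> a" if "a \<in> U t - V t" "b \<in> V t - U t" for a b
      using that by (intro \<kappa>) (auto simp: U_def V_def)
  qed (use t card in \<open>auto simp: U_def V_def\<close>)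
  have le: "sum \<kappa> (V t) \<le> sum \<kappa> (U t)" if "t \<in> {1..k}" for t
    using less[OF that] by (cases "U t = V t") auto
  have eq: "(\<Sum>s<k. x s * \<kappa> s) = (\<Sum>t\<in>{1..k}. sum \<kappa> (V t))" "(\<Sum>s<k. Suc s * \<kappa> s) = (\<Sum>t\<in>{1..k}. sum \<kappa>
      (U t))"
    unfolding U_def V_def by (rule layers[OF xs], assumption) (rule layers, simp)
  show "(\<Sum>s<k. x s * \<kappa> s) \<le> (\<Sum>s<k. Suc s * \<kappa> s)"
    unfolding eq by (intro sum_mono le)
  assume *: "(\<Sum>s<k. x s * \<kappa> s) = (\<Sum>s<k. Suc s * \<kappa> s)" and s: "s < k"
  have UV: "U t = V t" if t: "t \<in> {1..k}" for t
  proof (rule ccontr)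
    assume "U t \<noteq> V t"
    then have "\<exists>t\<in>{1..k}. sum \<kappa> (V t) < sum \<kappa> (U t)" using t less by blast
    then have "(\<Sum>t\<in>{1..k}. sum \<kappa> (V t)) < (\<Sum>t\<in>{1..k}. sum \<kappa> (U t))"
      using le by (intro sum_strict_mono_ex1) blast+
    then show False using * eq by simp
  qed
  have "x s \<le> Suc s" using UV[OF xs[OF s]] s by (auto simp: U_def V_def)
  moreover have "Suc s \<le> x s" using UV[of "Suc s"] s by (auto simp: U_def V_def)
  ultimately show "x s = Suc s" by simp
qed

section \<open>Coefficients of products of determinants\<close>

context column_shape
begin

definition zz :: "int \<Rightarrow> int \<Rightarrow> cpoly" where
  "zz a b = (if a \<le> \<bar>b\<bar> then zvar a b else 0)"

definition D_poly :: "word \<Rightarrow> cpoly" where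
  "D_poly w = column_minors zz w"

definition column_perms :: "(nat \<Rightarrow> nat \<Rightarrow> nat) set" where
  "column_perms = (\<Pi>\<^sub>E c\<in>{..<m}. {\<pi>. \<pi> permutes {0..<h c}})"

text \<open>The row indices chosen by one term of the expansion, read as a word. These are the words
  on which \<open>hw_tensor\<close> is nonzero.\<close>

definition perm_word :: "(nat \<Rightarrow> nat \<Rightarrow> nat) \<Rightarrow> word" where
  "perm_word g = restrict (\<lambda>(c, s). int (g c s) + 1) Pos"

lemma perm_word_Words:
  assumes "g \<in> column_perms"
  shows "perm_word g \<in> Words"
  unfolding Words_def perm_word_def
proof (rule restrict_PiE_iff[THEN iffD2], rule ballI)
  fix p assume "p \<in> Pos"
  then obtain c s where p: "p = (c, s)" "c < m" "s < h c" by (cases p) (auto simp: Pos_iff)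
  then have "g c permutes {0..<h c}" using assms by (auto simp: column_perms_def)
  then have "g c s < h c" using p permutes_in_image[of "g c" "{0..<h c}" s] by simp
  then show "(case p of (c, s) \<Rightarrow> int (g c s) + 1) \<in> Nset n"
    using p h_le[of c] by (simp add: Nset_iff)
qed

lemma column_minors_expand:
  "column_minors \<phi> w = (\<Sum>g\<in>column_perms. of_int (\<Prod>c<m. sign (g c)) * (\<Prod>p\<in>Pos. \<phi> (perm_word g p) (w
      p)))"
proof -
  have "column_minors \<phi> w = (\<Prod>c<m. \<Sum>\<pi> | \<pi> permutes {0..<h c}.
      of_int (sign \<pi>) * (\<Prod>s<h c. \<phi> (int (\<pi> s) + 1) (w (c, s))))"
    unfolding column_minors_def
  proof (rule prod.cong[OF refl])
    fix c
    have "det (mat (h c) (h c) (\<lambda>(r, s). \<phi> (int r + 1) (w (c, s))))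
        = (\<Sum>\<pi> | \<pi> permutes {0..<h c}. of_int (sign \<pi>) *
            (\<Prod>s<h c. mat (h c) (h c) (\<lambda>(r, s). \<phi> (int r + 1) (w (c, s))) $$ (\<pi> s, s)))"
      by (rule det_col) simp
    also have "\<dots> = (\<Sum>\<pi> | \<pi> permutes {0..<h c}. of_int (sign \<pi>) * (\<Prod>s<h c. \<phi> (int (\<pi> s) + 1) (w (c,
        s))))"
    proof (rule sum.cong[OF refl])
      fix \<pi> assume "\<pi> \<in> {\<pi>. \<pi> permutes {0..<h c}}"
      then have "\<pi> s < h c" if "s < h c" for s using that permutes_in_image[of \<pi> "{0..<h c}" s] by
          simp
      then show "of_int (sign \<pi>) * (\<Prod>s<h c. mat (h c) (h c) (\<lambda>(r, s). \<phi> (int r + 1) (w (c, s))) $$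
          (\<pi> s, s))
          = of_int (sign \<pi>) * (\<Prod>s<h c. \<phi> (int (\<pi> s) + 1) (w (c, s)))"
        by simp
    qed
    finally show "det (mat (h c) (h c) (\<lambda>(r, s). \<phi> (int r + 1) (w (c, s))))
        = (\<Sum>\<pi> | \<pi> permutes {0..<h c}. of_int (sign \<pi>) * (\<Prod>s<h c. \<phi> (int (\<pi> s) + 1) (w (c, s))))" .
  qed
  also have "\<dots> = (\<Sum>g\<in>column_perms. \<Prod>c<m. of_int (sign (g c)) * (\<Prod>s<h c. \<phi> (int (g c s) + 1) (w (c,
      s))))"
    unfolding column_perms_def by (rule prod_sum_PiE) (auto intro: finite_permutations)
  also have "\<dots> = (\<Sum>g\<in>column_perms. of_int (\<Prod>c<m. sign (g c)) * (\<Prod>p\<in>Pos. \<phi> (perm_word g p) (w p)))"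
  proof (rule sum.cong[OF refl])
    fix g
    have "(\<Prod>c<m. \<Prod>s<h c. \<phi> (int (g c s) + 1) (w (c, s))) = (\<Prod>p\<in>Pos. \<phi> (perm_word g p) (w p))"
      unfolding Pos_def by (subst prod.Sigma) (auto simp: perm_word_def Pos_def intro!: prod.cong)
    then show "(\<Prod>c<m. of_int (sign (g c)) * (\<Prod>s<h c. \<phi> (int (g c s) + 1) (w (c, s))))
        = of_int (\<Prod>c<m. sign (g c)) * (\<Prod>p\<in>Pos. \<phi> (perm_word g p) (w p))"
      by (simp add: prod.distrib)
  qed
  finally show ?thesis .
qed

text \<open>The signs of the determinant expansion are the values of \<open>hw_tensor\<close>. This
  brings the coefficients of D_w into the shape that those of f^d t already have, sums over words u
  weighted by \<open>hw_tensor u\<close>.\<close>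

lemma hw_tensor_sum:
  "(\<Sum>u\<in>Words. hw_tensor u * X u) = (\<Sum>g\<in>column_perms. of_int (\<Prod>c<m. sign (g c)) * X (perm_word g))"
proof -
  have "hw_tensor u = (\<Sum>g\<in>column_perms. of_int (\<Prod>c<m. sign (g c)) * (if u = perm_word g then 1
      else 0))"
    if u: "u \<in> Words" for u
  proof -
    have "(\<Prod>p\<in>Pos. of_bool (perm_word g p = u p)) = (if u = perm_word g then 1 else 0 :: complex)"
      if "g \<in> column_perms" for g
    proof (cases "u = perm_word g")
      case False
      then have "\<exists>p\<in>Pos. u p \<noteq> perm_word g p"
        using u perm_word_Words[OF that] unfolding Words_def by (metis PiE_ext)
      then show ?thesis using False by (auto intro!: prod_zero)
    qed simp
    then show ?thesis using u by (simp add: hw_tensor_def column_minors_expand)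
  qed
  then have "(\<Sum>u\<in>Words. hw_tensor u * X u)
      = (\<Sum>u\<in>Words. \<Sum>g\<in>column_perms. of_int (\<Prod>c<m. sign (g c)) * (if u = perm_word g then X u else
          0))"
    by (intro sum.cong refl) (simp add: sum_distrib_right, intro sum.cong refl, simp)
  also have "\<dots> = (\<Sum>g\<in>column_perms. \<Sum>u\<in>Words. of_int (\<Prod>c<m. sign (g c)) * (if u = perm_word g then
      X u else 0))"
    by (rule sum.swap)
  also have "\<dots> = (\<Sum>g\<in>column_perms. of_int (\<Prod>c<m. sign (g c)) * X (perm_word g))"
    by (intro sum.cong refl) (simp add: perm_word_Words flip: sum_distrib_left)
  finally show ?thesis .
qed

definition path_mono :: "word \<Rightarrow> word \<Rightarrow> mono" where
  "path_mono u w = (\<Sum>p\<in>Pos. var_exp (u p, w p))"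

lemma lookup_path_mono: "Poly_Mapping.lookup (path_mono u w) ij = card {p\<in>Pos. (u p, w p) = ij}"
proof -
  have "Poly_Mapping.lookup (path_mono u w) ij = (\<Sum>p\<in>Pos. if (u p, w p) = ij then 1 else 0)"
    unfolding path_mono_def lookup_sum by (intro sum.cong refl) (simp add: var_exp_def
        lookup_single when_def)
  also have "\<dots> = (\<Sum>p\<in>{p\<in>Pos. (u p, w p) = ij}. 1)"
    by (rule sum.mono_neutral_cong_right) auto
  finally show ?thesis by simp
qed

lemma lookup_prod_zz:
  "Poly_Mapping.lookup (\<Prod>p\<in>Pos. zz (u p) (w p)) e = of_bool ((\<forall>p\<in>Pos. u p \<le> \<bar>w p\<bar>) \<and> path_mono u w
      = e)"
proof (cases "\<forall>p\<in>Pos. u p \<le> \<bar>w p\<bar>")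
  case True
  then have "(\<Prod>p\<in>Pos. zz (u p) (w p)) = (\<Prod>p\<in>Pos. monomial (var_exp (u p, w p)))"
    by (intro prod.cong refl) (simp add: zz_def zvar_def)
  then show ?thesis using True by (simp add: lookup_monomial path_mono_def flip: monomial_sum)
next
  case False
  then have "(\<Prod>p\<in>Pos. zz (u p) (w p)) = 0" by (intro prod_zero) (auto simp: zz_def)
  then show ?thesis using False by auto
qed

lemma lookup_D_poly:
  "Poly_Mapping.lookup (D_poly w) e
    = (\<Sum>u\<in>Words. hw_tensor u * of_bool ((\<forall>p\<in>Pos. u p \<le> \<bar>w p\<bar>) \<and> path_mono u w = e))"
  unfolding hw_tensor_sum D_poly_def column_minors_expand lookup_sum
  by (intro sum.cong refl) (simp only: lookup_of_int_mult lookup_prod_zz)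

text \<open>\<open>shape_weight\<close> counts every column when i \<le> 0, whereas a weight has to
  vanish outside 1, ..., n.\<close>

definition total_weight :: weight where
  "total_weight i = (if i \<in> {1..int n} then shape_weight i else 0)"

lemma grad_outside: "i \<notin> {1..int n} \<Longrightarrow> grad n d i = 0"
  unfolding grad_def by (intro sum.neutral) (auto simp: Pset_def eps_def)

lemma hw_tensor_count:
  assumes "hw_tensor u \<noteq> 0" "1 \<le> i"
  shows "int (card {p\<in>Pos. u p = i}) = shape_weight i"
proof -
  have "int (card {p\<in>Pos. u p = i}) = (\<Sum>p\<in>Pos. if u p = i then 1 else 0)"
    by (simp add: sum.If_cases Collect_conj_eq)
  also have "\<dots> = (\<Sum>c<m. \<Sum>s<h c. if u (c, s) = i then 1 else 0)"
    unfolding Pos_def by (subst sum.Sigma) (auto simp: case_prod_beta)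
  also have "\<dots> = (\<Sum>c<m. if i \<le> int (h c) then 1 else 0)"
  proof (rule sum.cong[OF refl])
    fix c assume "c \<in> {..<m}"
    then have "bij_betw (\<lambda>s. u (c, s)) {..<h c} {1..int (h c)}"
      using hw_tensor_letters[OF assms(1), of c] by (simp add: bij_betw_def)
    then have "(\<Sum>s<h c. if u (c, s) = i then 1 else 0 :: int) = (\<Sum>j\<in>{1..int (h c)}. if j = i then
        1 else 0)"
      by (rule sum.reindex_bij_betw)
    then show "(\<Sum>s<h c. if u (c, s) = i then 1 else 0 :: int) = (if i \<le> int (h c) then 1 else 0)"
      using assms(2) by simp
  qed
  also have "\<dots> = shape_weight i"
    by (simp add: shape_weight_def sum.If_cases Collect_conj_eq lessThan_def)
  finally show ?thesis .
qed

context
  fixes u w :: word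
  assumes u: "u \<in> Words" "hw_tensor u \<noteq> 0" and w: "w \<in> Words" and above: "\<forall>p\<in>Pos. u p \<le> \<bar>w p\<bar>"
begin

lemma path_in_Pset: "p \<in> Pos \<Longrightarrow> (u p, w p) \<in> Pset n"
  using hw_tensor_letter[OF u(2), of "fst p" "snd p"] u(1) w above Words_mem[OF u(1), of p]
      Words_mem[OF w, of p]
  by (auto simp: Pset_def Nset_iff)

lemma path_mono_monomials: "path_mono u w \<in> monomials n"
  unfolding monomials_def
proof (clarify)
  fix a b assume "(a, b) \<in> Poly_Mapping.keys (path_mono u w)"
  then have "card {p\<in>Pos. (u p, w p) = (a, b)} \<noteq> 0" by (simp add: in_keys_iff lookup_path_mono)
  then have "{p\<in>Pos. (u p, w p) = (a, b)} \<noteq> {}" by (metis card.empty)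
  then obtain p where "p \<in> Pos" "(u p, w p) = (a, b)" by blast
  then show "(a, b) \<in> Pset n" using path_in_Pset by metis
qed

lemma path_mono_grad: "grad n (path_mono u w) = total_weight"
proof
  fix i
  show "grad n (path_mono u w) i = total_weight i"
  proof (cases "i \<in> {1..int n}")
    case True
    have "grad n (path_mono u w) i = (\<Sum>ij\<in>Pset n. int (card {p\<in>Pos. (u p, w p) = ij}) * eps (fst
        ij) i)"
      by (simp only: grad_def lookup_path_mono split_beta' prod.collapse)
    also have "\<dots> = (\<Sum>p\<in>Pos. eps (u p) i)"
      using sum_counting[of Pos "Pset n" "\<lambda>p. (u p, w p)" "\<lambda>ij. eps (fst ij) i"] path_in_Pset by
          simp
    also have "\<dots> = int (card {p\<in>Pos. u p = i})"
      by (simp add: eps_def sum.If_cases Collect_conj_eq eq_commute)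
    also have "\<dots> = total_weight i" using True u by (simp add: hw_tensor_count total_weight_def)
    finally show ?thesis .
  next
    case False
    then show ?thesis using grad_outside[OF False] by (simp only: total_weight_def if_False)
  qed
qed

lemma path_mono_degree: "base_sum + mono_degree n (path_mono u w) = letter_sum w"
proof -
  have "mono_degree n (path_mono u w) = (\<Sum>p\<in>Pos. root_degree (u p, w p))"
    unfolding mono_degree_def lookup_path_mono using path_in_Pset by (intro sum_counting) auto
  also have "\<dots> = letter_sum w - (\<Sum>p\<in>Pos. u p)"
    by (simp add: root_degree_def letter_sum_def sum_subtractf)
  also have "(\<Sum>p\<in>Pos. u p) = letter_sum u"
    unfolding letter_sum_def using hw_tensor_letter(1)[OF u(2)]
    by (intro sum.cong refl) (metis abs_of_pos surj_pair)
  also have "letter_sum u = base_sum" by (rule hw_tensor_letter_sum[OF u])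
  finally show ?thesis by simp
qed

end

lemma D_poly_keysE:
  assumes "e \<in> Poly_Mapping.keys (D_poly w)"
  obtains u where "u \<in> Words" "hw_tensor u \<noteq> 0" "\<forall>p\<in>Pos. u p \<le> \<bar>w p\<bar>" "path_mono u w = e"
proof -
  have "(\<Sum>u\<in>Words. hw_tensor u * of_bool ((\<forall>p\<in>Pos. u p \<le> \<bar>w p\<bar>) \<and> path_mono u w = e)) \<noteq> 0"
    using assms by (simp only: in_keys_iff lookup_D_poly not_False_eq_True)
  then obtain u where "u \<in> Words" "hw_tensor u * of_bool ((\<forall>p\<in>Pos. u p \<le> \<bar>w p\<bar>) \<and> path_mono u w =
      e) \<noteq> 0"
    by (rule sum.not_neutral_contains_not_neutral)
  then show ?thesis using that[of u] by (auto split: if_splits)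
qed

lemma D_poly_keys:
  assumes "w \<in> Words" "e \<in> Poly_Mapping.keys (D_poly w)"
  shows "e \<in> monomials n" "grad n e = total_weight" "base_sum + mono_degree n e = letter_sum w"
  using D_poly_keysE[OF assms(2)] path_mono_monomials path_mono_grad path_mono_degree assms(1) by
      metis+

text \<open>A transition determines only the off-diagonal exponents, since f^d ignores the d_{i,i}.
  The grading supplies the rest: the exponent of z_{a,a} is what the off-diagonal variables of row a
  leave of the a-th coordinate of the weight.\<close>

lemma transition_iff:
  assumes u: "u \<in> Words" "hw_tensor u \<noteq> 0" and w: "w \<in> Words"
    and e: "e \<in> monomials n" "grad n e = total_weight"
  shows "transition (root_list n) (Poly_Mapping.lookup e) u w
    \<longleftrightarrow> (\<forall>p\<in>Pos. u p \<le> \<bar>w p\<bar>) \<and> path_mono u w = e"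
proof
  assume t: "transition (root_list n) (Poly_Mapping.lookup e) u w"
  have above: "\<forall>p\<in>Pos. u p \<le> \<bar>w p\<bar>"
  proof
    fix p assume "p \<in> Pos"
    then have "u p = w p \<or> (u p, w p) \<in> Pset n"
      using t by (auto simp: transition_def set_root_list)
    then show "u p \<le> \<bar>w p\<bar>" by (auto simp: Pset_def)
  qed
  have off: "Poly_Mapping.lookup (path_mono u w) (a, b) = Poly_Mapping.lookup e (a, b)" if "a \<noteq> b"
      for a b
  proof (cases "(a, b) \<in> Pset n")
    case True
    then have "(a, b) \<in> set (root_list n)" using that by (auto simp: set_root_list Aset_def)
    then show ?thesis using t unfolding lookup_path_mono transition_def by blast
  next
    case False
    then show ?thesis using e(1) path_mono_monomials[OF u w above]
      unfolding monomials_def mem_Collect_eq by (metis not_in_keys_iff_lookup_eq_zero subsetD)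
  qed
  have "Poly_Mapping.lookup (path_mono u w) (a, a) = Poly_Mapping.lookup e (a, a)" for a
  proof (cases "(a, a) \<in> Pset n")
    case True
    have sum: "grad n d a = int (Poly_Mapping.lookup d (a, a))
        + (\<Sum>ij\<in>Pset n - {(a, a)}. int (Poly_Mapping.lookup d ij) * eps (fst ij) a)" for d
      using True by (simp add: grad_def case_prod_beta sum.remove[of "Pset n" "(a, a)"] eps_def)
    have "(\<Sum>ij\<in>Pset n - {(a, a)}. int (Poly_Mapping.lookup (path_mono u w) ij) * eps (fst ij) a)
        = (\<Sum>ij\<in>Pset n - {(a, a)}. int (Poly_Mapping.lookup e ij) * eps (fst ij) a)"
    proof (rule sum.cong[OF refl])
      fix ij assume "ij \<in> Pset n - {(a, a)}"
      then show "int (Poly_Mapping.lookup (path_mono u w) ij) * eps (fst ij) a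
          = int (Poly_Mapping.lookup e ij) * eps (fst ij) a"
        using off[of "fst ij" "snd ij"] by (cases ij) (auto simp: eps_def)
    qed
    moreover have "grad n (path_mono u w) a = grad n e a"
      unfolding path_mono_grad[OF u w above] e(2) ..
    ultimately show ?thesis unfolding sum by simp
  next
    case False
    then show ?thesis using e(1) path_mono_monomials[OF u w above]
      unfolding monomials_def mem_Collect_eq by (metis not_in_keys_iff_lookup_eq_zero subsetD)
  qed
  with off have "Poly_Mapping.lookup (path_mono u w) ij = Poly_Mapping.lookup e ij" for ij
    by (cases ij) (metis)
  then show "(\<forall>p\<in>Pos. u p \<le> \<bar>w p\<bar>) \<and> path_mono u w = e"
    using above by (simp add: poly_mapping_eqI)
next
  assume r: "(\<forall>p\<in>Pos. u p \<le> \<bar>w p\<bar>) \<and> path_mono u w = e"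
  then have "(u p, w p) \<in> Pset n" if "p \<in> Pos" for p
    using path_in_Pset[OF u w _ that] by blast
  then have "u p = w p \<or> (u p, w p) \<in> set (root_list n)" if "p \<in> Pos" for p
    using that by (auto simp: set_root_list Aset_def)
  then show "transition (root_list n) (Poly_Mapping.lookup e) u w"
    using r by (auto simp: transition_def lookup_path_mono)
qed

text \<open>At the critical letter sum both sides are sums over the same words u. Above it both
  vanish, the right side because D_w is homogeneous of degree
  \<open>letter_sum w - base_sum\<close>.\<close>

lemma f_power_D_poly:
  assumes w: "w \<in> Words" and e: "e \<in> monomials n" "grad n e = total_weight"
    and le: "base_sum + mono_degree n e \<le> letter_sum w"
  shows "f_power n act e hw_tensor w = f_multiplier e * Poly_Mapping.lookup (D_poly w) e"
proof (cases "letter_sum w = base_sum + mono_degree n e")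
  case True
  have "(\<Sum>u\<in>Words. hw_tensor u * of_bool (transition (root_list n) (Poly_Mapping.lookup e) u w))
      = Poly_Mapping.lookup (D_poly w) e"
    unfolding lookup_D_poly
  proof (rule sum.cong[OF refl])
    fix u assume "u \<in> Words"
    then show "hw_tensor u * of_bool (transition (root_list n) (Poly_Mapping.lookup e) u w)
        = hw_tensor u * of_bool ((\<forall>p\<in>Pos. u p \<le> \<bar>w p\<bar>) \<and> path_mono u w = e)"
      using transition_iff[OF _ _ w e, of u] by (cases "hw_tensor u = 0") simp_all
  qed
  then show ?thesis using f_power_leading_eq[OF w True] by simp
next
  case False
  then have "e \<notin> Poly_Mapping.keys (D_poly w)" using D_poly_keys(3)[OF w, of e] by auto
  then show ?thesis using f_power_beyond[OF w, of e] False le by (simp add: in_keys_iff)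
qed

end


section \<open>King tableaux and the algebra of determinants\<close>

context column_shape
begin

definition row_word :: word where
  "row_word = restrict (\<lambda>(c, s). int s + 1) Pos"

lemma row_word_apply: "p \<in> Pos \<Longrightarrow> row_word p = int (snd p) + 1"
  by (simp add: row_word_def case_prod_beta)

lemma row_word_Words: "row_word \<in> Words"
  unfolding Words_def
proof (rule PiE_I)
  fix p
  show "row_word p \<in> Nset n" if "p \<in> Pos"
    using that h_le[of "fst p"] by (cases p) (simp add: row_word_apply Pos_iff Nset_iff)
qed (simp add: row_word_def)

lemma hw_tensor_row_word: "hw_tensor row_word = 1"
proof -
  have "mat (h c) (h c) (\<lambda>(r, s). of_bool (int r + 1 = row_word (c, s))) = (1\<^sub>m (h c) :: complex
      mat)"
    if "c < m" for c
    using that by (intro eq_matI) (auto simp: row_word_def Pos_iff)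
  then show ?thesis using row_word_Words by (simp add: hw_tensor_def column_minors_def)
qed

text \<open>The variable z_{a,b} gets the weight a times the position of b in King's order. By the
  rearrangement inequality the diagonal term of D_w is the unique term of largest weight when w is a
  King tableau.\<close>

definition king_weight :: "word \<Rightarrow> word \<Rightarrow> nat" where
  "king_weight u w = (\<Sum>p\<in>Pos. nat (u p) * kappa (w p))"

lemma king_weight_columns: "king_weight u w = (\<Sum>c<m. \<Sum>s<h c. nat (u (c, s)) * kappa (w (c, s)))"
  unfolding king_weight_def Pos_def by (subst sum.Sigma) (auto simp: case_prod_beta)

lemma king_weight_row_word: "king_weight row_word w = (\<Sum>c<m. \<Sum>s<h c. Suc s * kappa (w (c, s)))"
  unfolding king_weight_columns
proof (intro sum.cong refl)
  fix c s assume "c \<in> {..<m}" "s \<in> {..<h c}"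
  then have "row_word (c, s) = int s + 1" by (simp add: row_word_apply Pos_iff)
  then have "nat (row_word (c, s)) = Suc s" by simp
  then show "nat (row_word (c, s)) * kappa (w (c, s)) = Suc s * kappa (w (c, s))" by (simp only:)
qed

lemma hw_tensor_column_bij:
  assumes "hw_tensor u \<noteq> 0" "c < m"
  shows "bij_betw (\<lambda>s. nat (u (c, s))) {..<h c} {1..h c}"
proof -
  have "bij_betw (\<lambda>s. u (c, s)) {..<h c} {1..int (h c)}"
    using hw_tensor_letters[OF assms] by (simp add: bij_betw_def)
  moreover have "bij_betw nat {1..int (h c)} {1..h c}"
    by (rule bij_betw_byWitness[where f' = int]) auto
  ultimately show ?thesis using bij_betw_trans by (fastforce simp: comp_def)
qed

lemma king_weight_le:
  assumes u: "u \<in> Words" "hw_tensor u \<noteq> 0" and w: "king w"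
  shows "king_weight u w \<le> king_weight row_word w"
    and "king_weight u w = king_weight row_word w \<Longrightarrow> u = row_word"
proof -
  have strict: "kappa (w (c, r)) < kappa (w (c, s))" if "c < m" "r < s" "s < h c" for c r s
    using w that by (simp add: king_def Pos_iff)
  have le: "(\<Sum>s<h c. nat (u (c, s)) * kappa (w (c, s))) \<le> (\<Sum>s<h c. Suc s * kappa (w (c, s)))"
    if "c < m" for c
    by (rule rearrangement(1)[OF hw_tensor_column_bij[OF u(2) that] strict[OF that]])
  then show "king_weight u w \<le> king_weight row_word w"
    unfolding king_weight_row_word king_weight_columns[of u] by (intro sum_mono[where K =
        "{..<m}"] le) simp
  assume eq: "king_weight u w = king_weight row_word w"
  have col: "(\<Sum>s<h c. nat (u (c, s)) * kappa (w (c, s))) = (\<Sum>s<h c. Suc s * kappa (w (c, s)))"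
    if c: "c < m" for c
  proof (rule ccontr)
    assume "(\<Sum>s<h c. nat (u (c, s)) * kappa (w (c, s))) \<noteq> (\<Sum>s<h c. Suc s * kappa (w (c, s)))"
    then have "(\<Sum>s<h c. nat (u (c, s)) * kappa (w (c, s))) < (\<Sum>s<h c. Suc s * kappa (w (c, s)))"
      using le[OF c] by (rule le_neq_implies_less[rotated])
    then have "\<exists>c\<in>{..<m}. (\<Sum>s<h c. nat (u (c, s)) * kappa (w (c, s))) < (\<Sum>s<h c. Suc s * kappa (w
        (c, s)))"
      using c by blast
    then have "king_weight u w < king_weight row_word w"
      unfolding king_weight_row_word king_weight_columns[of u]
      using le by (intro sum_strict_mono_ex1) blast+
    then show False using eq by simp
  qed
  have "u p = row_word p" if p: "p \<in> Pos" for p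
  proof -
    have c: "fst p < m" "snd p < h (fst p)" using p by (auto simp: Pos_def)
    have "nat (u (fst p, snd p)) = Suc (snd p)"
      by (rule rearrangement(2)[OF hw_tensor_column_bij[OF u(2) c(1)] strict[OF c(1)] col[OF c(1)]
          c(2)])
    then show ?thesis using p by (simp add: row_word_apply)
  qed
  then show "u = row_word" using u(1) row_word_Words unfolding Words_def by (metis PiE_ext)
qed

text \<open>The weight depends on the monomial alone, so it can be compared between terms of
  different D_w that share a monomial.\<close>

lemma int_king_weight:
  assumes u: "u \<in> Words" "hw_tensor u \<noteq> 0" and w: "w \<in> Words" and above: "\<forall>p\<in>Pos. u p \<le> \<bar>w p\<bar>"
  shows "int (king_weight u w)
    = (\<Sum>ij\<in>Pset n. int (Poly_Mapping.lookup (path_mono u w) ij) * (fst ij * int (kappa (snd ij))))"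
proof -
  have "(\<Sum>ij\<in>Pset n. int (Poly_Mapping.lookup (path_mono u w) ij) * (fst ij * int (kappa (snd ij))))
      = (\<Sum>p\<in>Pos. u p * int (kappa (w p)))"
    unfolding lookup_path_mono
    using sum_counting[of Pos "Pset n" "\<lambda>p. (u p, w p)" "\<lambda>ij. fst ij * int (kappa (snd ij))"]
      path_in_Pset[OF u w above] by simp
  also have "\<dots> = int (king_weight u w)"
    unfolding king_weight_def of_nat_sum
  proof (rule sum.cong[OF refl])
    fix p assume "p \<in> Pos"
    then have "0 < u p" using hw_tensor_letter(1)[OF u(2), of "fst p" "snd p"] by simp
    then show "u p * int (kappa (w p)) = int (nat (u p) * kappa (w p))" by simp
  qed
  finally show ?thesis by simp
qed

lemma king_above: "king w \<Longrightarrow> \<forall>p\<in>Pos. row_word p \<le> \<bar>w p\<bar>"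
  by (auto simp: king_def row_word_apply) (metis add1_zle_eq surj_pair snd_conv)

text \<open>Each row of a King tableau is weakly increasing, so it is determined by its content.\<close>

lemma king_path_mono_inj:
  assumes w: "king w" and v: "king v" and eq: "path_mono row_word w = path_mono row_word v"
  shows "w = v"
proof -
  have "w (c, r) = v (c, r)" if cr: "(c, r) \<in> Pos" for c r
  proof -
    \<comment> \<open>The length of row r: columns get weakly shorter to the right, so exactly the
      columns before \<open>k\<close> reach this row.\<close>
    define k where "k = (LEAST k. k = m \<or> \<not> r < h k)"
    have k: "k = m \<or> \<not> r < h k" unfolding k_def by (rule LeastI[of _ m]) simp
    have k_min: "c \<noteq> m \<and> r < h c" if "c < k" for c
      using that not_less_Least[of c "\<lambda>k. k = m \<or> \<not> r < h k"] unfolding k_def by blast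
    have "k \<le> m" unfolding k_def by (rule Least_le) simp
    have iff: "(d, r) \<in> Pos \<longleftrightarrow> d < k" for d
    proof
      assume d: "(d, r) \<in> Pos"
      show "d < k"
      proof (rule ccontr)
        assume "\<not> d < k"
        then have "h d \<le> h k" "k < m" using h_antimono[of k d] d by (auto simp: Pos_iff)
        then show False using k d by (auto simp: Pos_iff)
      qed
    next
      assume "d < k"
      then show "(d, r) \<in> Pos" using k_min[of d] \<open>k \<le> m\<close> by (auto simp: Pos_iff)
    qed
    define row where "row x = map (\<lambda>c. x (c, r)) [0..<k]" for x :: word
    have row_count: "count (mset (row x)) b = card {p\<in>Pos. (row_word p, x p) = (int r + 1, b)}"
        for x b
    proof -
      have "count (mset (row x)) b = card {c. c < k \<and> x (c, r) = b}"
      proof -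
        have "count (mset (row x)) b = length (filter ((=) b) (row x))" by (simp add: count_mset
            count_list_eq_length_filter)
        also have "\<dots> = card {i. i < length (row x) \<and> b = row x ! i}" by (rule
            length_filter_conv_card)
        also have "{i. i < length (row x) \<and> b = row x ! i} = {c. c < k \<and> x (c, r) = b}"
          by (auto simp: row_def)
        finally show ?thesis .
      qed
      also have "\<dots> = card ((\<lambda>c. (c, r)) ` {c. c < k \<and> x (c, r) = b})"
        by (rule card_image[symmetric]) (simp add: inj_on_def)
      also have "(\<lambda>c. (c, r)) ` {c. c < k \<and> x (c, r) = b} = {p\<in>Pos. (row_word p, x p) = (int r +
          1, b)}"
      proof (intro equalityI subsetI)
        fix p assume "p \<in> (\<lambda>c. (c, r)) ` {c. c < k \<and> x (c, r) = b}"
        then obtain d where "p = (d, r)" "d < k" "x (d, r) = b" by blast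
        then show "p \<in> {p\<in>Pos. (row_word p, x p) = (int r + 1, b)}"
          using iff[of d] by (simp add: row_word_apply)
      next
        fix p assume p: "p \<in> {p\<in>Pos. (row_word p, x p) = (int r + 1, b)}"
        then have "snd p = r" using row_word_apply[of p] by simp
        then obtain d where d: "p = (d, r)" by (metis prod.collapse)
        then have "d < k" "x (d, r) = b" using p iff[of d] by auto
        then show "p \<in> (\<lambda>c. (c, r)) ` {c. c < k \<and> x (c, r) = b}"
          unfolding d by blast
      qed
      finally show ?thesis .
    qed
    have "mset (row w) = mset (row v)"
    proof (rule multiset_eqI)
      fix b
      show "count (mset (row w)) b = count (mset (row v)) b"
        unfolding row_count lookup_path_mono[symmetric] eq ..
    qed
    then have ms: "mset (map kappa (row w)) = mset (map kappa (row v))" by simp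
    have sorted: "sorted (map kappa (row x))" if "king x" for x
      using that iff by (auto simp: sorted_iff_nth_Suc row_def king_def)
    have "map kappa (row w) = map kappa (row v)"
      using properties_for_sort[OF ms sorted[OF w]] sorted_sort_id[OF sorted[OF v]] by simp
    moreover have "c < k" using cr iff by simp
    ultimately have "kappa (row w ! c) = kappa (row v ! c)"
      by (metis length_map length_upt minus_nat.diff_0 nth_map row_def)
    then show ?thesis using \<open>c < k\<close> by (simp add: row_def kappa_eq_iff)
  qed
  moreover have "w \<in> Words" "v \<in> Words" using w v by (auto simp: king_def)
  ultimately show ?thesis unfolding Words_def by (intro PiE_ext) auto
qed

lemma lookup_D_poly_diagonal:
  assumes w: "king w"
  shows "Poly_Mapping.lookup (D_poly w) (path_mono row_word w) = 1"
proof -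
  have W: "w \<in> Words" using w by (simp add: king_def)
  have "(\<Sum>u\<in>Words. hw_tensor u * of_bool ((\<forall>p\<in>Pos. u p \<le> \<bar>w p\<bar>) \<and> path_mono u w = path_mono
      row_word w))
      = (\<Sum>u\<in>Words. if u = row_word then 1 else 0)"
  proof (rule sum.cong[OF refl])
    fix u assume u: "u \<in> Words"
    show "hw_tensor u * of_bool ((\<forall>p\<in>Pos. u p \<le> \<bar>w p\<bar>) \<and> path_mono u w = path_mono row_word w)
        = (if u = row_word then 1 else 0)"
    proof (cases "u = row_word")
      case True
      then show ?thesis using king_above[OF w] by (simp add: hw_tensor_row_word)
    next
      case False
      have "\<not> (hw_tensor u \<noteq> 0 \<and> (\<forall>p\<in>Pos. u p \<le> \<bar>w p\<bar>) \<and> path_mono u w = path_mono row_word w)"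
      proof
        assume *: "hw_tensor u \<noteq> 0 \<and> (\<forall>p\<in>Pos. u p \<le> \<bar>w p\<bar>) \<and> path_mono u w = path_mono row_word w"
        have "hw_tensor row_word \<noteq> 0" by (simp add: hw_tensor_row_word)
        then have "int (king_weight u w) = int (king_weight row_word w)"
          using * int_king_weight[OF u _ W] int_king_weight[OF row_word_Words _ W king_above[OF
              w]] by simp
        then show False using king_weight_le(2)[OF u _ w] * False by simp
      qed
      then show ?thesis using False by auto
    qed
  qed
  then show ?thesis by (simp only: lookup_D_poly) (simp add: row_word_Words)
qed

text \<open>Non-diagonal terms of D_w have smaller weight, and a diagonal monomial determines its
  King tableau. With \<open>lookup_D_poly_diagonal\<close> this makes the coefficients of diagonal
  monomials unitriangular with respect to the weight.\<close>

lemma lookup_D_poly_off_diagonal: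
  assumes w: "king w" and v: "king v"
    and nz: "Poly_Mapping.lookup (D_poly w) (path_mono row_word v) \<noteq> 0"
  shows "w = v \<or> king_weight row_word v < king_weight row_word w"
proof -
  have W: "w \<in> Words" "v \<in> Words" using w v by (auto simp: king_def)
  have row: "hw_tensor row_word \<noteq> 0" by (simp add: hw_tensor_row_word)
  obtain u where u: "u \<in> Words" "hw_tensor u \<noteq> 0" "\<forall>p\<in>Pos. u p \<le> \<bar>w p\<bar>"
    "path_mono u w = path_mono row_word v"
    by (rule D_poly_keysE[of "path_mono row_word v" w]) (simp add: in_keys_iff nz)
  have "int (king_weight u w) = int (king_weight row_word v)"
    using int_king_weight[OF u(1,2) W(1) u(3)] int_king_weight[OF row_word_Words row W(2)
        king_above[OF v]] u(4)
    by simp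
  then have eq: "king_weight u w = king_weight row_word v" by simp
  show ?thesis
  proof (cases "king_weight u w = king_weight row_word w")
    case True
    then have "u = row_word" by (rule king_weight_le(2)[OF u(1,2) w])
    then show ?thesis using king_path_mono_inj[OF w v] u(4) by simp
  next
    case False
    then show ?thesis using king_weight_le(1)[OF u(1,2) w] eq by simp
  qed
qed

text \<open>Take a tableau v of largest weight in F: its diagonal monomial occurs in no other D_w
  with w in F.\<close>

lemma king_D_poly_independent:
  assumes F: "finite F" "\<And>w. w \<in> F \<Longrightarrow> king w" "\<And>w. w \<in> F \<Longrightarrow> a w \<noteq> 0" "F \<noteq> {}"
  shows "(\<Sum>w\<in>F. poly_scale (a w) (D_poly w)) \<noteq> 0"
proof -
  obtain v where v: "v \<in> F" "\<And>w. w \<in> F \<Longrightarrow> king_weight row_word w \<le> king_weight row_word v"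
    using Max_in[of "king_weight row_word ` F"] Max_ge[of "king_weight row_word ` F"] F(1,4) by
        fastforce
  have "Poly_Mapping.lookup (\<Sum>w\<in>F. poly_scale (a w) (D_poly w)) (path_mono row_word v)
      = (\<Sum>w\<in>F. if w = v then a v else 0)"
    unfolding lookup_sum lookup_poly_scale
  proof (rule sum.cong[OF refl])
    fix w assume w: "w \<in> F"
    show "a w * Poly_Mapping.lookup (D_poly w) (path_mono row_word v) = (if w = v then a v else 0)"
    proof (cases "w = v")
      case True
      then show ?thesis using lookup_D_poly_diagonal[OF F(2)[OF v(1)]] by simp
    next
      case False
      then have "Poly_Mapping.lookup (D_poly w) (path_mono row_word v) = 0"
        using lookup_D_poly_off_diagonal[OF F(2)[OF w] F(2)[OF v(1)]] v(2)[OF w] by fastforce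
      then show ?thesis using False by simp
    qed
  qed
  also have "\<dots> = a v" using F(1) v(1) by simp
  finally show ?thesis using F(3)[OF v(1)] by auto
qed

end

section \<open>Determinants and products in the algebra R\<close>

lemma subalgebra_Ralg: "subalgebra (Ralg n)"
  unfolding Ralg_def algebra_generated_def hull_def subalgebra_def poly.subspace_def by auto

lemma Ddet_Ralg: "x \<in> Theta n \<Longrightarrow> Ddet x \<in> Ralg n"
  unfolding Ralg_def algebra_generated_def by (rule hull_inc) simp

lemma Ralg_prod: "(\<And>x. x \<in> A \<Longrightarrow> f x \<in> Ralg n) \<Longrightarrow> prod f A \<in> Ralg n"
  using subalgebra_Ralg[of n]
  by (induction A rule: infinite_finite_induct) (auto simp: subalgebra_def)

text \<open>Products of generators are closed under multiplication, so their span is a subalgebra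
  containing the generators.\<close>

lemma Ralg_span_products: "Ralg n \<subseteq> poly.span {\<Prod>x\<leftarrow>L. Ddet x | L. set L \<subseteq> Theta n}"
proof -
  let ?G = "{\<Prod>x\<leftarrow>L. Ddet x | L. set L \<subseteq> Theta n}"
  have gen: "(\<Prod>x\<leftarrow>L. Ddet x) \<in> ?G" if "set L \<subseteq> Theta n" for L using that by blast
  have mult_left: "g * q \<in> poly.span ?G" if g: "g \<in> ?G" and q: "q \<in> poly.span ?G" for g q
    using q
  proof (induction rule: poly.span_induct_alt)
    case (step c x y)
    obtain L L' where "g = (\<Prod>x\<leftarrow>L. Ddet x)" "x = (\<Prod>x\<leftarrow>L'. Ddet x)" "set L \<subseteq> Theta n" "set L' \<subseteq> Theta
        n"
      using g step(1) by blast
    then have "g * x \<in> poly.span ?G"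
      using gen[of "L @ L'"] by (intro poly.span_base) simp
    then have "poly_scale c (g * x) + g * y \<in> poly.span ?G"
      by (intro poly.span_add poly.span_scale step)
    moreover have "g * (poly_scale c x + y) = poly_scale c (g * x) + g * y"
      by (simp add: poly_scale_def algebra_simps)
    ultimately show ?case by simp
  qed (simp add: poly.span_zero)
  have mult: "p * q \<in> poly.span ?G" if p: "p \<in> poly.span ?G" and q: "q \<in> poly.span ?G" for p q
    using p
  proof (induction rule: poly.span_induct_alt)
    case (step c x y)
    have "poly_scale c (x * q) + y * q \<in> poly.span ?G"
      by (intro poly.span_add poly.span_scale step mult_left q)
    moreover have "(poly_scale c x + y) * q = poly_scale c (x * q) + y * q"
      by (simp add: poly_scale_def algebra_simps)
    ultimately show ?case by simp
  qed (simp add: poly.span_zero)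
  have "1 \<in> poly.span ?G" using gen[of "[]"] by (intro poly.span_base) simp
  then have "subalgebra (poly.span ?G)"
    using mult by (simp add: subalgebra_def poly.subspace_span)
  moreover have "Ddet ` Theta n \<subseteq> poly.span ?G"
  proof
    fix p assume "p \<in> Ddet ` Theta n"
    then obtain x where "p = Ddet x" "x \<in> Theta n" by blast
    then show "p \<in> poly.span ?G" using gen[of "[x]"] by (intro poly.span_base) simp
  qed
  ultimately show ?thesis
    unfolding Ralg_def algebra_generated_def by (intro hull_minimal)
qed

lemma Ddet_mset:
  assumes "mset x = mset y"
  shows "Ddet x = Ddet y \<or> Ddet x = - Ddet y"
proof -
  obtain \<pi> where \<pi>: "\<pi> permutes {..<length y}" "permute_list \<pi> y = x"
    using mset_eq_permutation[OF assms] by blast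
  let ?F = "\<lambda>y. \<lambda>(r, c). let a = int r + 1; b = y ! c in if \<bar>b\<bar> \<ge> a then zvar a b else 0"
  have len: "length x = length y" using \<pi>(2) by auto
  have \<pi>': "\<pi> permutes {0..<length y}" using \<pi>(1) by (simp add: lessThan_atLeast0)
  have nth: "x ! c = y ! \<pi> c" if "c < length y" for c
    using permute_list_nth[OF \<pi>(1) that] \<pi>(2) by simp
  have "mat (length x) (length x) (?F x)
      = mat (length y) (length y) (\<lambda>(i, j). mat (length y) (length y) (?F y) $$ (i, \<pi> j))"
    using len nth permutes_in_image[OF \<pi>'] by (intro eq_matI) (auto simp: Let_def)
  then have "Ddet x = of_int (sign \<pi>) * Ddet y"
    unfolding Ddet_def by (simp add: det_permute_cols[OF _ \<pi>'])
  then show ?thesis by (simp add: sign_def split: if_splits)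
qed

lemma prec_iff_N_index:
  "a \<in> Nset n \<Longrightarrow> b \<in> Nset n \<Longrightarrow> a \<lessdot> b \<longleftrightarrow> N_index n a < N_index n b"
  by (auto simp: prec_def N_index_def Nset_iff)

text \<open>Columns of tableaux are sorted in King's order, but the tuples in \<open>Theta\<close>
  along \<lessdot>. Admissibility is independent of the order, and rearranging the columns of a
  determinant only affects its sign.\<close>

lemma Ddet_admissible_Ralg:
  assumes x: "admissible n x" "length x \<in> {1..n}"
  shows "Ddet x \<in> Ralg n"
proof -
  define y where "y = sort_key (N_index n) x"
  have ms: "mset y = mset x" by (simp add: y_def)
  have set: "set y = set x" using ms by (rule mset_eq_setD)
  have dist: "distinct y" using x by (simp add: y_def admissible_def)
  have "inj_on (N_index n) (set y)"
    using x bij_betw_N_index[of n] unfolding set admissible_def bij_betw_def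
    by (meson inj_on_subset)
  then have "distinct (map (N_index n) y)" using dist by (simp add: distinct_map)
  moreover have "sorted (map (N_index n) y)" by (simp add: y_def)
  ultimately have "sorted_wrt (<) (map (N_index n) y)" by (simp add: strict_sorted_iff)
  then have "sorted_wrt (\<lambda>a b. N_index n a < N_index n b) y" by (simp add: sorted_wrt_map)
  moreover have "a \<in> Nset n" if "a \<in> set y" for a
    using that x set by (auto simp: admissible_def)
  ultimately have "sorted_wrt (\<lessdot>) y"
    by (elim sorted_wrt_mono_rel[rotated]) (simp add: prec_iff_N_index[where n = n])
  moreover have "length (filter P y) = length (filter P x)" for P
    using ms by (metis mset_filter size_mset)
  then have "admissible n y" using x set dist by (simp add: admissible_def)
  moreover have "length y = length x" by (simp add: y_def)
  ultimately have "y \<in> Theta n" using x by (simp add: Theta_def)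
  then have "Ddet y \<in> Ralg n" by (rule Ddet_Ralg)
  moreover have "- Ddet y = poly_scale (- 1) (Ddet y)" by simp
  ultimately have "- Ddet y \<in> Ralg n"
    using subalgebra_Ralg[of n] unfolding subalgebra_def poly.subspace_def by metis
  then show ?thesis using Ddet_mset[OF ms[symmetric]] \<open>Ddet y \<in> Ralg n\<close> by metis
qed

context column_shape
begin

lemma D_poly_eq_prod: "D_poly w = (\<Prod>c<m. Ddet (map (\<lambda>s. w (c, s)) [0..<h c]))"
  unfolding D_poly_def column_minors_def Ddet_def
  by (intro prod.cong refl arg_cong[of _ _ det] eq_matI) (auto simp: zz_def)

lemma king_D_poly_component:
  assumes w: "king w" and pos: "\<And>c. c < m \<Longrightarrow> 1 \<le> h c"
  shows "D_poly w \<in> R_component n total_weight"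
proof -
  have W: "w \<in> Words" using w by (simp add: king_def)
  have "Ddet (map (\<lambda>s. w (c, s)) [0..<h c]) \<in> Ralg n" if c: "c < m" for c
  proof (rule Ddet_admissible_Ralg)
    have mem: "w (c, s) \<in> Nset n" if "s < h c" for s using W c that by (simp add: Pos_iff)
    have strict: "kappa (w (c, r)) < kappa (w (c, s))" if "r < s" "s < h c" for r s
      using w c that by (simp add: king_def Pos_iff)
    have low: "int s < \<bar>w (c, s)\<bar>" if "s < h c" for s
      using w c that by (simp add: king_def Pos_iff)
    have "inj_on (\<lambda>s. w (c, s)) {0..<h c}"
    proof (rule inj_onI)
      fix r s assume "r \<in> {0..<h c}" "s \<in> {0..<h c}" "w (c, r) = w (c, s)"
      then show "r = s" using strict[of r s] strict[of s r] by (cases r s rule: linorder_cases) auto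
    qed
    then have "distinct (map (\<lambda>s. w (c, s)) [0..<h c])" by (simp add: distinct_map)
    \<comment> \<open>Because s < |w (c, s)|, a letter of absolute value at most l can stand only in
      the rows 0, ..., l - 1.\<close>
    moreover have "length (filter (\<lambda>i. \<bar>i\<bar> \<le> int l) (map (\<lambda>s. w (c, s)) [0..<h c])) \<le> l" for l
    proof -
      have "length (filter (\<lambda>i. \<bar>i\<bar> \<le> int l) (map (\<lambda>s. w (c, s)) [0..<h c]))
          = card {s. s < h c \<and> \<bar>w (c, s)\<bar> \<le> int l}"
        by (simp add: length_filter_conv_card cong: conj_cong)
      also have "\<dots> \<le> card {..<l}"
        using low by (intro card_mono) (fastforce+)
      finally show ?thesis by simp
    qed
    ultimately show "admissible n (map (\<lambda>s. w (c, s)) [0..<h c])"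
      using mem by (auto simp: admissible_def)
    show "length (map (\<lambda>s. w (c, s)) [0..<h c]) \<in> {1..n}" using pos[OF c] h_le[OF c] by simp
  qed
  then have "D_poly w \<in> Ralg n" unfolding D_poly_eq_prod by (intro Ralg_prod) simp
  then show ?thesis using D_poly_keys(2)[OF W] by (simp add: R_component_def)
qed

lemma product_eq_D_poly:
  assumes L: "set L \<subseteq> Theta n" "length L = m" "\<And>c. c < m \<Longrightarrow> length (L ! c) = h c"
  obtains w where "w \<in> Words" "(\<Prod>x\<leftarrow>L. Ddet x) = D_poly w"
proof -
  define w where "w = restrict (\<lambda>(c, s). L ! c ! s) Pos"
  have "w \<in> Words"
    unfolding Words_def
  proof (rule PiE_I)
    fix p
    show "w p \<in> Nset n" if "p \<in> Pos"
    proof -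
      obtain c s where "p = (c, s)" by fastforce
      with that have p: "p = (c, s)" "c < m" "s < h c" by (auto simp: Pos_iff)
      then have "L ! c ! s \<in> set (L ! c)" "L ! c \<in> Theta n" using L nth_mem[of c L] by auto
      then have "L ! c ! s \<in> Nset n" by (auto simp: Theta_def admissible_def)
      then show ?thesis using p that by (simp add: w_def)
    qed
  qed (simp add: w_def)
  moreover have "(\<Prod>x\<leftarrow>L. Ddet x) = D_poly w"
  proof -
    have "(\<Prod>x\<leftarrow>L. Ddet x) = (\<Prod>c<m. Ddet (L ! c))"
      using L(2) by (simp add: prod.list_conv_set_nth lessThan_atLeast0)
    also have "\<dots> = D_poly w"
      unfolding D_poly_eq_prod
    proof (rule prod.cong[OF refl])
      fix c assume "c \<in> {..<m}"
      then have "L ! c = map (\<lambda>s. w (c, s)) [0..<h c]"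
        using L(3)[of c] by (intro nth_equalityI) (auto simp: w_def Pos_iff)
      then show "Ddet (L ! c) = Ddet (map (\<lambda>s. w (c, s)) [0..<h c])" by simp
    qed
    finally show ?thesis .
  qed
  ultimately show ?thesis using that by blast
qed

end

section \<open>Shapes and the weight components of R\<close>

locale list_shape =
  fixes n :: nat and hs :: "nat list"
  assumes descending: "sorted_wrt (\<ge>) hs" and heights: "set hs \<subseteq> {1..n}"

sublocale list_shape \<subseteq> column_shape n "length hs" "(!) hs"
proof
  show "hs ! c \<le> n" if "c < length hs" for c
    using heights nth_mem[OF that] by auto
  show "hs ! c' \<le> hs ! c" if "c \<le> c'" "c' < length hs" for c c'
    using sorted_wrt_nth_less[OF descending, of c c'] that by (cases "c = c'") auto
qed

context list_shape
begin

lemma shape_weight_filter: "shape_weight i = int (length (filter (\<lambda>k. i \<le> int k) hs))"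
  by (simp add: shape_weight_def length_filter_conv_card)

lemma height_pos: "c < length hs \<Longrightarrow> 1 \<le> hs ! c"
  using subsetD[OF heights nth_mem] by simp

end

text \<open>The k-th coordinate of the weight counts the columns of height at least k, so
  consecutive differences give the number of columns of each height.\<close>

lemma list_shape_eqI:
  assumes hs: "list_shape n hs" and ks: "list_shape n ks"
    and eq: "column_shape.total_weight n (length hs) ((!) hs) = column_shape.total_weight n
        (length ks) ((!) ks)"
  shows "hs = ks"
proof -
  interpret H: list_shape n hs by fact
  interpret K: list_shape n ks by fact
  define F where "F k xs = length (filter (\<lambda>j. k \<le> j) xs)" for k :: nat and xs
  have F_eq: "F k hs = F k ks" if "k \<in> {1..n}" for k
    using fun_cong[OF eq, of "int k"] that
    by (simp add: H.total_weight_def K.total_weight_def H.shape_weight_filter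
        K.shape_weight_filter F_def)
  have F_big: "F k xs = 0" if "set xs \<subseteq> {1..n}" "n < k" for k xs
    using that by (auto simp: F_def filter_empty_conv)
  have F_count: "F k xs = count_list xs k + F (Suc k) xs" for k xs
    unfolding F_def by (induction xs) auto
  have "count (mset hs) k = count (mset ks) k" for k
  proof (cases "k \<in> {1..n}")
    case True
    have "F (Suc k) hs = F (Suc k) ks"
      using True F_eq[of "Suc k"] F_big[OF H.heights, of "Suc k"] F_big[OF K.heights, of "Suc k"]
      by (cases "k = n") auto
    then show ?thesis using F_count[of k hs] F_count[of k ks] F_eq[OF True] by (simp add:
        count_mset)
  next
    case False
    then have "k \<notin> set hs" "k \<notin> set ks" using H.heights K.heights by auto
    then show ?thesis by (metis count_mset_0_iff)
  qed
  then have "mset (rev hs) = mset (rev ks)" by (simp add: multiset_eqI)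
  moreover have "sorted (rev hs)" "sorted (rev ks)"
    using H.descending K.descending by (simp_all add: sorted_wrt_rev)
  ultimately have "rev hs = rev ks"
    using properties_for_sort[of "rev hs" "rev ks"] sorted_sort_id[of "rev ks"] by simp
  then show ?thesis by simp
qed

text \<open>With its factors sorted by size, any product of determinants is a D_w for its own shape,
  and all its monomials have the weight of that shape. By \<open>list_shape_eqI\<close> this is the
  given weight only for the given shape.\<close>

lemma (in list_shape) product_cases:
  assumes L: "set L \<subseteq> Theta n"
  shows "(\<exists>w\<in>Words. (\<Prod>x\<leftarrow>L. Ddet x) = D_poly w) \<or>
    (\<forall>e\<in>Poly_Mapping.keys (\<Prod>x\<leftarrow>L. Ddet x). grad n e \<noteq> total_weight)"
proof -
  define L' where "L' = rev (sort_key length L)"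
  define ks where "ks = map length L'"
  have "mset (map Ddet L') = mset (map Ddet L)" by (simp add: L'_def)
  then have prod: "(\<Prod>x\<leftarrow>L'. Ddet x) = (\<Prod>x\<leftarrow>L. Ddet x)" by (metis prod_mset_prod_list)
  have L': "set L' \<subseteq> Theta n" using L by (simp add: L'_def)
  have "sorted (rev ks)" by (simp add: ks_def L'_def flip: rev_map)
  then have "list_shape n ks"
    using L' by unfold_locales (auto simp: sorted_wrt_rev ks_def Theta_def)
  then interpret K: list_shape n ks .
  obtain w where w: "w \<in> K.Words" "(\<Prod>x\<leftarrow>L'. Ddet x) = K.D_poly w"
    by (rule K.product_eq_D_poly[OF L']) (auto simp: ks_def)
  show ?thesis
  proof (cases "total_weight = K.total_weight")
    case True
    then have "hs = ks" by (intro list_shape_eqI) unfold_locales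
    then show ?thesis using w prod by auto
  next
    case False
    then show ?thesis using K.D_poly_keys(2)[OF w(1)] w(2) prod by auto
  qed
qed

text \<open>From a combination of arbitrary products keep those of the right shape as q. Then p and
  q agree on monomials of the given weight, and neither contains any others.\<close>

lemma (in list_shape) R_component_span:
  assumes p: "p \<in> R_component n total_weight"
  shows "p \<in> poly.span (D_poly ` Words)"
proof -
  have "p \<in> poly.span {\<Prod>x\<leftarrow>L. Ddet x | L. set L \<subseteq> Theta n}"
    using p Ralg_span_products by (auto simp: R_component_def)
  then have "\<exists>q\<in>poly.span (D_poly ` Words). \<forall>e. grad n e = total_weight \<longrightarrow>
      Poly_Mapping.lookup p e = Poly_Mapping.lookup q e"
  proof (induction rule: poly.span_induct_alt)
    case base
    show ?case by (intro bexI[of _ 0]) (simp_all add: poly.span_zero)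
  next
    case (step c x y)
    obtain L where L: "x = (\<Prod>x\<leftarrow>L. Ddet x)" "set L \<subseteq> Theta n" using step(1) by blast
    obtain q where q: "q \<in> poly.span (D_poly ` Words)"
      "\<And>e. grad n e = total_weight \<Longrightarrow> Poly_Mapping.lookup y e = Poly_Mapping.lookup q e"
      using step(2) by blast
    from product_cases[OF L(2)] show ?case
    proof
      assume "\<exists>w\<in>Words. (\<Prod>x\<leftarrow>L. Ddet x) = D_poly w"
      then have "x \<in> D_poly ` Words" using L(1) by auto
      then have "poly_scale c x + q \<in> poly.span (D_poly ` Words)"
        by (intro poly.span_add[OF poly.span_scale[OF poly.span_base] q(1)])
      then show ?thesis using q(2) by (auto intro!: bexI[of _ "poly_scale c x + q"] simp:
          lookup_add)
    next
      assume "\<forall>e\<in>Poly_Mapping.keys (\<Prod>x\<leftarrow>L. Ddet x). grad n e \<noteq> total_weight"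
      then have "Poly_Mapping.lookup x e = 0" if "grad n e = total_weight" for e
        using L(1) that by (auto simp: in_keys_iff)
      then show ?thesis using q by (auto intro!: bexI[of _ q] simp: lookup_add lookup_poly_scale)
    qed
  qed
  then obtain q where q: "q \<in> poly.span (D_poly ` Words)"
    "\<And>e. grad n e = total_weight \<Longrightarrow> Poly_Mapping.lookup p e = Poly_Mapping.lookup q e"
    by blast
  have off: "Poly_Mapping.lookup q e = 0" if "grad n e \<noteq> total_weight" for e
    using q(1)
  proof (induction rule: poly.span_induct_alt)
    case (step c x y)
    then obtain w where "x = D_poly w" "w \<in> Words" by blast
    then have "e \<notin> Poly_Mapping.keys x" using D_poly_keys(2)[of w e] that by auto
    then show ?case using step(2) by (simp add: lookup_add lookup_poly_scale in_keys_iff)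
  qed simp
  have "p = q"
  proof (rule poly_mapping_eqI)
    fix e
    show "Poly_Mapping.lookup p e = Poly_Mapping.lookup q e"
    proof (cases "grad n e = total_weight")
      case False
      then have "e \<notin> Poly_Mapping.keys p" using p by (auto simp: R_component_def)
      then show ?thesis using off[OF False] by (simp add: in_keys_iff)
    qed (rule q(2))
  qed
  then show ?thesis using q(1) by simp
qed

lemma fundamental_weight_apply: "fundamental_weight k x = of_bool (1 \<le> x \<and> x \<le> int k)"
  by (simp add: fundamental_weight_def eps_def)

lemma dominant_weight_shape:
  assumes "dominant_weight n lam"
  obtains hs where "list_shape n hs" "column_shape.total_weight n (length hs) ((!) hs) = lam"
proof -
  obtain a :: "nat \<Rightarrow> nat" where a: "lam = (\<lambda>x. \<Sum>k\<in>{1..n}. int (a k) * fundamental_weight k x)"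
    using assms by (auto simp: dominant_weight_def)
  define ks where "ks = rev [1..<Suc n]"
  \<comment> \<open>Each fundamental weight of index k contributes a column of height k, tallest
    columns first.\<close>
  define hs where "hs = concat (map (\<lambda>k. replicate (a k) k) ks)"
  have desc: "sorted_wrt (\<ge>) (concat (map (\<lambda>k. replicate (a k) k) xs))" if "sorted_wrt (\<ge>) xs" for
      xs
    using that
  proof (induction xs)
    case (Cons x xs)
    have "sorted_wrt (\<ge>) (replicate (a x) x)" by (simp add: sorted_wrt_iff_nth_less)
    then show ?case using Cons by (auto simp: sorted_wrt_append)
  qed simp
  have ks: "sorted_wrt (\<ge>) ks" by (simp add: ks_def sorted_wrt_rev del: upt_Suc)
  then have shape: "list_shape n hs"
    unfolding list_shape_def hs_def using desc[OF ks] by (auto simp: ks_def simp del: upt_Suc)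
  then interpret list_shape n hs .
  have "total_weight x = lam x" for x
  proof (cases "x \<in> {1..int n}")
    case True
    have "length (filter (\<lambda>k. x \<le> int k) (concat (map (\<lambda>k. replicate (a k) k) xs)))
        = (\<Sum>k\<leftarrow>xs. if x \<le> int k then a k else 0)" for xs
      by (induction xs) auto
    then have "length (filter (\<lambda>k. x \<le> int k) hs) = (\<Sum>k\<leftarrow>ks. if x \<le> int k then a k else 0)"
      unfolding hs_def .
    also have "\<dots> = (\<Sum>k\<in>{1..n}. if x \<le> int k then a k else 0)"
      by (simp add: ks_def sum_list_distinct_conv_sum_set atLeastLessThanSuc_atLeastAtMost del:
          upt_Suc)
    finally have "shape_weight x = (\<Sum>k\<in>{1..n}. int (if x \<le> int k then a k else 0))"
      unfolding shape_weight_filter by simp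
    also have "\<dots> = lam x"
      unfolding a using True by (intro sum.cong refl) (simp add: fundamental_weight_apply)
    finally show ?thesis using True by (simp add: total_weight_def)
  next
    case False
    then have "lam x = 0" unfolding a by (intro sum.neutral) (auto simp: fundamental_weight_apply)
    then show ?thesis using False by (simp only: total_weight_def if_False)
  qed
  then show ?thesis using that[OF shape] by blast
qed


section \<open>The bases\<close>

text \<open>The order may fail to be well-founded, so all extremal monomials are taken in finite
  sets, here supports and finite sets of exponents.\<close>

lemma finite_total_order_maximum:
  assumes "finite A" "A \<noteq> {}" "transp_on A lt" "totalp_on A lt"
  shows "\<exists>d\<in>A. \<forall>e\<in>A. e \<noteq> d \<longrightarrow> lt e d"
  using assms
proof (induction A rule: finite_ne_induct)
  case (insert x A)
  have "transp_on A lt" "totalp_on A lt"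
    using insert.prems by (auto intro: transp_on_subset totalp_on_subset)
  then obtain d where d: "d \<in> A" "\<forall>e\<in>A. e \<noteq> d \<longrightarrow> lt e d" using insert.IH by blast
  show ?case
  proof (cases "lt x d")
    case True
    then show ?thesis using d by (intro bexI[of _ d]) auto
  next
    case False
    then have xd: "lt d x" using insert.prems(2) insert.hyps d(1) by (auto simp: totalp_on_def)
    have "lt e x" if "e \<in> A" for e
      using that d xd transp_onD[OF insert.prems(1), of e d x] by (cases "e = d") auto
    then show ?thesis by (intro bexI[of _ x]) auto
  qed
qed simp

lemma max_exp:
  assumes lt: "total_monomial_order n lt" and p: "p \<noteq> 0" "Poly_Mapping.keys p \<subseteq> monomials n"
  shows "max_exp lt p \<in> Poly_Mapping.keys p"
    and "e \<in> Poly_Mapping.keys p \<Longrightarrow> e \<noteq> max_exp lt p \<Longrightarrow> lt e (max_exp lt p)"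
proof -
  let ?K = "Poly_Mapping.keys p"
  have ord: "irreflp_on ?K lt" "transp_on ?K lt" "totalp_on ?K lt"
    using lt p(2) unfolding total_monomial_order_def
    by (auto intro: irreflp_on_subset transp_on_subset totalp_on_subset)
  have "?K \<noteq> {}" using p(1) by (simp add: keys_eq_empty)
  then obtain d where d: "d \<in> ?K \<and> (\<forall>e\<in>?K. e \<noteq> d \<longrightarrow> lt e d)"
    using finite_total_order_maximum[OF _ _ ord(2,3)] by auto
  have "max_exp lt p = d"
    unfolding max_exp_def
  proof (rule the_equality)
    fix e assume e: "e \<in> ?K \<and> (\<forall>k\<in>?K. k \<noteq> e \<longrightarrow> lt k e)"
    show "e = d"
    proof (rule ccontr)
      assume "e \<noteq> d"
      then have "lt d d" using d e transp_onD[OF ord(2), of d e d] by auto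
      then show False using irreflp_onD[OF ord(1)] d by blast
    qed
  qed (rule d)
  then show "max_exp lt p \<in> ?K" "e \<in> ?K \<Longrightarrow> e \<noteq> max_exp lt p \<Longrightarrow> lt e (max_exp lt p)"
    using d by auto
qed

text \<open>Initial terms are multiples of single monomials. A monomial in their span must occur in
  one of them, hence be proportional to it.\<close>

lemma monomial_in_initial_space_iff:
  assumes lt: "total_monomial_order n lt" and U: "\<And>p. p \<in> U \<Longrightarrow> Poly_Mapping.keys p \<subseteq> monomials n"
  shows "monomial d \<in> initial_space lt U \<longleftrightarrow> (\<exists>p\<in>U. p \<noteq> 0 \<and> max_exp lt p = d)"
proof
  have nonzero: "\<exists>q\<in>S. Poly_Mapping.lookup q d \<noteq> 0"
    if "p \<in> poly.span S" "Poly_Mapping.lookup p d \<noteq> 0" for p S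
    using that
  proof (induction rule: poly.span_induct_alt)
    case (step c x y)
    then show ?case by (cases "Poly_Mapping.lookup x d = 0") (auto simp: lookup_add
        lookup_poly_scale)
  qed simp
  assume "monomial d \<in> initial_space lt U"
  then obtain q where "q \<in> initial lt ` U" "Poly_Mapping.lookup q d \<noteq> 0"
    using nonzero[of "monomial d" "initial lt ` U"] by (auto simp: initial_space_def
        lookup_monomial)
  then show "\<exists>p\<in>U. p \<noteq> 0 \<and> max_exp lt p = d"
    by (auto simp: initial_def lookup_single when_def split: if_splits)
next
  assume "\<exists>p\<in>U. p \<noteq> 0 \<and> max_exp lt p = d"
  then obtain p where p: "p \<in> U" "p \<noteq> 0" "max_exp lt p = d" by blast
  define c where "c = Poly_Mapping.lookup p d"
  have c: "c \<noteq> 0" using max_exp(1)[OF lt p(2) U[OF p(1)]] p(3) by (simp add: c_def in_keys_iff)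
  have "initial lt p = Poly_Mapping.single d c" using p by (simp add: initial_def c_def)
  then have "monomial d = poly_scale (inverse c) (initial lt p)"
    using c by (simp add: monomial_def poly_scale_def mult_single)
  moreover have "initial lt p \<in> initial lt ` U" using p(1) by blast
  ultimately show "monomial d \<in> initial_space lt U"
    unfolding initial_space_def by (simp only: poly.span_scale[OF poly.span_base])
qed

lemma (in vector_space) family_independentI:
  assumes indep: "\<And>F c. finite F \<Longrightarrow> F \<subseteq> I \<Longrightarrow> (\<Sum>k\<in>F. scale (c k) (u k)) = 0 \<Longrightarrow> \<forall>k\<in>F. c k = 0"
  shows "inj_on u I" "\<not> dependent (u ` I)"
proof -
  show inj: "inj_on u I"
  proof (rule inj_onI, rule ccontr)
    fix a b assume ab: "a \<in> I" "b \<in> I" "u a = u b" "a \<noteq> b"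
    have "(\<Sum>k\<in>{a, b}. scale (if k = a then 1 else - 1) (u k)) = 0" using ab(3,4) by simp
    from indep[OF _ _ this] ab show False by auto
  qed
  show "\<not> dependent (u ` I)"
  proof
    assume "dependent (u ` I)"
    then obtain S c where S: "finite S" "S \<subseteq> u ` I" "(\<Sum>x\<in>S. scale (c x) x) = 0" "\<exists>x\<in>S. c x \<noteq> 0"
      unfolding dependent_explicit by blast
    obtain F where F: "F \<subseteq> I" "finite F" "S = u ` F"
      using finite_subset_image[OF S(1,2)] by blast
    have "(\<Sum>k\<in>F. scale (c (u k)) (u k)) = 0"
      using S(3) inj_on_subset[OF inj F(1)] by (simp add: F(3) sum.reindex comp_def)
    then show False using indep[OF F(2,1), of "\<lambda>k. c (u k)"] S(4) F(3) by auto
  qed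
qed

lemma (in vector_space) span_image_sum:
  assumes "finite A" "x \<in> span (f ` A)"
  shows "\<exists>a. x = (\<Sum>k\<in>A. scale (a k) (f k))"
  using assms(2)
proof (induction rule: span_induct_alt)
  case base
  show ?case by (intro exI[of _ "\<lambda>_. 0"]) simp
next
  case (step c x y)
  obtain k a where ka: "k \<in> A" "x = f k" "y = (\<Sum>k\<in>A. scale (a k) (f k))" using step by blast
  have "(\<Sum>j\<in>A. scale (a j + (if j = k then c else 0)) (f j))
      = (\<Sum>j\<in>A. scale (a j) (f j)) + (\<Sum>j\<in>A. if j = k then scale c (f k) else 0)"
    unfolding sum.distrib[symmetric] by (intro sum.cong refl) (auto simp: scale_left_distrib)
  also have "\<dots> = scale c x + y" using assms(1) ka by simp
  finally show ?case by metis
qed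

text \<open>Writes f^d v as a word in root vectors, the form in which relations and spanning pass
  between V and the tensor model.\<close>

lemma f_power_eq_foldr:
  "f_power n \<rho> d v = foldr (\<lambda>(i, j). \<rho> (froot n i j))
    (concat (map (\<lambda>ij. replicate (Poly_Mapping.lookup d ij) ij) (root_list n))) v"
proof -
  have rep: "foldr (\<lambda>(i, j). \<rho> (froot n i j)) (replicate k (i, j)) x = (\<rho> (froot n i j) ^^ k) x"
      for k i j x
    by (induction k) auto
  have "foldr (\<lambda>(i, j). \<rho> (froot n i j) ^^ Poly_Mapping.lookup d (i, j)) L v
      = foldr (\<lambda>(i, j). \<rho> (froot n i j)) (concat (map (\<lambda>ij. replicate (Poly_Mapping.lookup d ij)
          ij) L)) v" for L
    by (induction L) (auto simp: rep)
  then show ?thesis unfolding f_power_def .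
qed

section \<open>Independence and spanning of the vectors f^d t\<close>

locale ordered_shape = list_shape +
  fixes lt :: "mono \<Rightarrow> mono \<Rightarrow> bool"
  assumes lt: "total_monomial_order n lt"
begin

definition initial_exponents :: "mono set" where
  "initial_exponents = {d \<in> monomials n. monomial d \<in> initial_space lt (R_component n
      total_weight)}"

lemma R_component_monomials:
  assumes "p \<in> R_component n total_weight"
  shows "Poly_Mapping.keys p \<subseteq> monomials n"
proof -
  have "\<forall>e. e \<notin> monomials n \<longrightarrow> Poly_Mapping.lookup p e = 0"
    using R_component_span[OF assms]
  proof (induction rule: poly.span_induct_alt)
    case (step c x y)
    then obtain w where "x = D_poly w" "w \<in> Words" by blast
    then have "\<forall>e. e \<notin> monomials n \<longrightarrow> Poly_Mapping.lookup x e = 0"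
      using D_poly_keys(1)[of w] by (auto simp: in_keys_iff)
    then show ?case using step(2) by (simp add: lookup_add lookup_poly_scale)
  qed simp
  then show ?thesis by (auto simp: in_keys_iff)
qed

lemma initial_exponents_iff:
  "d \<in> initial_exponents \<longleftrightarrow> (\<exists>p\<in>R_component n total_weight. p \<noteq> 0 \<and> max_exp lt p = d)"
proof -
  have "monomial d \<in> initial_space lt (R_component n total_weight)
      \<longleftrightarrow> (\<exists>p\<in>R_component n total_weight. p \<noteq> 0 \<and> max_exp lt p = d)"
    by (rule monomial_in_initial_space_iff[OF lt R_component_monomials])
  moreover have "max_exp lt p \<in> monomials n" if "p \<in> R_component n total_weight" "p \<noteq> 0" for p
    using max_exp(1)[OF lt that(2) R_component_monomials[OF that(1)]] R_component_monomials[OF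
        that(1)] by blast
  ultimately show ?thesis by (auto simp: initial_exponents_def)
qed

lemma initial_exponents_grad:
  assumes "d \<in> initial_exponents"
  shows "d \<in> monomials n" "grad n d = total_weight"
proof -
  obtain p where p: "p \<in> R_component n total_weight" "p \<noteq> 0" "max_exp lt p = d"
    using assms by (auto simp: initial_exponents_iff)
  then have "d \<in> Poly_Mapping.keys p" using max_exp(1)[OF lt p(2) R_component_monomials[OF p(1)]]
      by simp
  then show "d \<in> monomials n" "grad n d = total_weight"
    using p(1) R_component_monomials[OF p(1)] by (auto simp: R_component_def)
qed

text \<open>Expand an element p with initial monomial z^d in the D_w and take the same combination
  of coordinates, but only at the words whose letter sum belongs to the degree of d. At f^e t of
  smaller degree these coordinates vanish. In equal degree the value is a nonzero multiple of the
  coefficient of z^e in p, which is 0 unless e = d or e <' d.\<close>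

lemma triangular_functional:
  assumes d: "d \<in> initial_exponents"
  obtains a where
    "(\<Sum>w | w \<in> Words \<and> letter_sum w = base_sum + mono_degree n d. a w * f_power n act d hw_tensor
        w) \<noteq> 0"
    "\<forall>e\<in>initial_exponents. e \<noteq> d \<longrightarrow>
      mono_degree n e < mono_degree n d \<or> mono_degree n e = mono_degree n d \<and> \<not> lt e d \<longrightarrow>
      (\<Sum>w | w \<in> Words \<and> letter_sum w = base_sum + mono_degree n d. a w * f_power n act e hw_tensor
          w) = 0"
proof -
  obtain p where p: "p \<in> R_component n total_weight" "p \<noteq> 0" "max_exp lt p = d"
    using d by (auto simp: initial_exponents_iff)
  note max = max_exp[OF lt p(2) R_component_monomials[OF p(1)], unfolded p(3)]
  obtain a where a: "p = (\<Sum>w\<in>Words. poly_scale (a w) (D_poly w))"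
    using poly.span_image_sum[OF finite_Words R_component_span[OF p(1)]] by blast
  let ?W = "{w. w \<in> Words \<and> letter_sum w = base_sum + mono_degree n d}"
  have eq: "(\<Sum>w\<in>?W. a w * f_power n act e hw_tensor w) = f_multiplier e * Poly_Mapping.lookup p e"
    if e: "e \<in> initial_exponents" "mono_degree n e = mono_degree n d" for e
  proof -
    have "(\<Sum>w\<in>?W. a w * f_power n act e hw_tensor w)
        = (\<Sum>w\<in>?W. f_multiplier e * (a w * Poly_Mapping.lookup (D_poly w) e))"
      using e by (intro sum.cong refl) (simp add: f_power_D_poly initial_exponents_grad)
    also have "\<dots> = (\<Sum>w\<in>Words. f_multiplier e * (a w * Poly_Mapping.lookup (D_poly w) e))"
    proof (rule sum.mono_neutral_left)
      show "\<forall>w\<in>Words - ?W. f_multiplier e * (a w * Poly_Mapping.lookup (D_poly w) e) = 0"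
      proof
        fix w assume w: "w \<in> Words - ?W"
        then have "e \<notin> Poly_Mapping.keys (D_poly w)" using D_poly_keys(3)[of w e] e(2) by auto
        then show "f_multiplier e * (a w * Poly_Mapping.lookup (D_poly w) e) = 0" by (simp add:
            in_keys_iff)
      qed
    qed auto
    also have "\<dots> = f_multiplier e * Poly_Mapping.lookup p e"
      by (simp add: a lookup_sum lookup_poly_scale sum_distrib_left)
    finally show ?thesis .
  qed
  show ?thesis
  proof (rule that[of a])
    show "(\<Sum>w\<in>?W. a w * f_power n act d hw_tensor w) \<noteq> 0"
      using eq[OF d refl] max(1) f_multiplier_nonzero by (simp add: in_keys_iff)
    show "\<forall>e\<in>initial_exponents. e \<noteq> d \<longrightarrow>
      mono_degree n e < mono_degree n d \<or> mono_degree n e = mono_degree n d \<and> \<not> lt e d \<longrightarrow>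
      (\<Sum>w\<in>?W. a w * f_power n act e hw_tensor w) = 0"
    proof (intro ballI impI)
      fix e assume e: "e \<in> initial_exponents" "e \<noteq> d"
        "mono_degree n e < mono_degree n d \<or> mono_degree n e = mono_degree n d \<and> \<not> lt e d"
      show "(\<Sum>w\<in>?W. a w * f_power n act e hw_tensor w) = 0"
      proof (cases "mono_degree n e < mono_degree n d")
        case True
        then show ?thesis by (intro sum.neutral) (auto simp: f_power_beyond)
      next
        case False
        then have "e \<notin> Poly_Mapping.keys p" using max(2) e by blast
        then show ?thesis using eq[OF e(1)] False e(3) by (simp add: in_keys_iff)
      qed
    qed
  qed
qed

text \<open>Among the exponents with nonzero coefficient take those of largest degree, and among
  these the <'-smallest d. The functional belonging to d then annihilates every other term of the
  relation.\<close>

lemma f_powers_independent: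
  assumes F: "finite F" "F \<subseteq> initial_exponents"
    and zero: "(\<Sum>d\<in>F. tensor_scale (c d) (f_power n act d hw_tensor)) = 0"
  shows "\<forall>d\<in>F. c d = 0"
proof (rule ccontr)
  define G where "G = {d \<in> F. c d \<noteq> 0}"
  assume "\<not> (\<forall>d\<in>F. c d = 0)"
  then have "G \<noteq> {}" "finite G" using F(1) by (auto simp: G_def)
  define M where "M = Max (mono_degree n ` G)"
  define G' where "G' = {d \<in> G. mono_degree n d = M}"
  have M: "mono_degree n d \<le> M" if "d \<in> G" for d
    using that \<open>finite G\<close> by (simp add: M_def)
  have "M \<in> mono_degree n ` G" unfolding M_def using \<open>G \<noteq> {}\<close> \<open>finite G\<close> by (intro Max_in) auto
  then have "G' \<noteq> {}" "finite G'" using \<open>finite G\<close> by (auto simp: G'_def)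
  have sub: "G' \<subseteq> monomials n" using F(2) initial_exponents_grad(1) by (auto simp: G'_def G_def)
  have ord: "irreflp_on G' lt" "transp_on G' lt" "totalp_on G' lt"
    using lt sub unfolding total_monomial_order_def
    by (auto intro: irreflp_on_subset transp_on_subset totalp_on_subset)
  have "transp_on G' (\<lambda>x y. lt y x)" "totalp_on G' (\<lambda>x y. lt y x)"
    using ord(2,3) unfolding transp_on_def totalp_on_def by blast+
  from finite_total_order_maximum[OF \<open>finite G'\<close> \<open>G' \<noteq> {}\<close> this]
  obtain d where d: "d \<in> G'" "\<And>e. e \<in> G' \<Longrightarrow> e \<noteq> d \<Longrightarrow> lt d e" by blast
  have not_lt: "\<not> lt e d" if "e \<in> G'" "e \<noteq> d" for e
    using d that transp_onD[OF ord(2), of d e d] irreflp_onD[OF ord(1), of d] by blast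
  have dF: "d \<in> F" "c d \<noteq> 0" "mono_degree n d = M" using d(1) by (auto simp: G'_def G_def)
  then have dI: "d \<in> initial_exponents" using F(2) by blast
  obtain a where a:
    "(\<Sum>w | w \<in> Words \<and> letter_sum w = base_sum + mono_degree n d. a w * f_power n act d hw_tensor
        w) \<noteq> 0"
    "\<forall>e\<in>initial_exponents. e \<noteq> d \<longrightarrow>
      mono_degree n e < mono_degree n d \<or> mono_degree n e = mono_degree n d \<and> \<not> lt e d \<longrightarrow>
      (\<Sum>w | w \<in> Words \<and> letter_sum w = base_sum + mono_degree n d. a w * f_power n act e hw_tensor
          w) = 0"
    by (rule triangular_functional[OF dI])
  let ?W = "{w. w \<in> Words \<and> letter_sum w = base_sum + mono_degree n d}"
  have point: "(\<Sum>e\<in>F. c e * f_power n act e hw_tensor w) = 0" for w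
  proof -
    have "(\<Sum>e\<in>F. tensor_scale (c e) (f_power n act e hw_tensor)) w = (\<Sum>e\<in>F. c e * f_power n act e
        hw_tensor w)"
      using F(1) by (induction F rule: finite_induct) (auto simp: tensor_scale_def)
    then show ?thesis using zero by simp
  qed
  have "0 = (\<Sum>w\<in>?W. a w * (\<Sum>e\<in>F. c e * f_power n act e hw_tensor w))"
    unfolding point by simp
  also have "\<dots> = (\<Sum>w\<in>?W. \<Sum>e\<in>F. c e * (a w * f_power n act e hw_tensor w))"
    by (intro sum.cong refl) (simp add: sum_distrib_left mult_ac)
  also have "\<dots> = (\<Sum>e\<in>F. \<Sum>w\<in>?W. c e * (a w * f_power n act e hw_tensor w))"
    by (rule sum.swap)
  also have "\<dots> = (\<Sum>e\<in>F. c e * (\<Sum>w\<in>?W. a w * f_power n act e hw_tensor w))"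
    by (intro sum.cong refl) (simp only: sum_distrib_left)
  also have "\<dots> = (\<Sum>e\<in>F. if e = d then c d * (\<Sum>w\<in>?W. a w * f_power n act d hw_tensor w) else 0)"
  proof (rule sum.cong[OF refl])
    fix e assume e: "e \<in> F"
    show "c e * (\<Sum>w\<in>?W. a w * f_power n act e hw_tensor w)
        = (if e = d then c d * (\<Sum>w\<in>?W. a w * f_power n act d hw_tensor w) else 0)"
    proof (cases "e = d \<or> c e = 0")
      case False
      then have eG: "e \<in> G" using e by (simp add: G_def)
      have "mono_degree n e < mono_degree n d \<or> mono_degree n e = mono_degree n d \<and> \<not> lt e d"
        using M[OF eG] dF(3) not_lt[of e] eG False by (auto simp: G'_def)
      then show ?thesis using a(2) False e F(2) by auto
    qed auto
  qed
  also have "\<dots> = c d * (\<Sum>w\<in>?W. a w * f_power n act d hw_tensor w)"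
    using F(1) dF(1) by simp
  finally show False using a(1) dF(2) by simp
qed

text \<open>The tableaux of smallest letter sum in the support of b give a nonzero homogeneous q in
  R[lambda]; let z^d be its initial monomial. At f^d t the tableaux of larger letter sum contribute
  0, so the value is a nonzero multiple of the coefficient of z^d in q.\<close>

lemma functional_nonzero_on_f_power:
  assumes b: "\<And>u. b u \<noteq> 0 \<Longrightarrow> king u" and nz: "b u0 \<noteq> 0"
  shows "\<exists>d\<in>initial_exponents. (\<Sum>u | king u. b u * f_power n act d hw_tensor u) \<noteq> 0"
proof -
  define S where "S = {u. b u \<noteq> 0}"
  have S: "finite S" "S \<noteq> {}" "u0 \<in> S"
    using finite_subset[OF _ finite_king, of S] b nz by (auto simp: S_def)
  define l where "l = Min (letter_sum ` S)"
  define F where "F = {u \<in> S. letter_sum u = l}"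
  have l_le: "l \<le> letter_sum u" if "u \<in> S" for u using that S(1) by (simp add: l_def)
  have "l \<in> letter_sum ` S" unfolding l_def using S by (intro Min_in) auto
  then have F: "finite F" "F \<noteq> {}" using S(1) by (auto simp: F_def)
  have king: "king u" if "u \<in> S" for u using that b by (simp add: S_def)
  define q where "q = (\<Sum>u\<in>F. poly_scale (b u) (D_poly u))"
  have q_nz: "q \<noteq> 0"
    unfolding q_def using F king by (intro king_D_poly_independent) (auto simp: F_def S_def)
  have "D_poly u \<in> R_component n total_weight" if "u \<in> F" for u
    using that king by (intro king_D_poly_component height_pos) (auto simp: F_def)
  moreover have "poly.subspace (R_component n total_weight)"
    using subalgebra_Ralg[of n] unfolding poly.subspace_def subalgebra_def R_component_def
    by (auto simp: in_keys_iff lookup_add lookup_poly_scale)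
  ultimately have q: "q \<in> R_component n total_weight"
    unfolding q_def by (intro poly.subspace_sum poly.subspace_scale)
  define d where "d = max_exp lt q"
  have d: "d \<in> initial_exponents" using q q_nz by (auto simp: initial_exponents_iff d_def)
  have d_key: "d \<in> Poly_Mapping.keys q"
    unfolding d_def by (rule max_exp(1)[OF lt q_nz R_component_monomials[OF q]])
  then have "Poly_Mapping.lookup q d \<noteq> 0" by (simp add: in_keys_iff)
  then have "\<exists>u\<in>F. Poly_Mapping.lookup (D_poly u) d \<noteq> 0"
    unfolding q_def lookup_sum lookup_poly_scale by (metis (no_types, lifting) mult_zero_right
        sum.neutral)
  then obtain u where u: "u \<in> F" "d \<in> Poly_Mapping.keys (D_poly u)" by (auto simp: in_keys_iff)
  have "u \<in> Words" using u(1) king by (auto simp: F_def king_def)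
  then have deg: "base_sum + mono_degree n d = l" using D_poly_keys(3)[OF _ u(2)] u(1) by (auto
      simp: F_def)
  have "(\<Sum>u | king u. b u * f_power n act d hw_tensor u) = (\<Sum>u\<in>S. b u * f_power n act d hw_tensor
      u)"
    using finite_king king by (intro sum.mono_neutral_right) (auto simp: S_def)
  also have "\<dots> = (\<Sum>u\<in>S. f_multiplier d * (b u * Poly_Mapping.lookup (D_poly u) d))"
  proof (rule sum.cong[OF refl])
    fix u assume u: "u \<in> S"
    have "f_power n act d hw_tensor u = f_multiplier d * Poly_Mapping.lookup (D_poly u) d"
      using king[OF u] l_le[OF u] deg
      by (intro f_power_D_poly initial_exponents_grad[OF d]) (auto simp: king_def)
    then show "b u * f_power n act d hw_tensor u = f_multiplier d * (b u * Poly_Mapping.lookup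
        (D_poly u) d)"
      by simp
  qed
  also have "\<dots> = (\<Sum>u\<in>F. f_multiplier d * (b u * Poly_Mapping.lookup (D_poly u) d))"
  proof (rule sum.mono_neutral_right)
    show "\<forall>u\<in>S - F. f_multiplier d * (b u * Poly_Mapping.lookup (D_poly u) d) = 0"
    proof
      fix u assume u: "u \<in> S - F"
      then have "u \<in> Words" "letter_sum u \<noteq> l" using king by (auto simp: king_def F_def)
      then have "d \<notin> Poly_Mapping.keys (D_poly u)" using D_poly_keys(3)[of u d] deg by auto
      then show "f_multiplier d * (b u * Poly_Mapping.lookup (D_poly u) d) = 0" by (simp add:
          in_keys_iff)
    qed
  qed (use S F_def in auto)
  also have "\<dots> = f_multiplier d * Poly_Mapping.lookup q d"
    by (simp add: q_def lookup_sum lookup_poly_scale sum_distrib_left)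
  finally have "(\<Sum>u | king u. b u * f_power n act d hw_tensor u) \<noteq> 0"
    using d_key f_multiplier_nonzero by (simp add: in_keys_iff)
  then show ?thesis using d by blast
qed

text \<open>Otherwise a linear functional would be 0 on all f^d t and 1 on some descendant y of t.
  Straightening writes it on such tensors through King coordinates only, which contradicts
  \<open>functional_nonzero_on_f_power\<close>.\<close>

lemma f_powers_span:
  "sp_representation.fwords n act hw_tensor \<subseteq> tensor.span ((\<lambda>d. f_power n act d hw_tensor) `
      initial_exponents)"
proof
  interpret sp_representation tensor_scale n act by (rule tensor_representation)
  interpret pair: vector_space_pair tensor_scale "(*) :: complex \<Rightarrow> complex \<Rightarrow> complex"
    by unfold_locales (auto simp: algebra_simps)
  let ?X = "(\<lambda>d. f_power n act d hw_tensor) ` initial_exponents"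
  fix y assume y: "y \<in> fwords hw_tensor"
  show "y \<in> tensor.span ?X"
  proof (rule ccontr)
    assume "y \<notin> tensor.span ?X"
    obtain B where B: "B \<subseteq> ?X" "\<not> tensor.dependent B" "?X \<subseteq> tensor.span B"
      using tensor.maximal_independent_subset[of ?X] by blast
    have span: "tensor.span B = tensor.span ?X"
      using B by (metis tensor.span_mono tensor.span_span subset_antisym)
    then have "\<not> tensor.dependent (insert y B)"
      using \<open>y \<notin> tensor.span ?X\<close> B(2) by (simp add: tensor.independent_insertI)
    then obtain \<xi> where \<xi>: "Vector_Spaces.linear tensor_scale (*) \<xi>"
      "\<forall>x\<in>insert y B. \<xi> x = (if x = y then 1 else 0)"
      using pair.linear_independent_extend[of "insert y B" "\<lambda>x. if x = y then 1 else 0"] by blast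
    interpret \<xi>: Vector_Spaces.linear tensor_scale "(*) :: complex \<Rightarrow> complex \<Rightarrow> complex" \<xi> by fact
    have "y \<notin> B" using \<open>y \<notin> tensor.span ?X\<close> span tensor.span_base by metis
    then have "\<xi> x = 0" if "x \<in> B" for x using \<xi>(2) that by auto
    then have "\<xi> x = 0" if "x \<in> tensor.span B" for x
      using that by (rule \<xi>.eq_0_on_span)
    then have \<xi>_zero: "\<xi> (f_power n act d hw_tensor) = 0" if "d \<in> initial_exponents" for d
      using that B(3) by blast
    have \<xi>_y: "\<xi> y = 1" using \<xi>(2) by simp
    have straighten: "\<forall>w\<in>Words. \<exists>a. \<forall>f. straight_tensor f \<longrightarrow> f w = (\<Sum>u | king u. a u * f u)"
      using straightens_all unfolding straightens_def by blast
    from bchoice[OF this] obtain a where a: "\<And>w f. w \<in> Words \<Longrightarrow> straight_tensor f \<Longrightarrow> f w = (\<Sum>u |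
        king u. a w u * f u)"
      by blast
    \<comment> \<open>Expand a tensor in the unit tensors of words and straighten each coordinate;
      collecting the terms gives the coefficient of the functional at the King tableau u.\<close>
    define b where "b u = (if king u then \<Sum>w\<in>Words. \<xi> (\<lambda>x. of_bool (x = w)) * a w u else 0)" for u
    have \<xi>_formula: "\<xi> f = (\<Sum>u | king u. b u * f u)"
      if f: "straight_tensor f" "\<And>w. w \<notin> Words \<Longrightarrow> f w = 0" for f
    proof -
      have "f = (\<Sum>w\<in>Words. tensor_scale (f w) (\<lambda>x. of_bool (x = w)))"
      proof
        fix x
        have "(\<Sum>w\<in>A. tensor_scale (f w) (\<lambda>x. of_bool (x = w))) x = (\<Sum>w\<in>A. f w * of_bool (x = w))"
          if "finite A" for A
          using that by (induction A rule: finite_induct) (auto simp: tensor_scale_def)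
        from this[OF finite_Words]
        show "f x = (\<Sum>w\<in>Words. tensor_scale (f w) (\<lambda>x. of_bool (x = w))) x"
          using f(2)[of x] by (cases "x \<in> Words") simp_all
      qed
      then have "\<xi> f = \<xi> (\<Sum>w\<in>Words. tensor_scale (f w) (\<lambda>x. of_bool (x = w)))" by (rule arg_cong)
      also have "\<dots> = (\<Sum>w\<in>Words. f w * \<xi> (\<lambda>x. of_bool (x = w)))"
        by (simp only: \<xi>.sum \<xi>.scale)
      also have "\<dots> = (\<Sum>w\<in>Words. \<Sum>u | king u. \<xi> (\<lambda>x. of_bool (x = w)) * a w u * f u)"
      proof (rule sum.cong[OF refl])
        fix w assume "w \<in> Words"
        then have "f w = (\<Sum>u | king u. a w u * f u)" using f(1) by (rule a)
        then have "f w * \<xi> (\<lambda>x. of_bool (x = w)) = (\<Sum>u | king u. a w u * f u) * \<xi> (\<lambda>x. of_bool (x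
            = w))"
          by (rule arg_cong)
        then show "f w * \<xi> (\<lambda>x. of_bool (x = w)) = (\<Sum>u | king u. \<xi> (\<lambda>x. of_bool (x = w)) * a w u *
            f u)"
          by (simp only: sum_distrib_left sum_distrib_right mult_ac)
      qed
      also have "\<dots> = (\<Sum>u | king u. \<Sum>w\<in>Words. \<xi> (\<lambda>x. of_bool (x = w)) * a w u * f u)" by (rule
          sum.swap)
      also have "\<dots> = (\<Sum>u | king u. b u * f u)"
        by (intro sum.cong refl) (simp add: b_def sum_distrib_right)
      finally show ?thesis .
    qed
    have word_props: "straight_tensor (fword L hw_tensor)" "w \<notin> Words \<Longrightarrow> fword L hw_tensor w = 0"
      if "set L \<subseteq> Pset n - Aset n" for L w
      using that fword_straight hw_tensor_span_outside[of "fword L hw_tensor" w]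
      by (auto simp: fwords_def intro!: tensor.span_base)
    have "\<xi> y = (\<Sum>u | king u. b u * y u)"
      using y word_props by (intro \<xi>_formula) (auto simp: fwords_def)
    then have "\<exists>u. b u \<noteq> 0" using \<xi>_y by (metis (no_types, lifting) mult_zero_left sum.neutral
        zero_neq_one)
    then obtain u0 where "b u0 \<noteq> 0" ..
    moreover have "king u" if "b u \<noteq> 0" for u using that by (simp add: b_def split: if_splits)
    ultimately obtain d where d: "d \<in> initial_exponents" "(\<Sum>u | king u. b u * f_power n act d
        hw_tensor u) \<noteq> 0"
      using functional_nonzero_on_f_power[of b u0] by blast
    have L: "set (concat (map (\<lambda>ij. replicate (Poly_Mapping.lookup d ij) ij) (root_list n))) \<subseteq>
        Pset n - Aset n"
      by (auto simp: set_root_list)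
    have "\<xi> (f_power n act d hw_tensor) = (\<Sum>u | king u. b u * f_power n act d hw_tensor u)"
      unfolding f_power_eq_foldr by (intro \<xi>_formula word_props[OF L])
    then show False using \<xi>_zero[OF d(1)] d(2) by simp
  qed
qed

end

theorem lemma1p8p2:
  fixes n :: nat
    and lt :: "mono \<Rightarrow> mono \<Rightarrow> bool"
    and lam :: weight
    and scale :: "complex \<Rightarrow> 'v::ab_group_add \<Rightarrow> 'v"
    and \<rho> :: "complex mat \<Rightarrow> 'v \<Rightarrow> 'v"
    and v :: 'v
  assumes "n \<ge> 1"
    and "total_monomial_order n lt"
    and "sagbi_basis lt (Ralg n) (Ddet ` Theta n)"
    and "dominant_weight n lam"
    and "irreducible_highest_weight_representation scale n \<rho> lam v"
  shows "basis_family scale (\<lambda>d. f_power n \<rho> d v)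
           {d \<in> monomials n. monomial d \<in> initial_space lt (R_component n lam)}"
proof -
  obtain hs where hs: "list_shape n hs" "column_shape.total_weight n (length hs) ((!) hs) = lam"
    using dominant_weight_shape[OF assms(4)] .
  interpret S: ordered_shape n hs lt
    using hs(1) assms(2) by (intro ordered_shape.intro ordered_shape_axioms.intro)
  have lam: "lam i = S.shape_weight i" if "i \<in> {1..int n}" for i
    using fun_cong[OF hs(2), of i] that by (simp add: S.total_weight_def)
  interpret irreducible_highest_weight_representation scale n \<rho> lam v by (rule assms(5))
  interpret comparison scale n \<rho> lam v tensor_scale S.act S.inner_form S.hw_tensor
    by (intro comparison.intro assms(5) S.tensor_contravariant lam)
  let ?L = "\<lambda>d. concat (map (\<lambda>ij. replicate (Poly_Mapping.lookup d ij) ij) (root_list n))"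
  have L: "set (?L d) \<subseteq> Pset n - Aset n" for d by (auto simp: set_root_list)
  \<comment> \<open>A relation between the f^d v passes to the f^d t, where independence is
    known.\<close>
  have indep: "\<forall>d\<in>F. c d = 0" if F: "finite F" "F \<subseteq> S.initial_exponents"
    and zero: "(\<Sum>d\<in>F. scale (c d) (f_power n \<rho> d v)) = 0" for F c
  proof (rule S.f_powers_independent[OF F])
    show "(\<Sum>d\<in>F. tensor_scale (c d) (f_power n S.act d S.hw_tensor)) = 0"
      using zero unfolding f_power_eq_foldr by (rule transfer_relation[OF L])
  qed
  have "span ((\<lambda>d. f_power n \<rho> d v) ` S.initial_exponents) = UNIV"
    unfolding f_power_eq_foldr
    by (rule transfer_spanning[OF L]) (rule S.f_powers_span[unfolded f_power_eq_foldr])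
  then have "basis_family scale (\<lambda>d. f_power n \<rho> d v) S.initial_exponents"
    using family_independentI[OF indep] by (simp add: basis_family_def)
  then show ?thesis unfolding S.initial_exponents_def hs(2) .
qed

end
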